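(* Let $\ell_1,\ell_2\ge 1$ and $\delta>0$. (1) If $(\ell_1,\ell_2)\in Q_+$, then for every $f\in\mathscr W_\delta$ the sequence of renormalizations $\{R^nf\}_{n\ge 0}$ is bounded. (2) If $(\ell_1,\ell_2)\in Q_-$, then for every $f\in\mathscr W_\delta$ the sequence $\{R^nf\}_{n\ge 0}$ is either bounded or degenerate. In particular, there exists $K_\delta>0$ (depending, for the fixed exponents $\ell_1,\ell_2$ and the fixed eigenbasis, only on $\delta$) such that for every $f\in\mathscr W_\delta$ with $C_u(0)\ge K_\delta$ the sequence $\{R^nf\}_{n\ge 0}$ is degenerate.
   Context: **Maps.** Fix real numbers $\ell_1,\ell_2\ge1$ (critical exponents). $\mathrm{Diff}^2([0,1])$ is the space of $C^2$ orientation preserving diffeomorphisms of $[0,1]$. $\mathscr L$ is the set of tuples $f=(x_1,x_2,x_3,x_4,s,\varphi,\varphi^l,\varphi^r)$ with $x_1<0<x_3<x_4<1$, $0<x_2<1$, $0<s<1$, $\varphi,\varphi^l,\varphi^r\in\mathrm{Diff}^2([0,1])$; such a tuple represents the map $f:[x_1,1]\to[x_1,1]$ given by $f(x)=(1-x_2)\,q_s\circ\varphi(1-x/x_1)+x_2$ on $[x_1,0)$; $f(x)=x_1\big(\varphi^l(\tfrac{x_3-x}{x_3})\big)^{\ell_1}$ on $[0,x_3]$; $f(x)=0$ on $(x_3,x_4)$; $f(x)=x_2\big(\varphi^r(\tfrac{x-x_4}{1-x_4})\big)^{\ell_2}$ on $[x_4,1]$; where $q_s(x)=\frac{[(1-s)x+s]^{\ell_2}-s^{\ell_2}}{1-s^{\ell_2}}$.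 Identifying $x_1$ with $1$ gives a circle map with flat interval $U_f=[x_3,x_4]$. **Renormalization.** $f$ is renormalizable if $0<x_2<x_3$. Then $Rf$ is the first return map of $f$ to $[x_1,x_2]$ conjugated by $h(x)=x/x_1$. It is again represented by a tuple in $\mathscr L$, with the roles of $\ell_1$ and $\ell_2$ interchanged (including in $q_s$): $Rf:[\tilde x_1,1]\to[\tilde x_1,1]$ is given by $Rf(x)=(1-\tilde x_2)\,\tilde q_{\tilde s}\circ\tilde\varphi(1-x/\tilde x_1)+\tilde x_2$ on $[\tilde x_1,0)$; $Rf(x)=\tilde x_1\big(\tilde\varphi^l(\tfrac{\tilde x_3-x}{\tilde x_3})\big)^{\ell_2}$ on $[0,\tilde x_3]$; $Rf(x)=0$ on $(\tilde x_3,\tilde x_4)$; $Rf(x)=\tilde x_2\big(\tilde\varphi^r(\tfrac{x-\tilde x_4}{1-\tilde x_4})\big)^{\ell_1}$ on $[\tilde x_4,1]$; where $\tilde q_s(x)=\frac{[(1-s)x+s]^{\ell_1}-s^{\ell_1}}{1-s^{\ell_1}}$, and the representing tuple is $(\tilde x_1,\dots,\tilde x_4,\tilde s,\tilde\varphi,\tilde\varphi^l,\tilde\varphi^r)$ with $\tilde x_1=x_2/x_1$, $\tilde x_2=(\varphi^l(\tfrac{x_3-x_2}{x_3}))^{\ell_1}$, $\tilde x_3=1-(q_s\circ\varphi)^{-1}(\tfrac{x_4-x_2}{1-x_2})$, $\tilde x_4=1-(q_s\circ\varphi)^{-1}(\tfrac{x_3-x_2}{1-x_2})$, $\tilde s=\varphi^l(\tfrac{x_3-x_2}{x_3})$,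 $\tilde\varphi=Z_{[\frac{x_3-x_2}{x_3},1]}\varphi^l$, $\tilde\varphi^l=\varphi^r\circ Z_{[1-\tilde x_3,1]}(q_s\circ\varphi)$, $\tilde\varphi^r=Z_{[0,\frac{x_3-x_2}{x_3}]}\varphi^l\circ Z_{[0,1-\tilde x_4]}(q_s\circ\varphi)$, where for $I=[a,b]\subset[0,1]$, $Z_I\psi(x)=\frac{\psi((b-a)x+a)-\psi(a)}{\psi(b)-\psi(a)}$. $\mathscr W$ (Fibonacci maps) is the set of $f\in\mathscr L$ such that $R^nf$ is renormalizable for all $n\ge0$, and for $\delta>0$, $\mathscr W_\delta=\{f\in\mathscr W: |\varphi|_{C^2}+|\varphi^l|_{C^2}+|\varphi^r|_{C^2}<\delta\}$. A subscript $n$ denotes the data of $R^nf$. Put $\ell_n=\ell_1$ for $n$ even and $\ell_n=\ell_2$ for $n$ odd as index convention for the exponents at level $n$. **Scaling ratios.** $S_{1,n}=\frac{x_{3,n}-x_{2,n}}{x_{3,n}}$, $S_{2,n}=\frac{1-x_{4,n}}{1-x_{2,n}}$, $S_{3,n}=\frac{x_{3,n}}{1-x_{4,n}}$, $S_{4,n}=\frac{x_{2,n}}{-x_{1,n}}$, $S_{5,n}=s_n^{\ell_2-1}$ for $n$ even, $S_{5,n}=s_n^{\ell_1-1}$ for $n$ odd, and $w_n=(\log S_{2,n},\log S_{3,n},\log S_{4,n},\log S_{5,n})^T$. **Matrix and coordinates.** For $i=1,2$ let $$L_i=\begin{pmatrix}1+\frac1{\ell_i}&1&0&-1\\-\frac1{\ell_i}&-1&0&1\\1&0&-1&0\\1-\frac1{\ell_i}&0&0&0\end{pmatrix},\qquad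 L_{even}=L_2L_1.$$ The eigenvalues of $L_{even}$ are $\lambda_1=1$, $\lambda_0=0$, $\lambda_s\in(0,1)$ and $\lambda_u>0$, with $\lambda_{u}$ and $\lambda_s$ equal to $\frac{1}{2\ell_1\ell_2}\big\{1+\ell_1+\ell_2\pm\sqrt{\ell_1^2+\ell_2^2+2\ell_1+2\ell_2-2\ell_1\ell_2+1}\big\}$ ($+$ for $\lambda_u$, $-$ for $\lambda_s$). Fix a basis of eigenvectors $E_u,E_s,E_1,E_0$ for $\lambda_u,\lambda_s,\lambda_1,\lambda_0$, with $E_1=(0,0,1,0)$ and $E_u=(e^u_2,e^u_3,e^u_4,e^u_5)$ oriented so that $e^u_2<0$. Define $C_u(n),C_s(n),C_1(n),C_0(n)$ by $w_{2n}=C_u(n)E_u+C_s(n)E_s+C_1(n)E_1+C_0(n)E_0$. **Bounded/degenerate.** $\{R^nf\}$ is bounded if $\limsup_{n\to\infty}C_u(n)<\infty$ and degenerate if $\limsup_{n\to\infty}C_u(n)=\infty$. **Regions.** Let $Q=[1,\infty)\times[1,\infty)$ and let $\Gamma\subset Q$ be the curve $\lambda_u(\ell_1,\ell_2)=1$. $Q\setminus\Gamma$ has two connected components: $Q_-$, on which $\lambda_u>1$, and $Q_+$, on which $\lambda_u<1$.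
   Formalization: Renormalization is the conjugated first return map; the displayed formula for its right diffeomorphism is corrected by inserting the reflection x -> 1-x on both sides of the zoomed q_s∘φ, without which the tuple does not represent the first return map. *)

theory Defs
  imports "HOL-Analysis.Analysis"
begin

section \<open>Diffeomorphisms of the unit interval\<close>

text \<open>Derivatives on \<open>[0,1]\<close> are one-sided at the endpoints; values of functions outside
  \<open>[0,1]\<close> never matter.\<close>

definition D01 :: "(real \<Rightarrow> real) \<Rightarrow> real \<Rightarrow> real" where
  "D01 f x = vector_derivative f (at x within {0..1})"

definition C2_01 :: "(real \<Rightarrow> real) \<Rightarrow> bool" where
  "C2_01 f \<longleftrightarrow> f differentiable_on {0..1} \<and> D01 f differentiable_on {0..1}
     \<and> continuous_on {0..1} (D01 (D01 f))"

definition Diff2 :: "(real \<Rightarrow> real) set" where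
  "Diff2 = {\<phi>. bij_betw \<phi> {0..1} {0..1} \<and> strict_mono_on {0..1} \<phi>
     \<and> C2_01 \<phi> \<and> C2_01 (inv_into {0..1} \<phi>)}"

definition C2_norm :: "(real \<Rightarrow> real) \<Rightarrow> real" where
  "C2_norm f = (SUP x\<in>{0..1}. \<bar>f x\<bar>) + (SUP x\<in>{0..1}. \<bar>D01 f x\<bar>)
     + (SUP x\<in>{0..1}. \<bar>D01 (D01 f) x\<bar>)"

section \<open>Circle maps with a flat interval\<close>

record flat_map =
  x1_of :: real
  x2_of :: real
  x3_of :: real
  x4_of :: real
  s_of :: real
  phi_of :: "real \<Rightarrow> real"
  phil_of :: "real \<Rightarrow> real"
  phir_of :: "real \<Rightarrow> real"

definition LL :: "flat_map set" where
  "LL = {f. x1_of f < 0 \<and> 0 < x3_of f \<and> x3_of f < x4_of f \<and> x4_of f < 1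
     \<and> 0 < x2_of f \<and> x2_of f < 1 \<and> 0 < s_of f \<and> s_of f < 1
     \<and> phi_of f \<in> Diff2 \<and> phil_of f \<in> Diff2 \<and> phir_of f \<in> Diff2}"

definition qmap :: "real \<Rightarrow> real \<Rightarrow> real \<Rightarrow> real" where
  "qmap b s x = (((1 - s) * x + s) powr b - s powr b) / (1 - s powr b)"

text \<open>The map on \<open>[x\<^sub>1,1]\<close> represented by a tuple. The exponent \<open>a\<close> belongs to the left, and \<open>b\<close>
  to the right boundary point of the flat interval.\<close>

definition to_map :: "real \<Rightarrow> real \<Rightarrow> flat_map \<Rightarrow> real \<Rightarrow> real" where
  "to_map a b f x =
    (if x < 0 then (1 - x2_of f) * qmap b (s_of f) (phi_of f (1 - x / x1_of f)) + x2_of f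
     else if x \<le> x3_of f then x1_of f * phil_of f ((x3_of f - x) / x3_of f) powr a
     else if x < x4_of f then 0
     else x2_of f * phir_of f ((x - x4_of f) / (1 - x4_of f)) powr b)"

section \<open>Renormalization\<close>

definition renormalizable :: "flat_map \<Rightarrow> bool" where
  "renormalizable f \<longleftrightarrow> 0 < x2_of f \<and> x2_of f < x3_of f"

definition zoom :: "real \<Rightarrow> real \<Rightarrow> (real \<Rightarrow> real) \<Rightarrow> real \<Rightarrow> real" where
  "zoom a b \<psi> x = (\<psi> ((b - a) * x + a) - \<psi> a) / (\<psi> b - \<psi> a)"

text \<open>The result is to be read with the exponents interchanged, i.e. as \<^term>\<open>to_map b a\<close>.
  The branch on \<open>[x\<^sub>1,0)\<close> is increasing and the one on \<open>[0,x\<^sub>3]\<close> is written in the reflected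
  coordinate \<open>(x\<^sub>3 - x)/x\<^sub>3\<close>. Composing them in the last component therefore needs the
  reflection \<open>x \<mapsto> 1 - x\<close> on both sides of the zoomed \<open>q\<^sub>s \<circ> \<phi>\<close>. Lemma
  \<open>renorm_first_return\<close> below confirms that this tuple represents the first return map.\<close>

definition renorm :: "real \<Rightarrow> real \<Rightarrow> flat_map \<Rightarrow> flat_map" where
  "renorm a b f =
    (let t = (x3_of f - x2_of f) / x3_of f;
         g = qmap b (s_of f) \<circ> phi_of f;
         y3 = 1 - inv_into {0..1} g ((x4_of f - x2_of f) / (1 - x2_of f));
         y4 = 1 - inv_into {0..1} g ((x3_of f - x2_of f) / (1 - x2_of f))
     in \<lparr> x1_of = x2_of f / x1_of f,
          x2_of = phil_of f t powr a,
          x3_of = y3,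
          x4_of = y4,
          s_of = phil_of f t,
          phi_of = zoom t 1 (phil_of f),
          phil_of = phir_of f \<circ> zoom (1 - y3) 1 g,
          phir_of = (\<lambda>x. zoom 0 t (phil_of f) (1 - zoom 0 (1 - y4) g (1 - x))) \<rparr>)"

definition first_return :: "('a \<Rightarrow> 'a) \<Rightarrow> 'a set \<Rightarrow> 'a \<Rightarrow> 'a" where
  "first_return F I x = (F ^^ (LEAST k. 0 < k \<and> (F ^^ k) x \<in> I)) x"

lemma Diff2_props:
  assumes "\<phi> \<in> Diff2"
  shows "\<phi> 0 = 0" "\<phi> 1 = 1"
    "\<And>x. 0 \<le> x \<Longrightarrow> x \<le> 1 \<Longrightarrow> 0 \<le> \<phi> x \<and> \<phi> x \<le> 1"
    "\<And>x y. 0 \<le> x \<Longrightarrow> x < y \<Longrightarrow> y \<le> 1 \<Longrightarrow> \<phi> x < \<phi> y"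
    "\<phi> ` {0..1} = {0..1}"
proof -
  have im: "\<phi> ` {0..1} = {0..1}" and sm: "strict_mono_on {0..1} \<phi>"
    using assms by (auto simp: Diff2_def bij_betw_def)
  show rng: "0 \<le> \<phi> x \<and> \<phi> x \<le> 1" if "0 \<le> x" "x \<le> 1" for x
    using im that by (metis atLeastAtMost_iff imageI)
  show mono: "\<phi> x < \<phi> y" if "0 \<le> x" "x < y" "y \<le> 1" for x y
    using sm that by (auto simp: strict_mono_on_def)
  show "\<phi> ` {0..1} = {0..1}" by (fact im)
  obtain z where "z \<in> {0..1}" "\<phi> z = 0"
    using im by (metis atLeastAtMost_iff imageE order_refl zero_le_one)
  then show "\<phi> 0 = 0" using mono[of 0 z] rng[of 0] by (cases "z = 0") auto
  obtain z where "z \<in> {0..1}" "\<phi> z = 1"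
    using im by (metis atLeastAtMost_iff imageE order_refl zero_le_one)
  then show "\<phi> 1 = 1" using mono[of z 1] rng[of 1] by (cases "z = 1") auto
qed

lemma qmap_props:
  assumes "0 < s" "s < 1" "1 \<le> b"
  shows "qmap b s 0 = 0" "qmap b s 1 = 1"
    "\<And>x y. 0 \<le> x \<Longrightarrow> x < y \<Longrightarrow> y \<le> 1 \<Longrightarrow> qmap b s x < qmap b s y"
    "qmap b s ` {0..1} = {0..1}"
proof -
  have sb: "s powr b < 1" using assms powr_less_mono2[of b s 1] by simp
  show q0: "qmap b s 0 = 0" by (simp add: qmap_def)
  show q1: "qmap b s 1 = 1" using sb by (simp add: qmap_def)
  show mono: "qmap b s x < qmap b s y" if "0 \<le> x" "x < y" "y \<le> 1" for x y
    using assms that sb unfolding qmap_def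
    by (intro divide_strict_right_mono diff_strict_right_mono powr_less_mono2) auto
  have cont: "continuous_on {0..1} (qmap b s)"
    unfolding qmap_def using assms sb
    by (intro continuous_intros) (auto simp: add_nonneg_eq_0_iff)
  show "qmap b s ` {0..1} = {0..1}"
  proof
    show "qmap b s ` {0..1} \<subseteq> {0..1}"
    proof clarsimp
      fix x :: real assume "0 \<le> x" "x \<le> 1"
      then show "0 \<le> qmap b s x \<and> qmap b s x \<le> 1"
        using mono[of 0 x] mono[of x 1] q0 q1 by (cases "x = 0"; cases "x = 1") auto
    qed
    show "{0..1} \<subseteq> qmap b s ` {0..1}"
    proof
      fix y :: real assume "y \<in> {0..1}"
      then show "y \<in> qmap b s ` {0..1}"
        using IVT'[of "qmap b s" 0 y 1] q0 q1 cont by fastforce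
    qed
  qed
qed

text \<open>At \<open>x\<^sub>1\<close> and \<open>0\<close> the two sides agree only after the endpoints of the intervals are
  identified, so these two points are excluded.\<close>

lemma renorm_first_return:
  assumes L: "f \<in> LL" and a: "1 \<le> a" and b: "1 \<le> b" and R: "renormalizable f"
    and x: "x1_of f < x" "x \<le> x2_of f" "x \<noteq> 0"
  shows "to_map b a (renorm a b f) (x / x1_of f) =
    first_return (to_map a b f) {x1_of f..x2_of f} x / x1_of f"
proof -
  define x1 where "x1 = x1_of f"
  define x2 where "x2 = x2_of f"
  define x3 where "x3 = x3_of f"
  define x4 where "x4 = x4_of f"
  define s where "s = s_of f"
  define p where "p = phi_of f"
  define l where "l = phil_of f"
  define r where "r = phir_of f"
  define F where "F = to_map a b f"
  define I where "I = {x1..x2}"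
  define t where "t = (x3 - x2) / x3"
  define g where "g = qmap b s \<circ> p"
  define z3 where "z3 = inv_into {0..1} g ((x4 - x2) / (1 - x2))"
  define z4 where "z4 = inv_into {0..1} g ((x3 - x2) / (1 - x2))"
  define y where "y = x / x1"
  note defs = x1_def x2_def x3_def x4_def s_def p_def l_def r_def
  have o: "x1 < 0" "0 < x2" "x2 < x3" "x3 < x4" "x4 < 1" "0 < s" "s < 1"
    "p \<in> Diff2" "l \<in> Diff2" "r \<in> Diff2" and xx: "x1 < x" "x \<le> x2"
    using L R x by (auto simp: LL_def renormalizable_def defs)
  note P = Diff2_props[OF \<open>p \<in> Diff2\<close>] and Lp = Diff2_props[OF \<open>l \<in> Diff2\<close>]
    and Rp = Diff2_props[OF \<open>r \<in> Diff2\<close>] and Q = qmap_props[OF o(6,7) b]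
  have t: "0 < t" "t < 1" using o by (auto simp: t_def)
  have g01: "g 0 = 0" "g 1 = 1" using P Q by (auto simp: g_def)
  have gm: "g u < g v" if "0 \<le> u" "u < v" "v \<le> 1" for u v
    using P(3)[of u] P(3)[of v] P(4)[of u v] Q(3) that by (simp add: g_def)
  have gle: "g u \<le> g v \<longleftrightarrow> u \<le> v" if "0 \<le> u" "u \<le> 1" "0 \<le> v" "v \<le> 1" for u v
    using gm[of u v] gm[of v u] that by (metis less_eq_real_def not_less)
  have gi: "g ` {0..1} = {0..1}" unfolding g_def image_comp[symmetric] P(5) Q(4) ..
  have z3: "z3 \<in> {0..1}" "g z3 = (x4 - x2) / (1 - x2)"
  proof -
    have "(x4 - x2) / (1 - x2) \<in> g ` {0..1}" unfolding gi using o by simp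
    then show "z3 \<in> {0..1}" "g z3 = (x4 - x2) / (1 - x2)"
      unfolding z3_def by (rule inv_into_into, rule f_inv_into_f)
  qed
  have z4: "z4 \<in> {0..1}" "g z4 = (x3 - x2) / (1 - x2)"
  proof -
    have "(x3 - x2) / (1 - x2) \<in> g ` {0..1}" unfolding gi using o by simp
    then show "z4 \<in> {0..1}" "g z4 = (x3 - x2) / (1 - x2)"
      unfolding z4_def by (rule inv_into_into, rule f_inv_into_f)
  qed
  have z4pos: "0 < z4" using z4 g01 o by (cases "z4 = 0") auto
  have z31: "z3 < 1" using z3 g01 o by (cases "z3 = 1") (auto simp: divide_simps)
  have z43: "z4 < z3"
  proof -
    have "g z4 < g z3" unfolding z3 z4 using o by (intro divide_strict_right_mono) auto
    then show ?thesis using gle[of z3 z4] z3 z4 by auto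
  qed
  have ren: "renorm a b f = \<lparr> x1_of = x2 / x1, x2_of = l t powr a, x3_of = 1 - z3,
      x4_of = 1 - z4, s_of = l t, phi_of = zoom t 1 l, phil_of = r \<circ> zoom z3 1 g,
      phir_of = (\<lambda>x. zoom 0 t l (1 - zoom 0 z4 g (1 - x))) \<rparr>"
    by (simp add: renorm_def Let_def defs t_def g_def z3_def z4_def)
  have lt: "0 < l t" "l t < 1" using Lp(1,2) Lp(4)[of 0 t] Lp(4)[of t 1] t by auto
  have lta: "l t powr a < 1" using lt a powr_less_mono2[of a "l t" 1] by simp
  have le1: "u powr c \<le> 1" if "0 \<le> u" "u \<le> 1" "1 \<le> c" for u c :: real
    using powr_mono2[of c u 1] that by simp
  have neg: "x1 * u powr c \<in> I" if "0 \<le> u" "u \<le> 1" "1 \<le> c" for u c :: real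
    using le1[OF that] o mult_left_mono_neg[of "u powr c" 1 x1]
    by (auto simp: I_def mult_nonpos_nonneg intro: order_trans[of _ 0])
  show ?thesis
  proof (cases "0 < x")
    case True
    have v: "0 \<le> (x3 - x) / x3" "(x3 - x) / x3 \<le> 1" using True xx o by (auto simp: divide_simps)
    have Fx: "F x = x1 * l ((x3 - x) / x3) powr a"
      using True xx o by (simp add: F_def to_map_def defs)
    have "(LEAST k. 0 < k \<and> (F ^^ k) x \<in> I) = 1"
      using neg[OF _ _ a] Lp(3)[OF v] Fx by (intro Least_equality) auto
    then have ret: "first_return F I x = F x" by (simp add: first_return_def)
    have y: "y < 0" using True o by (simp add: y_def divide_pos_neg)
    have arg: "(1 - t) * (1 - y / (x2 / x1)) + t = (x3 - x) / x3"
      using o by (simp add: y_def t_def field_simps)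
    have "to_map b a (renorm a b f) y =
      (1 - l t powr a) * qmap a (l t) (zoom t 1 l (1 - y / (x2 / x1))) + l t powr a"
      using y by (simp add: to_map_def ren)
    also have "zoom t 1 l (1 - y / (x2 / x1)) = (l ((x3 - x) / x3) - l t) / (1 - l t)"
      unfolding zoom_def arg using Lp by simp
    also have "qmap a (l t) \<dots> = (l ((x3 - x) / x3) powr a - l t powr a) / (1 - l t powr a)"
      using lt by (simp add: qmap_def)
    finally have "to_map b a (renorm a b f) y = l ((x3 - x) / x3) powr a"
      using lta by simp
    then show ?thesis using ret Fx o by (simp add: y_def F_def I_def defs)
  next
    case False
    then have xn: "x < 0" using x by simp
    have y: "0 < y" "y < 1" using xn xx o by (auto simp: y_def divide_simps)
    define X where "X = F x"
    have X: "X = (1 - x2) * g (1 - y) + x2"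
      using xn by (simp add: X_def F_def to_map_def g_def y_def defs)
    have g1y: "0 < g (1 - y)" "g (1 - y) < 1"
      using gm[of 0 "1 - y"] gm[of "1 - y" 1] g01 y by auto
    have Xr: "x2 < X" "X < 1"
    proof -
      show "x2 < X" using g1y o by (simp add: X)
      have "(1 - x2) * g (1 - y) < (1 - x2) * 1" using g1y o by (intro mult_strict_left_mono) auto
      then show "X < 1" by (simp add: X)
    qed
    have X3: "X \<le> x3 \<longleftrightarrow> 1 - z4 \<le> y"
    proof -
      have "X \<le> x3 \<longleftrightarrow> g (1 - y) \<le> g z4"
        unfolding z4 X using o by (simp add: field_simps)
      also have "\<dots> \<longleftrightarrow> 1 - y \<le> z4" using y z4(1) by (intro gle) auto
      finally show ?thesis by auto
    qed
    have X4: "x4 \<le> X \<longleftrightarrow> y \<le> 1 - z3"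
    proof -
      have "x4 \<le> X \<longleftrightarrow> g z3 \<le> g (1 - y)"
        unfolding z3 X using o by (simp add: field_simps)
      also have "\<dots> \<longleftrightarrow> z3 \<le> 1 - y" using y z3(1) by (intro gle) auto
      finally show ?thesis by auto
    qed
    have FX: "F X = (if X \<le> x3 then x1 * l ((x3 - X) / x3) powr a else if X < x4 then 0
        else x2 * r ((X - x4) / (1 - x4)) powr b)"
      using Xr o by (simp add: F_def to_map_def defs)
    have FI: "F X \<in> I"
    proof -
      consider "X \<le> x3" | "x3 < X" "X < x4" | "x3 < X" "x4 \<le> X" by linarith
      then show ?thesis
      proof cases
        case 1
        have "0 \<le> (x3 - X) / x3" "(x3 - X) / x3 \<le> 1" using 1 Xr o by (auto simp: divide_simps)
        then show ?thesis using 1 FX neg[OF _ _ a] Lp(3) by simp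
      next
        case 2
        then show ?thesis using FX o by (simp add: I_def)
      next
        case 3
        have "0 \<le> (X - x4) / (1 - x4)" "(X - x4) / (1 - x4) \<le> 1"
          using 3 Xr o by (auto simp: divide_simps)
        then have "0 \<le> r ((X - x4) / (1 - x4)) powr b" "r ((X - x4) / (1 - x4)) powr b \<le> 1"
          using Rp(3) le1[OF _ _ b] by auto
        then have "x2 * r ((X - x4) / (1 - x4)) powr b \<le> x2" 
            "0 \<le> x2 * r ((X - x4) / (1 - x4)) powr b"
          using o by (auto intro: mult_left_le)
        moreover have "F X = x2 * r ((X - x4) / (1 - x4)) powr b" using 3 FX by simp
        ultimately show ?thesis using o unfolding I_def atLeastAtMost_iff by linarith
      qed
    qed
    have "(LEAST k. 0 < k \<and> (F ^^ k) x \<in> I) = 2"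
    proof (rule Least_equality)
      show "0 < (2::nat) \<and> (F ^^ 2) x \<in> I" using FI by (simp add: X_def numeral_2_eq_2)
      fix k assume k: "0 < k \<and> (F ^^ k) x \<in> I"
      have "k \<noteq> 1" using k Xr by (auto simp: X_def I_def)
      then show "2 \<le> k" using k by linarith
    qed
    then have ret: "first_return F I x = F X" by (simp add: first_return_def X_def numeral_2_eq_2)
    have "to_map b a (renorm a b f) y = F X / x1"
    proof -
      consider "X \<le> x3" | "x3 < X" "X < x4" | "x3 < X" "x4 \<le> X" by linarith
      then show ?thesis
      proof cases
        case 1
        have y4: "1 - z4 \<le> y" using X3 1 by simp
        have ny: "\<not> y \<le> 1 - z3" using y4 z43 by simp
        have u: "1 - (y - (1 - z4)) / z4 = (1 - y) / z4" using z4pos by (simp add: field_simps)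
        have "to_map b a (renorm a b f) y =
          l t powr a * (zoom 0 t l (1 - zoom 0 z4 g ((1 - y) / z4))) powr a"
          using y y4 ny u by (simp add: to_map_def ren)
        also have "zoom 0 z4 g ((1 - y) / z4) = (X - x2) / (x3 - x2)"
          using z4pos o by (simp add: zoom_def g01 z4 X)
        also have "t * (1 - (X - x2) / (x3 - x2)) = (x3 - X) / x3"
          using o by (simp add: t_def divide_simps)
        then have "zoom 0 t l (1 - (X - x2) / (x3 - x2)) = l ((x3 - X) / x3) / l t"
          by (simp add: zoom_def Lp)
        also have "l t powr a * (l ((x3 - X) / x3) / l t) powr a = l ((x3 - X) / x3) powr a"
        proof -
          have "0 \<le> (x3 - X) / x3" "(x3 - X) / x3 \<le> 1" using 1 Xr o by (auto simp: divide_simps)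
          then show ?thesis using Lp(3) lt by (simp add: powr_divide)
        qed
        finally show ?thesis using 1 FX o by simp
      next
        case 2
        have "\<not> 1 - z4 \<le> y" "\<not> y \<le> 1 - z3" using X3 X4 2 by auto
        then show ?thesis using FX 2 y by (simp add: to_map_def ren)
      next
        case 3
        have y3: "y \<le> 1 - z3" using X4 3 by simp
        have arg: "(1 - z3) * ((1 - z3 - y) / (1 - z3)) + z3 = 1 - y" using z31 by simp
        have "to_map b a (renorm a b f) y =
          x2 / x1 * r (zoom z3 1 g ((1 - z3 - y) / (1 - z3))) powr b"
          using y y3 by (simp add: to_map_def ren)
        also have "zoom z3 1 g ((1 - z3 - y) / (1 - z3)) = (X - x4) / (1 - x4)"
          unfolding zoom_def arg g01 z3 X using o by (simp add: divide_simps)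
        finally show ?thesis using 3 FX by simp
      qed
    qed
    then show ?thesis using ret by (simp add: y_def F_def I_def x1_def x2_def)
  qed
qed

definition lev :: "real \<Rightarrow> real \<Rightarrow> nat \<Rightarrow> real" where
  "lev l1 l2 n = (if even n then l1 else l2)"

primrec renorm_iter :: "real \<Rightarrow> real \<Rightarrow> nat \<Rightarrow> flat_map \<Rightarrow> flat_map" where
  "renorm_iter l1 l2 0 f = f"
| "renorm_iter l1 l2 (Suc n) f = renorm (lev l1 l2 n) (lev l1 l2 (Suc n)) (renorm_iter l1 l2 n f)"

definition Fibonacci_maps :: "real \<Rightarrow> real \<Rightarrow> flat_map set" where
  "Fibonacci_maps l1 l2 = {f \<in> LL. \<forall>n. renormalizable (renorm_iter l1 l2 n f)}"

definition Fibonacci_maps_bd :: "real \<Rightarrow> real \<Rightarrow> real \<Rightarrow> flat_map set" where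
  "Fibonacci_maps_bd l1 l2 \<delta> = {f \<in> Fibonacci_maps l1 l2.
     C2_norm (phi_of f) + C2_norm (phil_of f) + C2_norm (phir_of f) < \<delta>}"

section \<open>Scaling ratios\<close>

definition ratio2 :: "flat_map \<Rightarrow> real" where "ratio2 f = (1 - x4_of f) / (1 - x2_of f)"
definition ratio3 :: "flat_map \<Rightarrow> real" where "ratio3 f = x3_of f / (1 - x4_of f)"
definition ratio4 :: "flat_map \<Rightarrow> real" where "ratio4 f = x2_of f / (- x1_of f)"

definition ratio5 :: "real \<Rightarrow> flat_map \<Rightarrow> real" where "ratio5 b f = s_of f powr (b - 1)"

text \<open>At level \<open>n\<close> the exponent of the right boundary point, which enters \<^const>\<open>qmap\<close> and
  \<^const>\<open>ratio5\<close>, is the one of index \<open>n + 1\<close>. Component \<open>i\<close> of a vector in \<open>\<real>\<^sup>4\<close> corresponds to the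
  ratio with index \<open>i + 1\<close>.\<close>

definition wvec :: "real \<Rightarrow> real \<Rightarrow> flat_map \<Rightarrow> nat \<Rightarrow> real ^ 4" where
  "wvec l1 l2 f n = (let g = renorm_iter l1 l2 n f in
     vector [ln (ratio2 g), ln (ratio3 g), ln (ratio4 g), ln (ratio5 (lev l1 l2 (Suc n)) g)])"

definition Lmat :: "real \<Rightarrow> real ^ 4 ^ 4" where
  "Lmat l = vector
    [vector [1 + 1 / l, 1, 0, -1],
     vector [- (1 / l), -1, 0, 1],
     vector [1, 0, -1, 0],
     vector [1 - 1 / l, 0, 0, 0]]"

definition L_even :: "real \<Rightarrow> real \<Rightarrow> real ^ 4 ^ 4" where
  "L_even l1 l2 = Lmat l2 ** Lmat l1"

definition lambda_u :: "real \<Rightarrow> real \<Rightarrow> real" where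
  "lambda_u l1 l2 =
     (1 + l1 + l2 + sqrt (l1\<^sup>2 + l2\<^sup>2 + 2 * l1 + 2 * l2 - 2 * l1 * l2 + 1)) / (2 * l1 * l2)"

definition lambda_s :: "real \<Rightarrow> real \<Rightarrow> real" where
  "lambda_s l1 l2 =
     (1 + l1 + l2 - sqrt (l1\<^sup>2 + l2\<^sup>2 + 2 * l1 + 2 * l2 - 2 * l1 * l2 + 1)) / (2 * l1 * l2)"

definition eigenbasis ::
    "real \<Rightarrow> real \<Rightarrow> real ^ 4 \<Rightarrow> real ^ 4 \<Rightarrow> real ^ 4 \<Rightarrow> real ^ 4 \<Rightarrow> bool" where
  "eigenbasis l1 l2 Eu Es E1 E0 \<longleftrightarrow>
     distinct [Eu, Es, E1, E0] \<and> independent {Eu, Es, E1, E0} \<and>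
     L_even l1 l2 *v Eu = lambda_u l1 l2 *\<^sub>R Eu \<and>
     L_even l1 l2 *v Es = lambda_s l1 l2 *\<^sub>R Es \<and>
     L_even l1 l2 *v E1 = E1 \<and>
     L_even l1 l2 *v E0 = 0 \<and>
     E1 = vector [0, 0, 1, 0] \<and> Eu $ 1 < 0"

text \<open>Four independent vectors span \<open>\<real>\<^sup>4\<close>, so \<^const>\<open>representation\<close> yields the coordinate.\<close>

definition C_u ::
    "real \<Rightarrow> real \<Rightarrow> real ^ 4 \<Rightarrow> real ^ 4 \<Rightarrow> real ^ 4 \<Rightarrow> real ^ 4 \<Rightarrow> flat_map \<Rightarrow> nat \<Rightarrow> real" where
  "C_u l1 l2 Eu Es E1 E0 f n = representation {Eu, Es, E1, E0} (wvec l1 l2 f (2 * n)) Eu"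

definition bounded_renorm ::
    "real \<Rightarrow> real \<Rightarrow> real ^ 4 \<Rightarrow> real ^ 4 \<Rightarrow> real ^ 4 \<Rightarrow> real ^ 4 \<Rightarrow> flat_map \<Rightarrow> bool" where
  "bounded_renorm l1 l2 Eu Es E1 E0 f \<longleftrightarrow>
     limsup (\<lambda>n. ereal (C_u l1 l2 Eu Es E1 E0 f n)) < \<infinity>"

definition degenerate_renorm ::
    "real \<Rightarrow> real \<Rightarrow> real ^ 4 \<Rightarrow> real ^ 4 \<Rightarrow> real ^ 4 \<Rightarrow> real ^ 4 \<Rightarrow> flat_map \<Rightarrow> bool" where
  "degenerate_renorm l1 l2 Eu Es E1 E0 f \<longleftrightarrow>
     limsup (\<lambda>n. ereal (C_u l1 l2 Eu Es E1 E0 f n)) = \<infinity>"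

section \<open>Regions of critical exponents\<close>

definition Qset :: "(real \<times> real) set" where
  "Qset = {1..} \<times> {1..}"

definition Gamma_curve :: "(real \<times> real) set" where
  "Gamma_curve = {(l1, l2) \<in> Qset. lambda_u l1 l2 = 1}"

definition Q_minus :: "(real \<times> real) set" where
  "Q_minus = {(l1, l2) \<in> Qset - Gamma_curve. lambda_u l1 l2 > 1}"

definition Q_plus :: "(real \<times> real) set" where
  "Q_plus = {(l1, l2) \<in> Qset - Gamma_curve. lambda_u l1 l2 < 1}"

end

theory Submission
  imports Defs
begin

text \<open>All scaling data of all renormalizations of one Fibonacci map are ratios of lengths in a single
  picture, and a single real sequence decides between boundedness and degeneracy. The renormalized
  coordinate of level \<open>n\<close> is scaled back so that the interval \<open>[0,1]\<close>
  gets length \<open>P (n + 1)\<close>; then \<open>P (n + 3) / P (n + 1)\<close> is the critical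
  value \<open>x\<^sub>2\<close> of level \<open>n\<close>, and the end points
  \<open>x\<^sub>3\<close>, \<open>x\<^sub>4\<close> of the flat interval become lengths \<open>X
  (n + 1) < Y (n + 1)\<close>. The branches of the first return maps turn into functions \<open>F
  n\<close> raised to the power \<open>L n\<close>, and renormalization becomes the recursion
  \<open>F (n + 2) x = F n (- (F (n + 1) (- x)) powr L (n + 1))\<close>. This structure is the
  locale \<open>flat_tower\<close>, and \<open>fibonacci_tower\<close> shows that every Fibonacci
  map gives rise to one.

  In a tower the cross ratio is the right tool: powers with exponent at least one do not decrease
  it (\<open>xr_le_powr\<close>), and the two initial branches distort it by at most the
  exponential of a multiple of the length involved. The accumulated error is the increment of a
  function \<open>V n\<close> that satisfies the recursion \<open>V (n + 2) x = V n (pull n x) - V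
  (n + 1) (- x)\<close>. These increments obey a conservation law (\<open>mass_step\<close>), so
  the total distortion is bounded at all levels (\<open>osc_bounded\<close>) and the part of it
  that sits in the gaps \<open>[X, Y]\<close> is summable. Cross ratios with their first point at
  the far edge of the flat interval then give the a priori bounds \<open>u n = P (n + 2) / P n
  \<le> 1 - \<eta>\<close> and \<open>X n \<le> R * P (n + 2)\<close>.

  With \<open>e n = P (n + 1) / P n\<close> and \<open>h n = u n powr (1 / L (n + 1)) = (e n * e
  (n + 1)) powr (1 / L (n + 1))\<close> the question becomes one about recursive inequalities. If
  \<open>1 / L 0 + 1 / L 1 < 1\<close>, the lower bound \<open>c * h (k + 3) \<le> e (k +
  5)\<close> is a contraction for \<open>- ln e\<close>, so \<open>u\<close> is bounded below
  (\<open>u_bounded_below\<close>). If the sum is larger than one, suppose \<open>u\<close> were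
  bounded below. Then every gap occupies a definite part of its surroundings, and the summability
  of the distortion in the gaps forces the distortion to tend to zero altogether
  (\<open>osc_tendsto_0\<close>). The nearly undistorted recursion \<open>near_recursion\<close>
  has, however, no solution bounded away from zero and infinity
  (\<open>no_bounded_solution\<close>), so \<open>u\<close> is not bounded below
  (\<open>u_not_bounded_below\<close>).

  It remains to translate. The functional \<open>(1, c, 0, - c)\<close> with \<open>c = 1 / (l2 *
  \<lambda>\<^sub>u)\<close> is a left eigenvector of \<open>L_even\<close> that is negative on
  \<open>Eu\<close> and kills the other eigenvectors, so \<open>C_u\<close> is bounded above
  exactly when the quantity \<open>ln S\<^sub>2 + c * (ln S\<^sub>3 - ln S\<^sub>5)\<close> is
  bounded below. As \<open>x\<^sub>2\<close> is a power of \<open>s\<close> after one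
  renormalization, this quantity is bounded below if \<open>x\<^sub>2\<close> and \<open>1 -
  x\<^sub>4\<close> are, and a lower bound for it on the even levels gives one for
  \<open>x\<^sub>2\<close> on these levels. Since \<open>\<lambda>\<^sub>u < 1\<close> and
  \<open>\<lambda>\<^sub>u > 1\<close> mean \<open>1 / l1 + 1 / l2 < 1\<close> and \<open>1 / l1 +
  1 / l2 > 1\<close>, the maps are bounded for exponents in \<open>Q_plus\<close>, while for
  exponents in \<open>Q_minus\<close> all Fibonacci maps are degenerate, whatever the value of
  \<open>C_u\<close> at level zero.\<close>

section \<open>Cross ratios and power maps\<close>

text \<open>The cross ratio of four increasing points, normalized so that it compares the product
  of the middle and the whole interval with the product of the two outer intervals.\<close>

definition xr :: "real \<Rightarrow> real \<Rightarrow> real \<Rightarrow> real \<Rightarrow> real" where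
  "xr p q r s = (r - q) * (s - p) / ((q - p) * (s - r))"

lemma xr_minus: "xr (- s) (- r) (- q) (- p) = xr p q r s"
  by (simp add: xr_def mult.commute)

lemma xr_pos: "p < q \<Longrightarrow> q < r \<Longrightarrow> r < s \<Longrightarrow> 0 < xr p q r s"
  by (simp add: xr_def)

lemma frac_cross_le: "a / b \<le> c / d \<Longrightarrow> 0 < b \<Longrightarrow> 0 < d \<Longrightarrow> a * d \<le> c * (b :: real)"
  by (simp add: field_simps)

lemma frac_le_cross: "a * d \<le> c * b \<Longrightarrow> 0 < b \<Longrightarrow> 0 < d \<Longrightarrow> a / b \<le> c / (d :: real)"
  by (simp add: field_simps)

text \<open>With \<open>z = exp (2 * t)\<close> this is \<open>a * sinh t \<le> sinh (a *
  t)\<close>, which follows by differentiation from the monotonicity of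
  \<open>cosh\<close>.\<close>

lemma powr_sub_ge:
  fixes a z :: real
  assumes a: "1 \<le> a" and z: "1 \<le> z"
  shows "a * z powr ((a - 1) / 2) * (z - 1) \<le> z powr a - 1"
proof -
  define f where "f t = exp (a * t) - exp (- (a * t)) - a * (exp t - exp (- t))" for t :: real
  have "f 0 \<le> f t" if "0 \<le> t" for t
  proof (rule DERIV_nonneg_imp_nondecreasing[OF that])
    fix x :: real assume x: "0 \<le> x" "x \<le> t"
    have mono: "exp x + exp (- x) \<le> exp (a * x) + exp (- (a * x))"
      using x a cosh_real_nonneg_le_iff[of x "a * x"] mult_right_mono[of 1 a x]
      by (simp add: cosh_def field_simps)
    have "(f has_real_derivative a * (exp (a * x) + exp (- (a * x))) - a * (exp x + exp (- x))) (at x)"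
      unfolding f_def by (auto intro!: derivative_eq_intros simp: algebra_simps)
    moreover have "0 \<le> a * (exp (a * x) + exp (- (a * x))) - a * (exp x + exp (- x))"
      using mono a by (simp add: mult_left_mono)
    ultimately show "\<exists>y. (f has_real_derivative y) (at x) \<and> 0 \<le> y" by blast
  qed
  from this[of "ln z / 2"] z
  have 1: "a * (exp (ln z / 2) - exp (- (ln z / 2))) \<le> exp (a * (ln z / 2)) - exp (- (a * (ln z / 2)))"
    by (simp add: f_def)
  define w where "w = exp (a * (ln z / 2))"
  have w: "0 < w" by (simp add: w_def)
  have "w * (a * (exp (ln z / 2) - exp (- (ln z / 2)))) \<le> w * (w - exp (- (a * (ln z / 2))))"
    using 1 w unfolding w_def by (intro mult_left_mono) auto
  also have "w * (w - exp (- (a * (ln z / 2)))) = z powr a - 1"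
    using z by (simp add: w_def powr_def algebra_simps flip: exp_add)
  also have "w * (a * (exp (ln z / 2) - exp (- (ln z / 2)))) = a * z powr ((a - 1) / 2) * (z - 1)"
  proof -
    have "z powr ((a - 1) / 2) * z = exp ((a - 1) / 2 * ln z) * exp (ln z)"
      using z by (simp add: powr_def)
    also have "\<dots> = w * exp (ln z / 2)"
      unfolding w_def exp_add[symmetric] by (simp add: field_simps)
    finally have "w * exp (ln z / 2) = z powr ((a - 1) / 2) * z" by simp
    moreover have "w * exp (- (ln z / 2)) = z powr ((a - 1) / 2)"
      using z by (simp add: w_def powr_def field_simps flip: exp_add)
    ultimately show ?thesis by (simp add: algebra_simps)
  qed
  finally show ?thesis .
qed

text \<open>The integrated form of the negative Schwarzian derivative of \<open>x powr a\<close>: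
  the geometric mean of the derivatives at two points is at most the slope between them.\<close>

lemma powr_schwarz:
  fixes a x y :: real
  assumes a: "1 \<le> a" and x: "0 < x" "x \<le> y"
  shows "(a * x powr (a - 1)) * (a * y powr (a - 1)) * (y - x)\<^sup>2 \<le> (y powr a - x powr a)\<^sup>2"
proof -
  have "a * (y / x) powr ((a - 1) / 2) * (y / x - 1) \<le> (y / x) powr a - 1"
    using powr_sub_ge[of a "y / x"] a x by simp
  then have "x powr a * (a * (y / x) powr ((a - 1) / 2) * (y / x - 1)) \<le> x powr a * ((y / x) powr a - 1)"
    by (intro mult_left_mono) auto
  also have "\<dots> = y powr a - x powr a"
    using x by (simp add: powr_divide algebra_simps)
  finally have 1: "x powr a * (a * (y / x) powr ((a - 1) / 2) * (y / x - 1)) \<le> y powr a - x powr a" .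
  have 0: "0 \<le> x powr a * (a * (y / x) powr ((a - 1) / 2) * (y / x - 1))"
    using a x by (intro mult_nonneg_nonneg) (auto simp: field_simps)
  define w where "w = (y / x) powr ((a - 1) / 2)"
  have sq: "w\<^sup>2 = y powr (a - 1) / x powr (a - 1)"
    using x by (simp add: w_def power2_eq_square powr_divide flip: powr_add)
  have "(x powr a * (a * w * (y / x - 1)))\<^sup>2 = (x powr a)\<^sup>2 * a\<^sup>2 * w\<^sup>2 * ((y - x) / x)\<^sup>2"
    using x by (simp add: power_mult_distrib diff_divide_distrib)
  also have "\<dots> = (x powr a)\<^sup>2 * a\<^sup>2 * (y powr (a - 1) / x powr (a - 1)) * ((y - x) / x)\<^sup>2"
    by (simp add: sq)
  also have "\<dots> = (a * x powr (a - 1)) * (a * y powr (a - 1)) * (y - x)\<^sup>2"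
  proof -
    have "x powr a = x * x powr (a - 1)" using x powr_add[of x 1 "a - 1"] by simp
    then show ?thesis using x by (simp add: field_simps power2_eq_square)
  qed
  finally show ?thesis using power_mono[OF 1 0, of 2] by (simp add: w_def)
qed

text \<open>The cross ratio in the form \<open>(r - q) * (s - p) / ((r - p) * (s - q))\<close> is
  the one that the Schwarzian derivative controls. It is \<open>t / (1 + t)\<close> for the value
  \<open>t\<close> of \<open>xr\<close>, hence an increasing function of it. Its logarithm is a
  double difference of \<open>ln ((f y - f x) / (y - x))\<close>, whose mixed second derivative
  has the sign given by \<open>powr_schwarz\<close>.\<close>

lemma xr_le_powr:
  assumes a: "1 \<le> a" and p: "0 \<le> p" "p < q" "q < r" "r < s"
  shows "xr p q r s \<le> xr (p powr a) (q powr a) (r powr a) (s powr a)"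
proof -
  define f where "f x = x powr a" for x :: real
  have fm: "f x < f y" if "0 \<le> x" "x < y" for x y
    using that a by (simp add: f_def powr_less_mono2)
  define k where "k x y = 1 / (y - x) - a * x powr (a - 1) / (f y - f x)" for x y
  have kdec: "k x s \<le> k x r" if x: "0 < x" "x < r" for x
  proof (rule DERIV_nonpos_imp_nonincreasing[of r s "k x"])
    show "r \<le> s" using p by simp
    fix y assume y: "r \<le> y" "y \<le> s"
    have d: "0 < f y - f x" "0 < y - x" using fm[of x y] x y by auto
    have "((\<lambda>y. f y) has_real_derivative a * y powr (a - 1)) (at y)"
      unfolding f_def using x y by (auto intro!: derivative_eq_intros)
    then have "(k x has_real_derivative - 1 / (y - x)\<^sup>2 + a * x powr (a - 1) * (a * y powr (a - 1)) / (f y - f x)\<^sup>2) (at y)"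
      unfolding k_def using d by (auto intro!: derivative_eq_intros simp: power2_eq_square)
    moreover have "a * x powr (a - 1) * (a * y powr (a - 1)) / (f y - f x)\<^sup>2 \<le> 1 / (y - x)\<^sup>2"
      using powr_schwarz[OF a, of x y] x y d by (simp add: f_def field_simps)
    ultimately show "\<exists>z. (k x has_real_derivative z) (at y) \<and> z \<le> 0" by force
  qed
  define g where "g x = ln (f r - f x) - ln (r - x) - ln (f s - f x) + ln (s - x)" for x
  have "g p \<le> g q"
  proof (rule DERIV_nonneg_imp_increasing_open[of p q g])
    show "p \<le> q" using p by simp
    fix x assume x: "p < x" "x < q"
    have d: "0 < f r - f x" "0 < f s - f x" "0 < r - x" "0 < s - x"
      using fm[of x r] fm[of x s] x p by auto
    have "((\<lambda>x. f x) has_real_derivative a * x powr (a - 1)) (at x)"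
      unfolding f_def using x p by (auto intro!: derivative_eq_intros)
    then have "(g has_real_derivative k x r - k x s) (at x)"
      unfolding g_def k_def using d by (auto intro!: derivative_eq_intros simp: divide_inverse algebra_simps)
    moreover have "0 \<le> k x r - k x s" using kdec[of x] x p by simp
    ultimately show "\<exists>y. (g has_real_derivative y) (at x) \<and> 0 \<le> y" by blast
  next
    have "f x \<noteq> f r" "f x \<noteq> f s" if "p \<le> x" "x \<le> q" for x
      using fm[of x r] fm[of x s] that p by auto
    moreover have "continuous_on {p..q} f"
      unfolding f_def using a p by (intro continuous_on_powr' continuous_intros) auto
    ultimately show "continuous_on {p..q} g"
      unfolding g_def using p by (intro continuous_intros) fastforce+
  qed
  define A where "A x y = f y - f x" for x y
  have pos: "0 < A q r" "0 < A q s" "0 < A p r" "0 < A p s" "0 < A p q" "0 < A r s"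
    using fm p by (auto simp: A_def)
  have posd: "0 < r - q" "0 < s - q" "0 < r - p" "0 < s - p" "0 < q - p" "0 < s - r" using p by auto
  have "ln ((r - q) * (s - p) / ((r - p) * (s - q))) \<le> ln (A q r * A p s / (A p r * A q s))"
    using \<open>g p \<le> g q\<close> pos posd by (simp add: g_def A_def[symmetric] ln_mult ln_div)
  then have 1: "(r - q) * (s - p) / ((r - p) * (s - q)) \<le> A q r * A p s / (A p r * A q s)"
    using pos posd by (subst (asm) ln_le_cancel_iff) auto
  have id1: "(r - p) * (s - q) = (q - p) * (s - r) + (r - q) * (s - p)" by algebra
  have id2: "A p r * A q s = A p q * A r s + A q r * A p s" unfolding A_def by algebra
  have "(r - q) * (s - p) * (A p r * A q s) \<le> A q r * A p s * ((r - p) * (s - q))"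
    using frac_cross_le[OF 1] pos posd by simp
  then have "(r - q) * (s - p) * (A p q * A r s) \<le> A q r * A p s * ((q - p) * (s - r))"
    unfolding id1 id2 by (simp add: algebra_simps)
  then have "xr p q r s \<le> A q r * A p s / (A p q * A r s)"
    unfolding xr_def using pos posd by (intro frac_le_cross) auto
  then show ?thesis by (simp add: xr_def A_def f_def)
qed

section \<open>Maps with Lipschitz log-derivative\<close>

lemma DERIV_eq_on:
  assumes "(f has_real_derivative D) (at x within S)" "x \<in> S" "\<And>z. z \<in> S \<Longrightarrow> g z = f z"
  shows "(g has_real_derivative D) (at x within S)"
  using has_field_derivative_transform_within[OF assms(1) zero_less_one assms(2), of g] assms(3) by simp

text \<open>The class of maps that distort slopes of intervals of length \<open>l\<close> by at
  most \<open>exp (K * l)\<close>. It contains the \<open>C\<^sup>2\<close> diffeomorphisms, and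
  unlike these it is closed under \<open>C\<^sup>1\<close> gluing, which is needed at the critical
  value.\<close>

definition loglip :: "real \<Rightarrow> (real \<Rightarrow> real) \<Rightarrow> (real \<Rightarrow> real) \<Rightarrow> real \<Rightarrow> real \<Rightarrow> bool" where
  "loglip K f f' a b \<longleftrightarrow> 0 \<le> K \<and>
     (\<forall>x\<in>{a..b}. (f has_real_derivative f' x) (at x within {a..b}) \<and> 0 < f' x) \<and>
     (\<forall>x\<in>{a..b}. \<forall>y\<in>{a..b}. \<bar>ln (f' x) - ln (f' y)\<bar> \<le> K * \<bar>x - y\<bar>)"

lemma loglip_subset:
  assumes "loglip K f f' a b" "a \<le> a'" "b' \<le> b"
  shows "loglip K f f' a' b'"
proof -
  have "{a'..b'} \<subseteq> {a..b}" using assms by auto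
  then show ?thesis using assms(1) unfolding loglip_def
    by (meson DERIV_subset subsetD)
qed

lemma loglip_slope:
  assumes "loglip K f f' a b" "a \<le> x" "x < y" "y \<le> b"
  obtains z where "x < z" "z < y" "f y - f x = f' z * (y - x)"
proof -
  have d: "(f has_real_derivative f' z) (at z)" if "x < z" "z < y" for z
  proof -
    have "(f has_real_derivative f' z) (at z within {a..b})"
      using assms that by (auto simp: loglip_def)
    moreover have "at z within {a..b} = at z"
      using that assms by (intro at_within_interior) auto
    ultimately show ?thesis by simp
  qed
  have "continuous_on {x..y} f"
    by (rule continuous_on_subset[of "{a..b}"], rule DERIV_continuous_on[of _ _ f'])
       (use assms in \<open>auto simp: loglip_def\<close>)
  from MVT[OF \<open>x < y\<close> this] d obtain l z where
    z: "x < z" "z < y" "(f has_real_derivative l) (at z)" "f y - f x = (y - x) * l"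
    by (metis real_differentiable_def)
  have "l = f' z" using d z DERIV_unique by blast
  then show ?thesis using that z by (simp add: mult.commute)
qed

lemma loglip_strict_mono:
  assumes "loglip K f f' a b" "a \<le> x" "x < y" "y \<le> b"
  shows "f x < f y"
proof -
  obtain z where z: "x < z" "z < y" "f y - f x = f' z * (y - x)"
    using loglip_slope[OF assms] .
  then have "0 < f' z" using assms by (auto simp: loglip_def)
  then have "0 < f' z * (y - x)" using assms by simp
  then show ?thesis using z by linarith
qed

lemma loglip_continuous:
  assumes "loglip K f f' a b"
  shows "continuous_on {a..b} f"
  by (rule DERIV_continuous_on[of _ _ f']) (use assms in \<open>auto simp: loglip_def\<close>)

lemma loglip_ratio:
  assumes "loglip K f f' a b" "x \<in> {a..b}" "y \<in> {a..b}"
  shows "f' x \<le> exp (K * \<bar>x - y\<bar>) * f' y"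
proof -
  have p: "0 < f' x" "0 < f' y" using assms by (auto simp: loglip_def)
  have "ln (f' x) - ln (f' y) \<le> K * \<bar>x - y\<bar>"
    using assms unfolding loglip_def by (meson abs_le_D1)
  then have "exp (ln (f' x)) \<le> exp (K * \<bar>x - y\<bar> + ln (f' y))" by simp
  then show ?thesis using p by (simp add: exp_add)
qed

text \<open>The second slope is a weighted mean of the first one and of the slope over the added
  interval. Convexity of the exponential function gives an error that depends on the length of the
  added interval only, however long the first one is.\<close>

lemma loglip_slope_extend:
  assumes L: "loglip K f f' a b" and o: "a \<le> p" "p < q" "q < s" "s \<le> b"
  shows "(f q - f p) * (s - p) \<le> exp (K * (s - q)) * ((f s - f p) * (q - p))"
proof -
  obtain z where z: "p < z" "z < q" "f q - f p = f' z * (q - p)"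
    using loglip_slope[OF L, of p q] o by auto
  obtain w where w: "q < w" "w < s" "f s - f q = f' w * (s - q)"
    using loglip_slope[OF L, of q s] o by auto
  have pos: "0 < f' z" "0 < f' w" using L z w o by (auto simp: loglip_def)
  have KK: "0 \<le> K" using L by (simp add: loglip_def)
  have "f' z \<le> exp (K * \<bar>z - w\<bar>) * f' w" using z w o by (intro loglip_ratio[OF L]) auto
  also have "\<dots> \<le> exp (K * (s - p)) * f' w"
    using z w o pos(2) KK by (intro mult_right_mono iffD2[OF exp_le_cancel_iff] mult_left_mono) auto
  finally have "f' z \<le> exp (K * (s - p)) * f' w" .
  from mult_right_mono[OF this, of "exp (- (K * (s - p)))"]
  have "f' z * exp (- (K * (s - p))) \<le> exp (K * (s - p)) * f' w * exp (- (K * (s - p)))" by simp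
  also have "\<dots> = f' w" by (simp add: exp_minus)
  finally have le: "f' z * exp (- (K * (s - p))) \<le> f' w" .
  define t where "t = (s - q) / (s - p)"
  have t: "0 < t" "t < 1" using o by (auto simp: t_def field_simps)
  have "exp (- (K * (s - q))) = exp ((1 - t) *\<^sub>R 0 + t *\<^sub>R (- (K * (s - p))))"
    using o by (simp add: t_def)
  also have "\<dots> \<le> (1 - t) * exp 0 + t * exp (- (K * (s - p)))"
    using convex_onD[OF exp_convex, of t 0 "- (K * (s - p))"] t by simp
  finally have am: "exp (- (K * (s - q))) \<le> (1 - t) + t * exp (- (K * (s - p)))" by simp
  have "f' z * exp (- (K * (s - q))) \<le> f' z * ((1 - t) + t * exp (- (K * (s - p))))"
    using am pos by (intro mult_left_mono) auto
  also have "\<dots> \<le> (1 - t) * f' z + t * f' w"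
    using mult_left_mono[OF le, of t] t by (simp add: algebra_simps)
  also have "\<dots> = (f s - f p) / (s - p)"
  proof -
    have "1 - t = (q - p) / (s - p)" using o by (simp add: t_def field_simps)
    then have "(1 - t) * f' z + t * f' w = ((q - p) * f' z + (s - q) * f' w) / (s - p)"
      unfolding t_def by (simp add: add_divide_distrib)
    also have "(q - p) * f' z + (s - q) * f' w = f s - f p" using z(3) w(3) by (simp add: algebra_simps)
    finally show ?thesis .
  qed
  finally have "f' z * exp (- (K * (s - q))) * (s - p) \<le> f s - f p"
    using o by (simp add: pos_le_divide_eq)
  then have le2: "exp (K * (s - q)) * (f' z * exp (- (K * (s - q))) * (s - p)) \<le> exp (K * (s - q)) * (f s - f p)"
    by (intro mult_left_mono) auto
  have "f' z * (s - p) = exp (K * (s - q)) * (f' z * exp (- (K * (s - q))) * (s - p))"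
    by (simp add: exp_minus)
  also note le2
  finally have "f' z * (s - p) \<le> exp (K * (s - q)) * (f s - f p)" .
  then have "f' z * (s - p) * (q - p) \<le> exp (K * (s - q)) * (f s - f p) * (q - p)"
    using o by (intro mult_right_mono) auto
  then show ?thesis using z(3) by (simp add: mult.assoc mult.left_commute mult.commute)
qed

lemma loglip_adjacent:
  assumes L: "loglip K f f' a b" and o: "a \<le> q" "q < r" "r < s" "s \<le> b"
  shows "(r - q) * (f s - f r) \<le> exp (K * (s - q)) * ((f r - f q) * (s - r))"
    and "(s - r) * (f r - f q) \<le> exp (K * (s - q)) * ((f s - f r) * (r - q))"
proof -
  obtain z where z: "q < z" "z < r" "f r - f q = f' z * (r - q)"
    using loglip_slope[OF L, of q r] o by auto
  obtain w where w: "r < w" "w < s" "f s - f r = f' w * (s - r)"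
    using loglip_slope[OF L, of r s] o by auto
  have K: "0 \<le> K" using L by (simp add: loglip_def)
  have pos: "0 < f' z" "0 < f' w" using L z w o by (auto simp: loglip_def)
  have ab: "K * \<bar>w - z\<bar> \<le> K * (s - q)" "K * \<bar>z - w\<bar> \<le> K * (s - q)"
    using z w K by (auto intro!: mult_left_mono)
  have "f' w \<le> exp (K * \<bar>w - z\<bar>) * f' z" using z w o by (intro loglip_ratio[OF L]) auto
  also have "\<dots> \<le> exp (K * (s - q)) * f' z" using ab pos by (intro mult_right_mono) auto
  finally have 1: "f' w \<le> exp (K * (s - q)) * f' z" .
  have "f' z \<le> exp (K * \<bar>z - w\<bar>) * f' w" using z w o by (intro loglip_ratio[OF L]) auto
  also have "\<dots> \<le> exp (K * (s - q)) * f' w" using ab pos by (intro mult_right_mono) auto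
  finally have 2: "f' z \<le> exp (K * (s - q)) * f' w" .
  have n: "0 \<le> (r - q) * (s - r)" using o by simp
  show "(r - q) * (f s - f r) \<le> exp (K * (s - q)) * ((f r - f q) * (s - r))"
    unfolding z(3) w(3) using mult_right_mono[OF 1 n] by (simp add: mult.assoc mult.left_commute mult.commute)
  show "(s - r) * (f r - f q) \<le> exp (K * (s - q)) * ((f s - f r) * (r - q))"
    unfolding z(3) w(3) using mult_right_mono[OF 2 n] by (simp add: mult.assoc mult.left_commute mult.commute)
qed

lemma loglip_minus:
  assumes "loglip K f f' a b"
  shows "loglip K (\<lambda>x. - f (- x)) (\<lambda>x. f' (- x)) (- b) (- a)"
  unfolding loglip_def
proof (intro conjI ballI)
  show "0 \<le> K" using assms by (simp add: loglip_def)
  fix x assume x: "x \<in> {- b..- a}"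
  then have m: "- x \<in> {a..b}" by auto
  show "0 < f' (- x)" using assms m by (auto simp: loglip_def)
  have im: "uminus ` {- b..- a} = {a..b}" by auto
  have "(f has_real_derivative f' (- x)) (at (- x) within uminus ` {- b..- a})"
    unfolding im using assms m by (auto simp: loglip_def)
  moreover have "(uminus has_real_derivative -1) (at x within {- b..- a})"
    by (auto intro!: derivative_eq_intros)
  ultimately have "(f \<circ> uminus has_real_derivative f' (- x) * - 1) (at x within {- b..- a})"
    by (rule DERIV_image_chain)
  from DERIV_minus[OF this] show "((\<lambda>x. - f (- x)) has_real_derivative f' (- x)) (at x within {- b..- a})"
    by (simp add: o_def)
  fix y assume "y \<in> {- b..- a}"
  then have "- y \<in> {a..b}" by auto
  then have "\<bar>ln (f' (- x)) - ln (f' (- y))\<bar> \<le> K * \<bar>- x - - y\<bar>"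
    using assms m unfolding loglip_def by blast
  then show "\<bar>ln (f' (- x)) - ln (f' (- y))\<bar> \<le> K * \<bar>x - y\<bar>" by (simp add: abs_minus_commute)
qed

text \<open>The error involves the interval from \<open>q\<close> to \<open>s\<close> but not the
  first interval. This is what allows the first point to be moved to a pole, outside the
  domain.\<close>

lemma xr_loglip:
  assumes L: "loglip K f f' a b" and o: "a \<le> p" "p < q" "q < r" "r < s" "s \<le> b"
  shows "xr p q r s \<le> exp (2 * K * (s - q)) * xr (f p) (f q) (f r) (f s)"
proof -
  have m: "f p < f q" "f q < f r" "f r < f s"
    using loglip_strict_mono[OF L, of p q] loglip_strict_mono[OF L, of q r]
      loglip_strict_mono[OF L, of r s] o by auto
  let ?e = "exp (K * (s - q))"
  have 1: "(r - q) * (f s - f r) \<le> ?e * ((f r - f q) * (s - r))"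
    using loglip_adjacent(1)[OF L, of q r s] o by simp
  have 2: "(f q - f p) * (s - p) \<le> ?e * ((f s - f p) * (q - p))"
    using loglip_slope_extend[OF L, of p q s] o by simp
  have "((r - q) * (f s - f r)) * ((f q - f p) * (s - p))
      \<le> (?e * ((f r - f q) * (s - r))) * (?e * ((f s - f p) * (q - p)))"
    using o m by (intro mult_mono[OF 1 2]) auto
  also have "\<dots> = (?e * ?e) * ((f r - f q) * (f s - f p)) * ((q - p) * (s - r))"
    by algebra
  also have "?e * ?e = exp (2 * K * (s - q))" by (simp flip: exp_add)
  finally have "(r - q) * (s - p) * ((f q - f p) * (f s - f r))
      \<le> exp (2 * K * (s - q)) * ((f r - f q) * (f s - f p)) * ((q - p) * (s - r))"
    by (simp only: mult.assoc mult.left_commute mult.commute)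
  from frac_le_cross[OF this] show ?thesis unfolding xr_def using o m by simp
qed

lemma xr_loglip':
  assumes L: "loglip K f f' a b" and o: "a \<le> p" "p < q" "q < r" "r < s" "s \<le> b"
  shows "xr p q r s \<le> exp (2 * K * (r - p)) * xr (f p) (f q) (f r) (f s)"
proof -
  have "xr (- s) (- r) (- q) (- p) \<le> exp (2 * K * (- p - - r)) * xr (- f (- (- s))) (- f (- (- r))) (- f (- (- q))) (- f (- (- p)))"
    by (rule xr_loglip[OF loglip_minus[OF L]]) (use o in auto)
  then show ?thesis by (simp add: xr_minus)
qed

text \<open>The right-hand side contains the limit of the cross ratio of the image points as the
  first one tends to minus infinity: the point \<open>y\<close> behaves like a pole of
  \<open>f\<close>.\<close>

lemma pole_loglip:
  assumes L: "loglip K f f' a b" and d: "0 < d" "y + d \<le> a" and o: "a \<le> q" "q < r" "r < s" "s \<le> b"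
  shows "xr y q r s \<le> exp ((K + 1 / d) * (s - q)) * ((f r - f q) / (f s - f r))"
proof -
  have m: "f q < f r" "f r < f s"
    using loglip_strict_mono[OF L, of q r] loglip_strict_mono[OF L, of r s] o by auto
  have 1: "(r - q) * (f s - f r) \<le> exp (K * (s - q)) * ((f r - f q) * (s - r))"
    using loglip_adjacent(1)[OF L, of q r s] o by simp
  have "(s - y) / (q - y) = 1 + (s - q) / (q - y)" using o d by (simp add: field_simps)
  also have "\<dots> \<le> 1 + (s - q) / d" using o d by (simp add: frac_le)
  also have "\<dots> \<le> exp ((s - q) / d)" by (rule exp_ge_add_one_self)
  finally have 2: "(s - y) / (q - y) \<le> exp ((s - q) / d)" .
  have "xr y q r s = ((r - q) * (f s - f r)) / ((s - r) * (f s - f r)) * ((s - y) / (q - y))"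
    using m by (simp add: xr_def)
  also have "\<dots> \<le> (exp (K * (s - q)) * ((f r - f q) * (s - r))) / ((s - r) * (f s - f r)) * exp ((s - q) / d)"
    using m o d by (intro mult_mono[OF divide_right_mono[OF 1] 2]) auto
  also have "\<dots> = exp (K * (s - q)) * exp ((s - q) / d) * ((f r - f q) / (f s - f r))"
    using o by simp
  also have "exp (K * (s - q)) * exp ((s - q) / d) = exp ((K + 1 / d) * (s - q))"
    unfolding exp_add[symmetric] by (simp add: distrib_right)
  finally show ?thesis .
qed

lemma loglip_affine:
  assumes "0 < m"
  shows "loglip 0 (\<lambda>x. m * x + k) (\<lambda>_. m) a b"
  using assms unfolding loglip_def by (auto intro!: derivative_eq_intros)

lemma loglip_powr:
  assumes c: "0 < c" and e: "0 < e"
  shows "loglip (\<bar>e - 1\<bar> / c) (\<lambda>x. x powr e) (\<lambda>x. e * x powr (e - 1)) c d"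
  unfolding loglip_def
proof (intro conjI ballI)
  show "0 \<le> \<bar>e - 1\<bar> / c" using c by simp
  fix x assume x: "x \<in> {c..d}"
  then show "((\<lambda>x. x powr e) has_real_derivative e * x powr (e - 1)) (at x within {c..d})"
    using c by (auto intro!: derivative_eq_intros)
  show "0 < e * x powr (e - 1)" using c e x by auto
  fix y assume y: "y \<in> {c..d}"
  have ln1: "\<bar>ln v - ln u\<bar> \<le> \<bar>v - u\<bar> / c" if "c \<le> u" "u \<le> v" for u v
  proof -
    have "ln v - ln u = ln (v / u)" using that c by (simp add: ln_div)
    also have "\<dots> \<le> v / u - 1" using that c by (intro ln_le_minus_one) auto
    also have "\<dots> = (v - u) / u" using that c by (simp add: field_simps)
    also have "\<dots> \<le> (v - u) / c" using that c by (intro divide_left_mono) auto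
    finally show ?thesis using that c by simp
  qed
  have "\<bar>ln x - ln y\<bar> \<le> \<bar>x - y\<bar> / c"
    using ln1[of x y] ln1[of y x] x y by (cases "x \<le> y") (auto simp: abs_minus_commute)
  then have "\<bar>e - 1\<bar> * \<bar>ln x - ln y\<bar> \<le> \<bar>e - 1\<bar> * (\<bar>x - y\<bar> / c)" by (intro mult_left_mono) auto
  moreover have "ln (e * x powr (e - 1)) - ln (e * y powr (e - 1)) = (e - 1) * (ln x - ln y)"
    using x y c e by (simp add: ln_mult ln_powr algebra_simps)
  ultimately show "\<bar>ln (e * x powr (e - 1)) - ln (e * y powr (e - 1))\<bar> \<le> \<bar>e - 1\<bar> / c * \<bar>x - y\<bar>"
    by (simp add: abs_mult)
qed

lemma loglip_compose:
  assumes F: "loglip K f f' a b" and G: "loglip M g g' c d"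
    and im: "\<And>x. x \<in> {a..b} \<Longrightarrow> f x \<in> {c..d}"
  shows "\<exists>N. loglip N (\<lambda>x. g (f x)) (\<lambda>x. g' (f x) * f' x) a b"
proof (cases "a \<le> b")
  case False
  then have "loglip 0 (\<lambda>x. g (f x)) (\<lambda>x. g' (f x) * f' x) a b" by (simp add: loglip_def)
  then show ?thesis ..
next
  case True
  have KM: "0 \<le> K" "0 \<le> M" using F G by (auto simp: loglip_def)
  define S where "S = exp (K * (b - a)) * f' a"
  have f'S: "f' z \<le> S" if "z \<in> {a..b}" for z
  proof -
    have "f' z \<le> exp (K * \<bar>z - a\<bar>) * f' a" using that by (intro loglip_ratio[OF F]) auto
    also have "\<dots> \<le> S" unfolding S_def
      using that F True KM by (intro mult_right_mono iffD2[OF exp_le_cancel_iff] mult_left_mono)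
        (auto simp: loglip_def intro: less_imp_le)
    finally show ?thesis .
  qed
  have lip: "\<bar>f y - f x\<bar> \<le> S * (y - x)" if "a \<le> x" "x \<le> y" "y \<le> b" for x y
  proof (cases "x = y")
    case False
    then have "x < y" using that by simp
    from loglip_slope[OF F that(1) this that(3)]
    obtain z where z: "x < z" "z < y" "f y - f x = f' z * (y - x)" .
    then have "0 < f' z" "f' z \<le> S" using that f'S[of z] F by (auto simp: loglip_def)
    then show ?thesis using z that by (simp add: abs_mult mult_right_mono)
  qed auto
  have S0: "0 < S" using F True by (simp add: S_def loglip_def)
  have "loglip (M * S + K) (\<lambda>x. g (f x)) (\<lambda>x. g' (f x) * f' x) a b"
    unfolding loglip_def
  proof (intro conjI ballI)
    show "0 \<le> M * S + K" using KM S0 by simp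
    fix x assume x: "x \<in> {a..b}"
    have "(g has_real_derivative g' (f x)) (at (f x) within f ` {a..b})"
      by (rule DERIV_subset[of _ _ _ "{c..d}"]) (use G im x in \<open>auto simp: loglip_def\<close>)
    moreover have "(f has_real_derivative f' x) (at x within {a..b})" using F x by (auto simp: loglip_def)
    ultimately have "(g \<circ> f has_real_derivative g' (f x) * f' x) (at x within {a..b})"
      by (rule DERIV_image_chain)
    then show "((\<lambda>x. g (f x)) has_real_derivative g' (f x) * f' x) (at x within {a..b})"
      by (simp add: o_def)
    have p: "0 < g' (f z)" "0 < f' z" if "z \<in> {a..b}" for z
      using F G im[OF that] that by (auto simp: loglip_def)
    show "0 < g' (f x) * f' x" using p[OF x] by simp
    fix y assume y: "y \<in> {a..b}"
    have "\<bar>f x - f y\<bar> \<le> S * \<bar>x - y\<bar>"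
      using lip[of x y] lip[of y x] x y by (cases "x \<le> y") (auto simp: abs_minus_commute)
    then have "M * \<bar>f x - f y\<bar> \<le> M * (S * \<bar>x - y\<bar>)" using KM by (intro mult_left_mono) auto
    moreover have "\<bar>ln (g' (f x)) - ln (g' (f y))\<bar> \<le> M * \<bar>f x - f y\<bar>"
      using G im[OF x] im[OF y] unfolding loglip_def by blast
    moreover have "\<bar>ln (f' x) - ln (f' y)\<bar> \<le> K * \<bar>x - y\<bar>"
      using F x y unfolding loglip_def by blast
    moreover have "\<bar>ln (g' (f x) * f' x) - ln (g' (f y) * f' y)\<bar>
        \<le> \<bar>ln (g' (f x)) - ln (g' (f y))\<bar> + \<bar>ln (f' x) - ln (f' y)\<bar>"
      using p[OF x] p[OF y] by (simp add: ln_mult)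
    ultimately show "\<bar>ln (g' (f x) * f' x) - ln (g' (f y) * f' y)\<bar> \<le> (M * S + K) * \<bar>x - y\<bar>"
      by (simp add: algebra_simps)
  qed
  then show ?thesis ..
qed

lemma loglip_glue:
  assumes F: "loglip K f f' a c" and G: "loglip M g g' c b" and o: "a \<le> c" "c \<le> b"
    and e: "f c = g c" "f' c = g' c"
  shows "loglip (K + M) (\<lambda>x. if x \<le> c then f x else g x) (\<lambda>x. if x \<le> c then f' x else g' x) a b"
  unfolding loglip_def
proof (intro conjI ballI)
  let ?h = "\<lambda>x. if x \<le> c then f x else g x" and ?h' = "\<lambda>x. if x \<le> c then f' x else g' x"
  have KM: "0 \<le> K" "0 \<le> M" using F G by (auto simp: loglip_def)
  then show "0 \<le> K + M" by simp
  have dl: "(?h has_real_derivative f' x) (at x within {a..c})" if "x \<in> {a..c}" for x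
  proof (rule DERIV_eq_on[of f])
    show "(f has_real_derivative f' x) (at x within {a..c})" using F that by (auto simp: loglip_def)
  qed (use that in auto)
  have dr: "(?h has_real_derivative g' x) (at x within {c..b})" if "x \<in> {c..b}" for x
  proof (rule DERIV_eq_on[of g])
    show "(g has_real_derivative g' x) (at x within {c..b})" using G that by (auto simp: loglip_def)
  qed (use that e in auto)
  fix x assume x: "x \<in> {a..b}"
  show "(?h has_real_derivative ?h' x) (at x within {a..b})"
  proof -
    consider "x < c" | "x = c" | "c < x" by linarith
    then show ?thesis
    proof cases
      case 1
      have "at x within {a..b} = at x within {a..c}"
        using 1 o by (intro at_within_nhd[of _ "{..<c}"]) auto
      then show ?thesis using dl[of x] 1 x by simp
    next
      case 2
      have "{a..b} = {a..c} \<union> {c..b}" using o by auto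
      then show ?thesis using dl[of c] dr[of c] 2 x o e
        unfolding has_field_derivative_iff by (simp add: at_within_union filterlim_sup)
    next
      case 3
      have "at x within {a..b} = at x within {c..b}"
        using 3 o by (intro at_within_nhd[of _ "{c<..}"]) auto
      then show ?thesis using dr[of x] 3 x by simp
    qed
  qed
  show "0 < ?h' x" using F G x by (auto simp: loglip_def)
  fix y assume y: "y \<in> {a..b}"
  have main: "\<bar>ln (?h' u) - ln (?h' v)\<bar> \<le> (K + M) * \<bar>u - v\<bar>" if "u \<in> {a..b}" "v \<in> {a..b}" "u \<le> v" for u v
  proof -
    have l: "\<bar>ln (f' u) - ln (f' v)\<bar> \<le> K * (v - u)" if "u \<in> {a..c}" "v \<in> {a..c}" "u \<le> v" for u v
      using F that unfolding loglip_def by (metis abs_minus_commute abs_of_nonneg diff_ge_0_iff_ge)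
    have r: "\<bar>ln (g' u) - ln (g' v)\<bar> \<le> M * (v - u)" if "u \<in> {c..b}" "v \<in> {c..b}" "u \<le> v" for u v
      using G that unfolding loglip_def by (metis abs_minus_commute abs_of_nonneg diff_ge_0_iff_ge)
    have ex: "K * (v - u) \<le> (K + M) * (v - u)" "M * (v - u) \<le> (K + M) * (v - u)"
      using KM that by (auto intro!: mult_right_mono)
    consider "v \<le> c" | "c < u" | "u \<le> c" "c < v" by linarith
    then show ?thesis
    proof cases
      case 1
      then show ?thesis using l[of u v] ex that by auto
    next
      case 2
      then show ?thesis using r[of u v] ex that by auto
    next
      case 3
      have 1: "K * (c - u) + M * (v - c) \<le> K * (v - u) + M * (v - u)"
        using 3 KM by (intro add_mono mult_left_mono) auto
      have "\<bar>ln (f' u) - ln (g' v)\<bar> \<le> K * (c - u) + M * (v - c)"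
        using l[of u c] r[of c v] 3 that o e by auto
      then show ?thesis using 1 3 that by (simp add: algebra_simps)
    qed
  qed
  show "\<bar>ln (?h' x) - ln (?h' y)\<bar> \<le> (K + M) * \<bar>x - y\<bar>"
    using main[of x y] main[of y x] x y by (cases "x \<le> y") (auto simp: abs_minus_commute)
qed

lemma D01_works:
  assumes "f differentiable_on {0..1}" "x \<in> {0..1}"
  shows "(f has_real_derivative D01 f x) (at x within {0..1})"
  using assms unfolding D01_def differentiable_on_def
  by (simp add: has_real_derivative_iff_has_vector_derivative vector_derivative_works[symmetric])

text \<open>The derivative does not vanish because the inverse is differentiable too; then the
  nonlinearity \<open>\<phi>'' / \<phi>'\<close> is continuous on a compact interval, and it is
  the derivative of \<open>ln \<phi>'\<close>.\<close>

lemma loglip_Diff2: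
  assumes "\<phi> \<in> Diff2"
  shows "\<exists>K. loglip K \<phi> (D01 \<phi>) 0 1"
proof -
  note P = Diff2_props[OF assms]
  define \<psi> where "\<psi> = inv_into {0..1} \<phi>"
  have c: "\<phi> differentiable_on {0..1}" "D01 \<phi> differentiable_on {0..1}"
    "continuous_on {0..1} (D01 (D01 \<phi>))" "\<psi> differentiable_on {0..1}"
    "bij_betw \<phi> {0..1} {0..1}"
    using assms by (auto simp: Diff2_def C2_01_def \<psi>_def)
  have pos: "0 < D01 \<phi> x" if x: "x \<in> {0..1}" for x
  proof -
    have dx: "(\<phi> has_real_derivative D01 \<phi> x) (at x within {0..1})" using D01_works c x by blast
    have "(\<psi> has_real_derivative D01 \<psi> (\<phi> x)) (at (\<phi> x) within \<phi> ` {0..1})"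
      unfolding P(5) using D01_works[OF c(4), of "\<phi> x"] P(3)[of x] x by auto
    from DERIV_image_chain[OF this dx]
    have "(\<psi> \<circ> \<phi> has_real_derivative D01 \<psi> (\<phi> x) * D01 \<phi> x) (at x within {0..1})" .
    then have 1: "((\<lambda>x. x) has_real_derivative D01 \<psi> (\<phi> x) * D01 \<phi> x) (at x within {0..1})"
    proof (rule DERIV_eq_on)
      show "z = (\<psi> \<circ> \<phi>) z" if "z \<in> {0..1}" for z
        using that c(5) by (simp add: \<psi>_def bij_betw_def)
    qed (use x in auto)
    have ntriv: "at x within {0..1} \<noteq> bot" using x by (simp add: trivial_limit_within islimpt_Icc)
    have "D01 \<psi> (\<phi> x) * D01 \<phi> x = 1"
      using 1 DERIV_ident[of "at x within {0..1}"] ntriv unfolding has_field_derivative_iff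
      by (metis tendsto_unique)
    then have nz: "D01 \<phi> x \<noteq> 0" by auto
    have "0 \<le> D01 \<phi> x"
    proof (rule tendsto_lowerbound[OF _ _ ntriv])
      show "((\<lambda>y. (\<phi> y - \<phi> x) / (y - x)) \<longlongrightarrow> D01 \<phi> x) (at x within {0..1})"
        using dx by (simp add: has_field_derivative_iff)
      have "0 \<le> (\<phi> y - \<phi> x) / (y - x)" if "y \<in> {0..1}" for y
        using P(4)[of x y] P(4)[of y x] x that
        by (cases x y rule: linorder_cases) (auto simp: zero_le_divide_iff)
      then show "\<forall>\<^sub>F y in at x within {0..1}. 0 \<le> (\<phi> y - \<phi> x) / (y - x)"
        by (auto simp: eventually_at intro: exI[of _ 1])
    qed
    then show ?thesis using nz by simp
  qed
  define q where "q x = D01 (D01 \<phi>) x / D01 \<phi> x" for x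
  have "continuous_on {0..1} (D01 \<phi>)" using c(2) differentiable_imp_continuous_on by blast
  then have "continuous_on {0..1} q" unfolding q_def using c(3) pos by (intro continuous_intros) force+
  then have "bounded (q ` {0..1})" by (intro compact_imp_bounded compact_continuous_image) auto
  then obtain B where B: "\<And>x. x \<in> {0..1} \<Longrightarrow> norm (q x) \<le> B" unfolding bounded_iff by blast
  have "loglip B \<phi> (D01 \<phi>) 0 1"
    unfolding loglip_def
  proof (intro conjI ballI)
    show "0 \<le> B" using B[of 0] norm_ge_zero[of "q 0"] by auto
    fix x :: real assume x: "x \<in> {0..1}"
    show "(\<phi> has_real_derivative D01 \<phi> x) (at x within {0..1})" using D01_works c x by blast
    show "0 < D01 \<phi> x" using pos x by blast
    fix y :: real assume y: "y \<in> {0..1}"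
    have "((\<lambda>x. ln (D01 \<phi> x)) has_real_derivative q z) (at z within {0..1})" if "z \<in> {0..1}" for z
      using D01_works[OF c(2) that] pos[OF that] unfolding q_def
      by (auto intro!: derivative_eq_intros)
    from field_differentiable_bound[OF convex_real_interval(5), of 0 1, OF this B y x]
    have "norm (ln (D01 \<phi> y) - ln (D01 \<phi> x)) \<le> B * norm (y - x)" by auto
    then show "\<bar>ln (D01 \<phi> x) - ln (D01 \<phi> y)\<bar> \<le> B * \<bar>x - y\<bar>" by (simp add: abs_minus_commute)
  qed
  then show ?thesis ..
qed

section \<open>Towers of return branches\<close>

text \<open>The lengths \<open>P\<close>, \<open>X\<close>, \<open>Y\<close> belong to the end
  point \<open>1\<close> and to the end points of the flat interval of the successive return maps.
  The return branches are \<open>F n\<close> raised to the power \<open>L n\<close>; \<open>F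
  n\<close> is defined on \<open>[- X n, E n]\<close>, and the orientation is reversed from each
  level to the next so that the flat interval always lies to the left of the domain of the branch.
  The values listed for \<open>F n\<close> express that the near end \<open>- X n\<close> of the
  flat interval is mapped to \<open>0\<close>, and that \<open>0\<close>, \<open>- P (n +
  2)\<close> and the ends of the flat interval two levels deeper are mapped to marked points of
  the adjacent levels. The last three assumptions say that the two initial branches expand cross
  ratios up to an exponential error. In the third one the far end \<open>- Y i\<close> of the flat
  interval plays the part of a pole.\<close>

locale flat_tower =
  fixes L P X Y E :: "nat \<Rightarrow> real" and F :: "nat \<Rightarrow> real \<Rightarrow> real" and K :: real
  assumes L_ge1: "1 \<le> L n" and L_period: "L (Suc (Suc n)) = L n"
    and P_pos: "0 < P n" and P_X: "P (Suc (Suc n)) < X n" and X_Y: "X n < Y n" and Y_P: "Y n < P n"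
    and E0: "E 0 = 0" and E1: "E (Suc 0) = Y (Suc (Suc 0))" and E2: "E (Suc (Suc n)) = X (Suc n)"
    and F_X: "F n (- X n) = 0"
    and F_P2: "F n (- P (Suc (Suc n))) = P (Suc (Suc (Suc n))) powr (1 / L n)"
    and F_Y2: "F n (- Y (Suc (Suc n))) = X (Suc n) powr (1 / L n)"
    and F_X2: "F n (- X (Suc (Suc n))) = Y (Suc n) powr (1 / L n)"
    and F_0: "F n 0 = P (Suc n) powr (1 / L n)"
    and F1_X: "F (Suc 0) (X (Suc (Suc 0))) = X 0 powr (1 / L (Suc 0))"
    and F1_Y: "F (Suc 0) (Y (Suc (Suc 0))) = Y 0 powr (1 / L (Suc 0))"
    and F_rec: "F (Suc (Suc n)) x = F n (- (F (Suc n) (- x) powr L (Suc n)))"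
    and F0_mono: "strict_mono_on {- X 0..E 0} (F 0)" and F0_cont: "continuous_on {- X 0..E 0} (F 0)"
    and F1_mono: "strict_mono_on {- X 1..E 1} (F 1)" and F1_cont: "continuous_on {- X 1..E 1} (F 1)"
    and K: "0 \<le> K"
    and base_xr: "\<And>i p q r s. i < 2 \<Longrightarrow> - X i \<le> p \<Longrightarrow> p < q \<Longrightarrow> q < r \<Longrightarrow> r < s \<Longrightarrow> s \<le> E i \<Longrightarrow>
      xr p q r s \<le> exp (K * (s - q)) * xr (F i p) (F i q) (F i r) (F i s)"
    and base_xr': "\<And>i p q r s. i < 2 \<Longrightarrow> - X i \<le> p \<Longrightarrow> p < q \<Longrightarrow> q < r \<Longrightarrow> r < s \<Longrightarrow> s \<le> E i \<Longrightarrow>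
      xr p q r s \<le> exp (K * (r - p)) * xr (F i p) (F i q) (F i r) (F i s)"
    and base_pole: "\<And>i q r s. i < 2 \<Longrightarrow> - X i \<le> q \<Longrightarrow> q < r \<Longrightarrow> r < s \<Longrightarrow> s \<le> E i \<Longrightarrow>
      xr (- Y i) q r s \<le> exp (K * (s - q)) * ((F i r - F i q) / (F i s - F i r))"
begin

lemma X_pos: "0 < X n" and Y_pos: "0 < Y n"
  using P_pos[of "Suc (Suc n)"] P_X[of n] X_Y[of n] by auto

lemma XYP_nonneg [simp]: "0 \<le> X n" "0 \<le> Y n" "0 \<le> P n"
  using X_pos[of n] Y_pos[of n] P_pos[of n] by auto

lemma X2_X: "X (Suc (Suc n)) < X n" and Y2_X: "Y (Suc (Suc n)) < X n" and P2_P: "P (Suc (Suc n)) < P n"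
  using P_X[of n] X_Y[of n] Y_P[of n] X_Y[of "Suc (Suc n)"] Y_P[of "Suc (Suc n)"] by auto

lemmas ords = P_pos P_X X_Y Y_P X_pos Y_pos X2_X Y2_X P2_P

lemma Y2_le_E: "Y (Suc (Suc n)) \<le> E (Suc n)"
  using Y2_X[of n] by (cases n) (auto simp: E1 E2)

lemma E_nonneg: "0 \<le> E n"
  using X_pos Y_pos by (cases n rule: nat.exhaust; cases "n - 1") (auto simp: E0 E1 E2 less_imp_le)

lemma powr_L [simp]: "0 \<le> x \<Longrightarrow> (x powr (1 / L n)) powr L n = x"
  using L_ge1[of n] by (simp add: powr_powr)

lemma F_X_right: "F (Suc n) (X (Suc (Suc n))) = X n powr (1 / L (Suc n))"
proof (cases n)
  case (Suc m)
  then show ?thesis using L_ge1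
    by (simp add: F_rec F_X2 F_Y2 L_period)
qed (simp add: F1_X)

lemma F_Y_right: "F (Suc n) (Y (Suc (Suc n))) = Y n powr (1 / L (Suc n))"
proof (cases n)
  case (Suc m)
  then show ?thesis using L_ge1
    by (simp add: F_rec F_X2 F_Y2 L_period)
qed (simp add: F1_Y)

lemma F_end: "F (Suc (Suc n)) (X (Suc n)) = P (Suc n) powr (1 / L n)"
  using L_ge1[of "Suc n"] by (simp add: F_rec F_X F_0)

definition dom :: "nat \<Rightarrow> real set" where "dom n = {- X n..E n}"

text \<open>The recursion of the branches reads \<open>F (n + 2) = F n \<circ> pull n\<close>. The
  map \<open>pull n\<close> is the return branch of level \<open>n + 1\<close>, reflected on both
  sides, and it carries the far end \<open>- Y (n + 2)\<close> of one flat interval to the far end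
  \<open>- Y n\<close> of the one two levels above.\<close>

definition pull :: "nat \<Rightarrow> real \<Rightarrow> real" where
  "pull n x = - (F (Suc n) (- x) powr L (Suc n))"

lemma F_pull: "F (Suc (Suc n)) x = F n (pull n x)"
  by (simp add: F_rec pull_def)

lemma pull_X: "pull n (- X (Suc (Suc n))) = - X n"
  and pull_Y: "pull n (- Y (Suc (Suc n))) = - Y n"
  and pull_0: "pull n 0 = - P (Suc (Suc n))"
  and pull_end: "pull n (X (Suc n)) = 0"
  using L_ge1[of "Suc n"]
  by (simp_all add: pull_def F_X_right F_Y_right F_0 F_X)

lemma reflect_dom: "- Y (Suc (Suc n)) \<le> x \<Longrightarrow> x \<le> X (Suc n) \<Longrightarrow> - x \<in> dom (Suc n)"
  using Y2_le_E[of n] by (auto simp: dom_def)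

lemma dom_Suc_Suc: "dom (Suc (Suc n)) = {- X (Suc (Suc n))..X (Suc n)}"
  by (simp add: dom_def E2)

lemma pull_less_of_mono:
  assumes m: "strict_mono_on (dom (Suc n)) (F (Suc n))"
    and x: "- Y (Suc (Suc n)) \<le> x" "x < y" "y \<le> X (Suc n)"
  shows "pull n x < pull n y"
proof -
  have d: "- x \<in> dom (Suc n)" "- y \<in> dom (Suc n)" "- X (Suc n) \<in> dom (Suc n)"
    using reflect_dom[of n x] reflect_dom[of n y] x X_pos[of "Suc n"] E_nonneg[of "Suc n"] by (auto simp: dom_def)
  have "F (Suc n) (- y) < F (Suc n) (- x)" using m d x by (auto simp: strict_mono_on_def)
  moreover have "0 \<le> F (Suc n) (- y)"
  proof (cases "y = X (Suc n)")
    case False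
    then have "F (Suc n) (- X (Suc n)) < F (Suc n) (- y)" using m d x by (auto simp: strict_mono_on_def)
    then show ?thesis by (simp add: F_X)
  qed (simp add: F_X)
  ultimately show ?thesis using L_ge1[of "Suc n"] by (simp add: pull_def powr_less_mono2)
qed

lemma F_mono_cont: "strict_mono_on (dom n) (F n) \<and> continuous_on (dom n) (F n)"
proof (induction n rule: induct_nat_012)
  case 0
  then show ?case using F0_mono F0_cont by (simp add: dom_def)
next
  case 1
  then show ?case using F1_mono F1_cont by (simp add: dom_def)
next
  case (ge2 n)
  have lt: "pull n x < pull n y" if "x \<in> dom (Suc (Suc n))" "y \<in> dom (Suc (Suc n))" "x < y" for x y
    using pull_less_of_mono[of n x y] ge2 that X_Y[of "Suc (Suc n)"] by (auto simp: dom_Suc_Suc)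
  have ends: "- X (Suc (Suc n)) \<in> dom (Suc (Suc n))" "X (Suc n) \<in> dom (Suc (Suc n))"
    using X_pos[of "Suc n"] X_pos[of "Suc (Suc n)"] by (auto simp: dom_Suc_Suc)
  have im: "pull n x \<in> dom n" if x: "x \<in> dom (Suc (Suc n))" for x
  proof -
    have "pull n (- X (Suc (Suc n))) \<le> pull n x"
      using lt[OF ends(1) x] x by (cases "x = - X (Suc (Suc n))") (auto simp: dom_Suc_Suc)
    moreover have "pull n x \<le> pull n (X (Suc n))"
      using lt[OF x ends(2)] x by (cases "x = X (Suc n)") (auto simp: dom_Suc_Suc)
    ultimately show ?thesis using E_nonneg[of n] by (auto simp: pull_X pull_end dom_def)
  qed
  have "strict_mono_on (dom (Suc (Suc n))) (F (Suc (Suc n)))"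
    unfolding strict_mono_on_def F_pull using lt im ge2 by (auto simp: strict_mono_on_def)
  moreover have "continuous_on (dom (Suc (Suc n))) (F (Suc (Suc n)))"
  proof -
    have rd: "uminus ` dom (Suc (Suc n)) \<subseteq> dom (Suc n)"
      using reflect_dom[of n] X_Y[of "Suc (Suc n)"] by (force simp: dom_Suc_Suc)
    have c1: "continuous_on (dom (Suc (Suc n))) (\<lambda>x. F (Suc n) (- x))"
      by (rule continuous_on_compose2[of "dom (Suc n)" _ _ uminus])
        (use ge2 rd in \<open>auto intro: continuous_intros\<close>)
    have nn: "0 \<le> F (Suc n) (- x)" if "x \<in> dom (Suc (Suc n))" for x
    proof (cases "x = X (Suc n)")
      case False
      have "- x \<in> dom (Suc n)" using rd that by blast
      moreover have "- X (Suc n) \<in> dom (Suc n)"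
        using X_pos[of "Suc n"] E_nonneg[of "Suc n"] by (auto simp: dom_def)
      moreover have "- X (Suc n) < - x" using that False by (auto simp: dom_Suc_Suc)
      ultimately have "F (Suc n) (- X (Suc n)) < F (Suc n) (- x)" using ge2 by (auto simp: strict_mono_on_def)
      then show ?thesis by (simp add: F_X)
    qed (simp add: F_X)
    have "continuous_on (dom (Suc (Suc n))) (pull n)"
      unfolding pull_def using c1 nn L_ge1[of "Suc n"]
      by (intro continuous_intros continuous_on_powr') auto
    then show ?thesis unfolding F_pull
      by (rule continuous_on_compose2[of "dom n" "F n", rotated]) (use ge2 im in auto)
  qed
  ultimately show ?case by simp
qed

lemma F_less: "x \<in> dom n \<Longrightarrow> y \<in> dom n \<Longrightarrow> x < y \<Longrightarrow> F n x < F n y"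
  using F_mono_cont[of n] by (auto simp: strict_mono_on_def)

lemma F_le: "x \<in> dom n \<Longrightarrow> y \<in> dom n \<Longrightarrow> x \<le> y \<Longrightarrow> F n x \<le> F n y"
  using F_less[of x n y] by (cases "x = y") auto

lemma F_cont: "continuous_on (dom n) (F n)"
  using F_mono_cont by blast

lemma flat_end_dom: "- X n \<in> dom n" and zero_dom: "0 \<in> dom n"
  using X_pos[of n] E_nonneg[of n] by (auto simp: dom_def)

lemma F_nonneg: "x \<in> dom n \<Longrightarrow> 0 \<le> F n x"
  using F_le[OF flat_end_dom, of x n] by (auto simp: F_X dom_def)

lemma pull_less: "- Y (Suc (Suc n)) \<le> x \<Longrightarrow> x < y \<Longrightarrow> y \<le> X (Suc n) \<Longrightarrow> pull n x < pull n y"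
  using pull_less_of_mono F_mono_cont by blast

lemma pull_le: "- Y (Suc (Suc n)) \<le> x \<Longrightarrow> x \<le> y \<Longrightarrow> y \<le> X (Suc n) \<Longrightarrow> pull n x \<le> pull n y"
  using pull_less[of n x y] by (cases "x = y") auto

lemma pull_dom: "x \<in> dom (Suc (Suc n)) \<Longrightarrow> pull n x \<in> {- X n..0}"
  using pull_le[of n "- X (Suc (Suc n))" x] pull_le[of n x "X (Suc n)"] X_Y[of "Suc (Suc n)"]
  by (auto simp: dom_Suc_Suc pull_X pull_end)

lemma pull_dom': "x \<in> dom (Suc (Suc n)) \<Longrightarrow> pull n x \<in> dom n"
  using pull_dom[of x n] E_nonneg[of n] by (auto simp: dom_def)

lemma pull_less_dom: "x \<in> dom (Suc (Suc n)) \<Longrightarrow> y \<in> dom (Suc (Suc n)) \<Longrightarrow> x < y \<Longrightarrow> pull n x < pull n y"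
  using pull_less[of n x y] X_Y[of "Suc (Suc n)"] by (auto simp: dom_Suc_Suc)

text \<open>The increments of \<open>V n\<close> are the distortion accumulated by \<open>F
  n\<close>. By the recursion of the branches the distortion of \<open>F (n + 2)\<close> is the
  one of \<open>F (n + 1)\<close> on the reflected interval plus the one of \<open>F n\<close> on
  the image under \<open>pull n\<close>; the power between them only helps.\<close>

fun V :: "nat \<Rightarrow> real \<Rightarrow> real" where
  "V 0 x = K * x"
| "V (Suc 0) x = K * x"
| "V (Suc (Suc n)) x = V n (pull n x) - V (Suc n) (- x)"

declare V.simps(3) [simp del]

lemma minus_dom: "x \<in> dom (Suc (Suc n)) \<Longrightarrow> - x \<in> dom (Suc n)"
  using reflect_dom[of n x] X_Y[of "Suc (Suc n)"] by (auto simp: dom_Suc_Suc)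

lemma V_mono: "x \<in> dom n \<Longrightarrow> y \<in> dom n \<Longrightarrow> x \<le> y \<Longrightarrow> V n x \<le> V n y"
proof (induction n arbitrary: x y rule: induct_nat_012)
  case (ge2 n)
  have "V n (pull n x) \<le> V n (pull n y)"
    using ge2.IH(1)[OF pull_dom' pull_dom'] ge2.prems pull_less_dom[of x n y] by (cases "x = y") auto
  moreover have "V (Suc n) (- y) \<le> V (Suc n) (- x)"
    using ge2.IH(2)[OF minus_dom minus_dom] ge2.prems by auto
  ultimately show ?case by (simp add: V.simps(3))
qed (use K in \<open>auto intro: mult_left_mono\<close>)

abbreviation xrF :: "nat \<Rightarrow> real \<Rightarrow> real \<Rightarrow> real \<Rightarrow> real \<Rightarrow> real" where
  "xrF n p q r s \<equiv> xr (F n p) (F n q) (F n r) (F n s)"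

lemma xrF_pos:
  "p \<in> dom n \<Longrightarrow> q \<in> dom n \<Longrightarrow> r \<in> dom n \<Longrightarrow> s \<in> dom n \<Longrightarrow> p < q \<Longrightarrow> q < r \<Longrightarrow> r < s \<Longrightarrow> 0 < xrF n p q r s"
  by (intro xr_pos F_less)

lemma xrF_le_pull:
  assumes "- Y (Suc (Suc n)) \<le> p" "p < q" "q < r" "r < s" "s \<le> X (Suc n)"
  shows "xrF (Suc n) (- s) (- r) (- q) (- p) \<le> xr (pull n p) (pull n q) (pull n r) (pull n s)"
proof -
  have d: "- p \<in> dom (Suc n)" "- q \<in> dom (Suc n)" "- r \<in> dom (Suc n)" "- s \<in> dom (Suc n)"
    using reflect_dom[of n] assms by auto
  have "xrF (Suc n) (- s) (- r) (- q) (- p) \<le> xr (F (Suc n) (- s) powr L (Suc n)) (F (Suc n) (- r) powr L (Suc n))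
      (F (Suc n) (- q) powr L (Suc n)) (F (Suc n) (- p) powr L (Suc n))"
    using d assms by (intro xr_le_powr L_ge1 F_nonneg F_less) auto
  also have "\<dots> = xr (pull n p) (pull n q) (pull n r) (pull n s)"
    unfolding pull_def by (simp only: xr_minus)
  finally show ?thesis .
qed

lemma exp_chain:
  assumes "x \<le> exp a * y" "y \<le> y'" "y' \<le> exp b * z" "c = a + b"
  shows "x \<le> exp c * (z :: real)"
proof -
  have "x \<le> exp a * (exp b * z)" using assms by (meson exp_ge_zero mult_left_mono order_trans)
  then show ?thesis by (simp add: assms(4) exp_add mult.assoc)
qed

text \<open>Both forms of the error are needed at once: the reflection in the recursion exchanges
  them.\<close>

lemma expand:
  assumes "p \<in> dom n" "s \<in> dom n" "p < q" "q < r" "r < s"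
  shows "xr p q r s \<le> exp (V n s - V n q) * xrF n p q r s \<and>
         xr p q r s \<le> exp (V n r - V n p) * xrF n p q r s"
  using assms
proof (induction n arbitrary: p q r s rule: induct_nat_012)
  case 0
  then show ?case using base_xr[of 0 p q r s] base_xr'[of 0 p q r s] by (auto simp: dom_def right_diff_distrib)
next
  case 1
  then show ?case using base_xr[of 1 p q r s] base_xr'[of 1 p q r s] by (auto simp: dom_def right_diff_distrib)
next
  case (ge2 n)
  have d: "q \<in> dom (Suc (Suc n))" "r \<in> dom (Suc (Suc n))" using ge2.prems by (auto simp: dom_def)
  note dd = d ge2.prems(1,2)
  have i1: "xr (- s) (- r) (- q) (- p) \<le> exp (V (Suc n) (- p) - V (Suc n) (- r)) * xrF (Suc n) (- s) (- r) (- q) (- p)"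
    "xr (- s) (- r) (- q) (- p) \<le> exp (V (Suc n) (- q) - V (Suc n) (- s)) * xrF (Suc n) (- s) (- r) (- q) (- p)"
    using ge2.IH(2)[of "- s" "- p" "- r" "- q"] minus_dom dd ge2.prems by auto
  have i2: "xr (pull n p) (pull n q) (pull n r) (pull n s) \<le> exp (V n (pull n s) - V n (pull n q)) * xrF n (pull n p) (pull n q) (pull n r) (pull n s)"
    "xr (pull n p) (pull n q) (pull n r) (pull n s) \<le> exp (V n (pull n r) - V n (pull n p)) * xrF n (pull n p) (pull n q) (pull n r) (pull n s)"
    using ge2.IH(1)[of "pull n p" "pull n s" "pull n q" "pull n r"] pull_dom' pull_less_dom dd ge2.prems by auto
  have m: "xrF (Suc n) (- s) (- r) (- q) (- p) \<le> xr (pull n p) (pull n q) (pull n r) (pull n s)"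
    using xrF_le_pull[of n p q r s] ge2.prems X_Y[of "Suc (Suc n)"] by (auto simp: dom_Suc_Suc)
  have c: "V (Suc (Suc n)) r - V (Suc (Suc n)) p = (V (Suc n) (- p) - V (Suc n) (- r)) + (V n (pull n r) - V n (pull n p))"
    "V (Suc (Suc n)) s - V (Suc (Suc n)) q = (V (Suc n) (- q) - V (Suc n) (- s)) + (V n (pull n s) - V n (pull n q))"
    by (simp_all add: V.simps(3))
  show ?case
    using exp_chain[OF i1(1) m i2(2) c(1)] exp_chain[OF i1(2) m i2(1) c(2)]
    by (simp add: xr_minus F_pull)
qed

text \<open>In the induction step the point \<open>- Y (n + 2)\<close> is an ordinary point for
  the inner branch, which maps it to the pole \<open>- Y n\<close> of the outer one.\<close>

lemma expand_pole:
  assumes "q \<in> dom n" "s \<in> dom n" "q < r" "r < s"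
  shows "xr (- Y n) q r s \<le> exp (V n s - V n q) * ((F n r - F n q) / (F n s - F n r))"
  using assms
proof (induction n arbitrary: q r s rule: induct_nat_012)
  case 0
  then show ?case using base_pole[of 0 q r s] by (auto simp: dom_def right_diff_distrib)
next
  case 1
  then show ?case using base_pole[of 1 q r s] by (auto simp: dom_def right_diff_distrib)
next
  case (ge2 n)
  have d: "r \<in> dom (Suc (Suc n))" using ge2.prems by (auto simp: dom_def)
  note dd = d ge2.prems(1,2)
  define p where "p = - Y (Suc (Suc n))"
  have p: "p < q" using ge2.prems X_Y[of "Suc (Suc n)"] by (auto simp: p_def dom_Suc_Suc)
  have mp: "- p \<in> dom (Suc n)" using reflect_dom[of n p] p ge2.prems by (auto simp: p_def dom_Suc_Suc)
  have i1: "xr (- s) (- r) (- q) (- p) \<le> exp (V (Suc n) (- q) - V (Suc n) (- s)) * xrF (Suc n) (- s) (- r) (- q) (- p)"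
    using expand[of "- s" "Suc n" "- p" "- r" "- q"] minus_dom dd ge2.prems mp p by auto
  have m: "xrF (Suc n) (- s) (- r) (- q) (- p) \<le> xr (pull n p) (pull n q) (pull n r) (pull n s)"
    using xrF_le_pull[of n p q r s] ge2.prems p by (auto simp: dom_Suc_Suc p_def)
  have i2: "xr (pull n p) (pull n q) (pull n r) (pull n s)
      \<le> exp (V n (pull n s) - V n (pull n q)) * ((F n (pull n r) - F n (pull n q)) / (F n (pull n s) - F n (pull n r)))"
    using ge2.IH(1)[of "pull n q" "pull n s" "pull n r"] pull_dom' pull_less_dom dd ge2.prems
    by (auto simp: p_def pull_Y)
  have c: "V (Suc (Suc n)) s - V (Suc (Suc n)) q = (V (Suc n) (- q) - V (Suc n) (- s)) + (V n (pull n s) - V n (pull n q))"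
    by (simp add: V.simps(3))
  show ?case
    using exp_chain[OF i1 m i2 c] unfolding xr_minus F_pull p_def .
qed

section \<open>Total distortion of a tower\<close>

lemma V_diff_nonneg: "x \<in> dom n \<Longrightarrow> y \<in> dom n \<Longrightarrow> x \<le> y \<Longrightarrow> 0 \<le> V n y - V n x"
  using V_mono by simp

lemma left_dom: "x \<le> X n \<Longrightarrow> 0 \<le> x \<Longrightarrow> - x \<in> dom n"
  using E_nonneg[of n] by (auto simp: dom_def)

lemma inner_dom: "- P (Suc (Suc n)) \<in> dom n" "- Y (Suc (Suc n)) \<in> dom n" "- X (Suc (Suc n)) \<in> dom n"
  using P_X[of n] Y2_X[of n] X2_X[of n] by (auto intro!: left_dom)

definition mass_left :: "nat \<Rightarrow> real" where "mass_left n = V n 0 - V n (- X n)"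
definition mass_tip :: "nat \<Rightarrow> real" where "mass_tip n = V n (- Y (Suc (Suc n))) - V n (- P (Suc (Suc n)))"
definition mass_gap :: "nat \<Rightarrow> real" where "mass_gap n = V n (- X (Suc (Suc n))) - V n (- Y (Suc (Suc n)))"

lemma mass_nonneg: "0 \<le> mass_left n" "0 \<le> mass_tip n" "0 \<le> mass_gap n"
  unfolding mass_left_def mass_tip_def mass_gap_def
  using V_diff_nonneg[OF flat_end_dom zero_dom, of n]
    V_diff_nonneg[OF inner_dom(1,2), of n] V_diff_nonneg[OF inner_dom(2,3), of n]
    Y_P[of "Suc (Suc n)"] X_Y[of "Suc (Suc n)"] X_pos[of n] by auto

text \<open>A conservation law: the distortion on the left part of level \<open>n + 3\<close>
  together with the tip and the gap of level \<open>n + 1\<close> is a distortion that was already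
  present before.\<close>

lemma mass_step:
  "mass_left (Suc (Suc (Suc n))) + mass_tip (Suc n) + mass_gap (Suc n) = mass_left (Suc n) + mass_tip n"
proof -
  have "pull n (X (Suc (Suc (Suc n)))) = - Y (Suc (Suc n))"
    by (simp add: pull_def F_X2)
  then show ?thesis
    by (simp add: mass_left_def mass_tip_def mass_gap_def V.simps(3) pull_0 pull_X)
qed

text \<open>By \<open>mass_step\<close> the sum of two consecutive left masses and a tip mass
  decreases from level to level by exactly one gap mass.\<close>

lemma mass_left_bound: "mass_left (Suc n) \<le> mass_left 2 + mass_left 1 + mass_tip 0"
  and mass_gap_summable: "summable (\<lambda>n. mass_gap (Suc n))"
proof -
  define Z where "Z n = mass_left (Suc (Suc n)) + mass_left (Suc n) + mass_tip n" for n
  have step: "Z (Suc n) = Z n - mass_gap (Suc n)" for n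
    using mass_step[of n] by (simp add: Z_def)
  have Z0: "Z 0 = mass_left 2 + mass_left 1 + mass_tip 0" by (simp add: Z_def numeral_2_eq_2)
  have sum: "(\<Sum>i<n. mass_gap (Suc i)) = Z 0 - Z n" for n
    by (induction n) (auto simp: step)
  have Zn: "0 \<le> Z n" for n using mass_nonneg by (auto simp: Z_def)
  have "Z n \<le> Z 0" for n
    using sum[of n] sum_nonneg[of "{..<n}" "\<lambda>i. mass_gap (Suc i)"] mass_nonneg by auto
  then show "mass_left (Suc n) \<le> mass_left 2 + mass_left 1 + mass_tip 0"
    using mass_nonneg(1)[of "Suc (Suc n)"] mass_nonneg(2)[of n] unfolding Z0[symmetric]
    by (smt (verit) Z_def)
  show "summable (\<lambda>n. mass_gap (Suc n))"
    by (rule summableI_nonneg_bounded[of _ "Z 0"]) (use mass_nonneg Zn sum in auto)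
qed

definition osc :: "nat \<Rightarrow> real" where "osc n = V n (E n) - V n (- X n)"

lemma osc_le_mass: "osc (Suc (Suc n)) \<le> mass_left (Suc (Suc n)) + mass_left (Suc n) + mass_left n"
proof -
  have "V n (- P (Suc (Suc n))) \<ge> V n (- X n)"
    using V_mono[OF flat_end_dom inner_dom(1), of n] P_X[of n] by simp
  then show ?thesis
    by (simp add: osc_def E2 mass_left_def V.simps(3) pull_0 pull_X pull_end)
qed

lemma E_dom: "E n \<in> dom n"
  using X_pos[of n] E_nonneg[of n] by (auto simp: dom_def)

lemma V_le_osc: "x \<in> dom n \<Longrightarrow> y \<in> dom n \<Longrightarrow> V n y - V n x \<le> osc n"
  unfolding osc_def
  using V_mono[OF flat_end_dom, of x n] V_mono[OF _ E_dom, of y n] by (auto simp: dom_def)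

lemma osc_nonneg: "0 \<le> osc n"
  using V_le_osc[OF zero_dom zero_dom, of n] by simp

text \<open>From here on, cross ratios are expanded up to a factor that does not depend on the
  level.\<close>

lemma osc_bounded: "\<exists>M. \<forall>n. osc n \<le> M"
proof -
  define Z where "Z = mass_left 2 + mass_left 1 + mass_tip 0"
  have "0 \<le> Z" using mass_nonneg by (auto simp: Z_def)
  have l: "mass_left n \<le> Z + mass_left 0" for n
    using mass_left_bound[of "n - 1"] mass_nonneg(1)[of 0] \<open>0 \<le> Z\<close> by (cases n) (auto simp: Z_def)
  have "osc n \<le> 3 * (Z + mass_left 0) + osc 0 + osc 1" for n
  proof (cases "n < 2")
    case True
    then have "n = 0 \<or> n = 1" by auto
    then show ?thesis using osc_nonneg[of 0] osc_nonneg[of 1] \<open>0 \<le> Z\<close> mass_nonneg(1)[of 0] by auto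
  next
    case False
    then obtain k where "n = Suc (Suc k)" by (metis add_2_eq_Suc le_add_diff_inverse not_less)
    then show ?thesis
      using osc_le_mass[of k] l[of k] l[of "Suc k"] l[of "Suc (Suc k)"] osc_nonneg[of 0] osc_nonneg[of 1] by auto
  qed
  then show ?thesis by blast
qed

lemma expand_osc:
  assumes "p \<in> dom n" "s \<in> dom n" "p < q" "q < r" "r < s"
  shows "xr p q r s \<le> exp (osc n) * xrF n p q r s"
proof -
  have "q \<in> dom n" "r \<in> dom n" using assms by (auto simp: dom_def)
  then have "exp (V n s - V n q) * xrF n p q r s \<le> exp (osc n) * xrF n p q r s"
    using V_le_osc[of q n s] assms xrF_pos[of p n q r s] by (intro mult_right_mono) auto
  then show ?thesis using expand[OF assms] by linarith
qed

lemma expand_pole_osc: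
  assumes "q \<in> dom n" "s \<in> dom n" "q < r" "r < s"
  shows "xr (- Y n) q r s \<le> exp (osc n) * ((F n r - F n q) / (F n s - F n r))"
proof -
  have r: "r \<in> dom n" using assms by (auto simp: dom_def)
  have "0 \<le> (F n r - F n q) / (F n s - F n r)"
    using F_less[of q n r] F_less[of r n s] r assms by auto
  then have "exp (V n s - V n q) * ((F n r - F n q) / (F n s - F n r)) \<le> exp (osc n) * ((F n r - F n q) / (F n s - F n r))"
    using V_le_osc[of q n s] assms by (intro mult_right_mono) auto
  then show ?thesis using expand_pole[OF assms] by linarith
qed

text \<open>For \<open>n \<ge> 1\<close>, \<open>u n\<close> is the coordinate
  \<open>x\<^sub>2\<close> of the renormalization of level \<open>n - 1\<close>.\<close>

definition u :: "nat \<Rightarrow> real" where "u n = P (Suc (Suc n)) / P n"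
text \<open>For \<open>n \<ge> 2\<close> this is the parameter \<open>s\<close> of the
  renormalization of level \<open>n - 1\<close>. In the tower, \<open>h (n + 1)\<close> is the
  ratio of the values of \<open>F n\<close> at \<open>- P (n + 2)\<close> and
  \<open>0\<close>.\<close>

definition h :: "nat \<Rightarrow> real" where "h n = u n powr (1 / L (Suc n))"
definition e :: "nat \<Rightarrow> real" where "e n = P (Suc n) / P n"

lemma u_pos: "0 < u n" and u_less: "u n < 1" and e_pos: "0 < e n" and u_e: "u n = e n * e (Suc n)"
  using P_pos[of n] P_pos[of "Suc n"] P_pos[of "Suc (Suc n)"] P2_P[of n] by (auto simp: u_def e_def)

lemma h_pos: "0 < h n" and h_less: "h n < 1" and u_le_h: "u n \<le> h n"
proof -
  show "0 < h n" using u_pos[of n] by (simp add: h_def)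
  show "h n < 1" using u_pos[of n] u_less[of n] L_ge1[of "Suc n"] powr_less_mono2[of "1 / L (Suc n)" "u n" 1]
    by (simp add: h_def)
  have "u n powr 1 \<le> u n powr (1 / L (Suc n))"
    using u_pos[of n] u_less[of n] L_ge1[of "Suc n"] by (intro powr_mono') auto
  then show "u n \<le> h n" using u_pos[of n] by (simp add: h_def)
qed

lemma one_minus_h: "(1 - u n) / L (Suc n) \<le> 1 - h n" "1 - h n \<le> 1 - u n"
proof -
  have "u n powr (1 / L (Suc n)) * 1 powr (1 - 1 / L (Suc n)) \<le> 1 / L (Suc n) * u n + (1 - 1 / L (Suc n)) * 1"
    using u_pos[of n] L_ge1[of "Suc n"] by (intro Youngs_inequality_0) auto
  then show "(1 - u n) / L (Suc n) \<le> 1 - h n" by (simp add: h_def diff_divide_distrib)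
  show "1 - h n \<le> 1 - u n" using u_le_h by simp
qed

lemma P_powr_h: "P (Suc (Suc n)) powr (1 / L (Suc n)) = h n * P n powr (1 / L (Suc n))"
  using P_pos[of n] P_pos[of "Suc (Suc n)"] by (simp add: h_def u_def powr_divide)

lemma L3: "L (Suc (Suc (Suc n))) = L (Suc n)"
  by (rule L_period)

lemma P4_powr_h: "P (Suc (Suc (Suc (Suc n)))) powr (1 / L (Suc n)) = h (Suc (Suc n)) * (h n * P n powr (1 / L (Suc n)))"
  using P_powr_h[of "Suc (Suc n)"] P_powr_h[of n] by (simp add: L3)

lemma Suc_end_dom: "X (Suc k) \<in> dom (Suc (Suc k))"
  using X_pos[of "Suc k"] X_pos[of "Suc (Suc k)"] by (auto simp: dom_Suc_Suc)

text \<open>\<open>expand_pole\<close> for the points \<open>- Y (m + 2)\<close>, \<open>- P (m +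
  4)\<close>, \<open>0\<close> and \<open>X (m + 1)\<close>, whose images are known.\<close>

lemma chord_ineq:
  "P (m + 4) * (X (Suc m) + Y (m + 2)) / ((Y (m + 2) - P (m + 4)) * X (Suc m))
     \<le> exp (osc (m + 2)) * (h (Suc m) * (1 - h (m + 3)) / (1 - h (Suc m)))"
proof -
  let ?n = "Suc (Suc m)"
  define w where "w = P (Suc m) powr (1 / L m)"
  have w: "0 < w" using P_pos[of "Suc m"] by (simp add: w_def)
  have "xr (- Y ?n) (- P (Suc (Suc ?n))) 0 (X (Suc m))
      \<le> exp (osc ?n) * ((F ?n 0 - F ?n (- P (Suc (Suc ?n)))) / (F ?n (X (Suc m)) - F ?n 0))"
    by (rule expand_pole_osc) (use inner_dom Suc_end_dom P_pos X_pos in auto)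
  also have "F ?n 0 = h (Suc m) * w"
    using P_powr_h[of "Suc m"] by (simp add: F_0 L_period w_def)
  also have "F ?n (- P (Suc (Suc ?n))) = h (m + 3) * (h (Suc m) * w)"
    using P4_powr_h[of "Suc m"] by (simp add: F_P2 L_period w_def numeral_3_eq_3)
  also have "F ?n (X (Suc m)) = w" by (simp add: F_end w_def)
  also have "(h (Suc m) * w - h (m + 3) * (h (Suc m) * w)) / (w - h (Suc m) * w)
      = (w * (h (Suc m) * (1 - h (m + 3)))) / (w * (1 - h (Suc m)))" 
    by (rule arg_cong2[where f = "(/)"]; algebra)
  also have "\<dots> = h (Suc m) * (1 - h (m + 3)) / (1 - h (Suc m))" using w by simp
  also have "xr (- Y ?n) (- P (Suc (Suc ?n))) 0 (X (Suc m))
      = P (m + 4) * (X (Suc m) + Y (m + 2)) / ((Y (m + 2) - P (m + 4)) * X (Suc m))"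
    by (simp add: xr_def numeral_eq_Suc)
  finally show ?thesis by (simp add: numeral_2_eq_2)
qed

text \<open>\<open>expand_pole\<close> for the points \<open>- Y m\<close>, \<open>- X m\<close>,
  \<open>- P (m + 2)\<close> and \<open>0\<close>.\<close>

lemma flat_ineq:
  "(X m - P (m + 2)) * Y m / ((Y m - X m) * P (m + 2)) \<le> exp (osc m) * (h (Suc m) / (1 - h (Suc m)))"
proof -
  define w where "w = P (Suc m) powr (1 / L m)"
  have w: "0 < w" using P_pos[of "Suc m"] by (simp add: w_def)
  have "xr (- Y m) (- X m) (- P (Suc (Suc m))) 0
      \<le> exp (osc m) * ((F m (- P (Suc (Suc m))) - F m (- X m)) / (F m 0 - F m (- P (Suc (Suc m)))))"
    by (rule expand_pole_osc) (use flat_end_dom zero_dom P_X P_pos in auto)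
  also have "F m 0 = w" by (simp add: F_0 w_def)
  also have "F m (- P (Suc (Suc m))) = h (Suc m) * w"
    using P_powr_h[of "Suc m"] by (simp add: F_P2 L_period w_def)
  also have "F m (- X m) = 0" by (rule F_X)
  also have "(h (Suc m) * w - 0) / (w - h (Suc m) * w) = (w * h (Suc m)) / (w * (1 - h (Suc m)))"
    by (simp add: algebra_simps)
  also have "\<dots> = h (Suc m) / (1 - h (Suc m))" using w by simp
  also have "xr (- Y m) (- X m) (- P (Suc (Suc m))) 0 = (X m - P (m + 2)) * Y m / ((Y m - X m) * P (m + 2))"
    by (simp add: xr_def)
  finally show ?thesis .
qed

text \<open>Cross ratio expansion for \<open>- X (m + 2)\<close>, \<open>- P (m + 4)\<close>,
  \<open>0\<close> and \<open>X (m + 1)\<close>. It prevents \<open>X (m + 2)\<close> from coming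
  close to \<open>P (m + 4)\<close> as long as the ratios \<open>h\<close> stay away from
  zero.\<close>

lemma space_ineq:
  "P (m + 4) * (X (Suc m) + X (m + 2)) / ((X (m + 2) - P (m + 4)) * X (Suc m))
     \<le> exp (osc (m + 2)) * ((1 - h (m + 3)) / (h (m + 3) * (1 - h (Suc m))))"
proof -
  let ?n = "Suc (Suc m)"
  define w where "w = P (Suc m) powr (1 / L m)"
  have w: "0 < w" using P_pos[of "Suc m"] by (simp add: w_def)
  have "xr (- X ?n) (- P (Suc (Suc ?n))) 0 (X (Suc m))
      \<le> exp (osc ?n) * xrF ?n (- X ?n) (- P (Suc (Suc ?n))) 0 (X (Suc m))"
    by (rule expand_osc) (use flat_end_dom Suc_end_dom P_pos X_pos P_X in auto)
  also have "xrF ?n (- X ?n) (- P (Suc (Suc ?n))) 0 (X (Suc m)) =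
      xr 0 (h (m + 3) * (h (Suc m) * w)) (h (Suc m) * w) w"
    using P_powr_h[of "Suc m"] P4_powr_h[of "Suc m"]
    by (simp add: F_0 L_period w_def F_P2 numeral_3_eq_3 F_end F_X)
  also have "\<dots> = ((h (Suc m) * w * w) * (1 - h (m + 3))) / ((h (Suc m) * w * w) * (h (m + 3) * (1 - h (Suc m))))"
    unfolding xr_def by (rule arg_cong2[where f = "(/)"]; algebra)
  also have "\<dots> = (1 - h (m + 3)) / (h (m + 3) * (1 - h (Suc m)))"
    using w h_pos[of "Suc m"] by simp
  also have "xr (- X ?n) (- P (Suc (Suc ?n))) 0 (X (Suc m))
      = P (m + 4) * (X (Suc m) + X (m + 2)) / ((X (m + 2) - P (m + 4)) * X (Suc m))"
    by (simp add: xr_def numeral_eq_Suc)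
  finally show ?thesis by (simp add: numeral_2_eq_2)
qed

section \<open>A priori bounds\<close>

lemma u_ratio_ineq:
  "u (m + 2) / (1 - u (m + 2)) \<le> exp (osc (m + 2)) * (h (Suc m) * (1 - h (m + 3)) / (1 - h (Suc m)))"
proof -
  define p3 p1 y1 x0 where "p3 = P (m + 4)" and "p1 = P (m + 2)" and "y1 = Y (m + 2)" and "x0 = X (Suc m)"
  have o: "0 < p3" "p3 < y1" "y1 < p1" "0 < x0"
    using P_pos[of "m + 4"] P_X[of "m + 2"] X_Y[of "m + 2"] Y_P[of "m + 2"] X_pos[of "Suc m"]
    by (simp_all add: p3_def p1_def y1_def x0_def numeral_eq_Suc)
  have ueq: "u (m + 2) = p3 / p1" by (simp add: u_def p3_def p1_def numeral_eq_Suc)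
  have "u (m + 2) / (1 - u (m + 2)) = p3 / (p1 - p3)" unfolding ueq using o by (simp add: field_simps)
  also have "\<dots> \<le> p3 / (y1 - p3)" using o by (intro divide_left_mono) auto
  also have "\<dots> = p3 * x0 / ((y1 - p3) * x0)" using o by simp
  also have "\<dots> \<le> p3 * (x0 + y1) / ((y1 - p3) * x0)" using o by (intro divide_right_mono mult_left_mono) auto
  finally show ?thesis using chord_ineq[of m] unfolding p3_def y1_def x0_def by linarith
qed

lemma e_ineq:
  "e (m + 3) * (P (m + 3) / X (Suc m) + e (m + 2)) \<le> exp (osc (m + 2)) * (h (Suc m) * (1 - h (m + 3)) / (1 - h (Suc m)))"
proof -
  define p3 p2 p1 y1 x0 where "p3 = P (m + 4)" and "p2 = P (m + 3)" and "p1 = P (m + 2)" and "y1 = Y (m + 2)" and "x0 = X (Suc m)"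
  have o: "0 < p3" "p3 < y1" "y1 < p1" "0 < x0" "0 < p2"
    using P_pos[of "m + 4"] P_pos[of "m + 3"] P_X[of "m + 2"] X_Y[of "m + 2"] Y_P[of "m + 2"] X_pos[of "Suc m"]
    by (simp_all add: p3_def p2_def p1_def y1_def x0_def numeral_eq_Suc)
  have e: "e (m + 3) = p3 / p2" "e (m + 2) = p2 / p1"
    by (simp_all add: e_def p3_def p2_def p1_def numeral_eq_Suc)
  have "p3 / p2 * (p2 / x0 + p2 / p1) = p3 * (1 / x0 + 1 / p1)" using o by (simp add: field_simps)
  also have "\<dots> \<le> p3 * (1 / x0 + 1 / y1)" using o by (intro mult_left_mono add_left_mono divide_left_mono) auto
  also have "\<dots> = p3 * (x0 + y1) / (y1 * x0)" using o by (simp add: field_simps)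
  also have "\<dots> \<le> p3 * (x0 + y1) / ((y1 - p3) * x0)" using o by (intro divide_left_mono mult_right_mono) auto
  finally have "p3 / p2 * (p2 / x0 + p2 / p1) \<le> p3 * (x0 + y1) / ((y1 - p3) * x0)" .
  from order_trans[OF this[unfolded p3_def p2_def p1_def y1_def x0_def] chord_ineq]
  show ?thesis unfolding e p3_def p2_def p1_def .
qed

lemma X_ratio_ineq: "X m / P (m + 2) - 1 \<le> exp (osc m) * (h (Suc m) / (1 - h (Suc m)))"
proof -
  have o: "0 < P (m + 2)" "P (m + 2) < X m" "X m < Y m" using ords by simp_all
  have "X m / P (m + 2) - 1 = (X m - P (m + 2)) / P (m + 2)" using o by (simp add: field_simps)
  also have "\<dots> = (X m - P (m + 2)) * (Y m - X m) / ((Y m - X m) * P (m + 2))" using o by simp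
  also have "\<dots> \<le> (X m - P (m + 2)) * Y m / ((Y m - X m) * P (m + 2))"
    using o by (intro divide_right_mono mult_left_mono) auto
  finally show ?thesis using flat_ineq[of m] by linarith
qed

definition Lmax :: real where "Lmax = max (L 0) (L 1)"

lemma L_le: "L n \<le> Lmax" and Lmax_ge1: "1 \<le> Lmax"
proof -
  show "L n \<le> Lmax"
    by (induction n rule: induct_nat_012) (auto simp: Lmax_def L_period)
  show "1 \<le> Lmax" using L_ge1[of 0] by (simp add: Lmax_def)
qed

lemma one_minus_h_lower: "(1 - u n) / Lmax \<le> 1 - h n"
proof -
  have "(1 - u n) / Lmax \<le> (1 - u n) / L (Suc n)"
    using u_less[of n] L_le[of "Suc n"] L_ge1[of "Suc n"] by (intro divide_left_mono) auto
  then show ?thesis using one_minus_h(1)[of n] by linarith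
qed

text \<open>For \<open>d = 1 - u\<close>, the inequality \<open>u_ratio_ineq\<close> gives
  \<open>d (k + 1) \<le> c * d (k + 2) * d (k + 3)\<close> whenever \<open>d (k + 2) \<le> 1 /
  2\<close>. A very small distance therefore comes from an even smaller one two levels earlier,
  and finally from one of the first three.\<close>

lemma u_bounded_away: "\<exists>\<eta>>0. \<forall>n. u n \<le> 1 - \<eta>"
proof -
  obtain M where M: "\<And>n. osc n \<le> M" using osc_bounded by blast
  define d where "d n = 1 - u n" for n
  have dp: "0 < d n" "d n < 1" for n using u_pos[of n] u_less[of n] by (auto simp: d_def)
  define c where "c = 2 * exp M * Lmax + 1"
  have c1: "1 \<le> c" using Lmax_ge1 by (simp add: c_def)
  have step: "d (Suc m) \<le> c * d (Suc (Suc m)) * d (Suc (Suc (Suc m)))" if "d (Suc (Suc m)) \<le> 1 / 2" for m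
  proof -
    let ?u = "u (m + 2)"
    have u2: "1 / 2 \<le> ?u" using that by (simp add: d_def)
    have hp: "0 < 1 - h (Suc m)" "0 < 1 - h (m + 3)" using h_less[of "Suc m"] h_less[of "m + 3"] by auto
    have "?u / (1 - ?u) \<le> exp (osc (m + 2)) * (h (Suc m) * (1 - h (m + 3)) / (1 - h (Suc m)))"
      by (rule u_ratio_ineq)
    also have "\<dots> \<le> exp M * (1 * (1 - u (m + 3)) / (1 - h (Suc m)))"
      using M[of "m + 2"] hp h_less[of "Suc m"] h_pos[of "Suc m"] one_minus_h(2)[of "m + 3"]
      by (intro mult_mono divide_right_mono) auto
    finally have "?u / (1 - ?u) \<le> exp M * (1 - u (m + 3)) / (1 - h (Suc m))" by simp
    then have "?u * (1 - h (Suc m)) \<le> exp M * (1 - u (m + 3)) * (1 - ?u)"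
      by (rule frac_cross_le) (use hp u_less in auto)
    moreover have "1 / 2 * (d (Suc m) / Lmax) \<le> ?u * (1 - h (Suc m))"
      using u2 hp one_minus_h_lower[of "Suc m"] dp[of "Suc m"] Lmax_ge1 by (intro mult_mono) (auto simp: d_def)
    ultimately have "1 / 2 * (d (Suc m) / Lmax) \<le> exp M * d (m + 3) * d (m + 2)" by (simp add: d_def)
    then have "d (Suc m) \<le> 2 * exp M * Lmax * (d (m + 2) * d (m + 3))" using Lmax_ge1 by (simp add: field_simps)
    also have "\<dots> \<le> c * (d (m + 2) * d (m + 3))"
      using dp[of "m + 2"] dp[of "m + 3"] by (intro mult_right_mono) (auto simp: c_def)
    finally show ?thesis by (simp add: numeral_3_eq_3 mult.assoc)
  qed
  define \<eta> where "\<eta> = Min {1 / (2 * c), 1 / c\<^sup>2, d 0, d 1, d 2}"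
  have \<eta>: "0 < \<eta>" "\<eta> \<le> 1 / (2 * c)" "\<eta> \<le> 1 / c\<^sup>2" "\<eta> \<le> d 0" "\<eta> \<le> d 1" "\<eta> \<le> d 2"
    using dp c1 by (auto simp: \<eta>_def)
  have "\<eta> \<le> d n" for n
  proof (induction n rule: less_induct)
    case (less n)
    show ?case
    proof (cases "n < 3")
      case True
      then have "n = 0 \<or> n = 1 \<or> n = 2" by auto
      then show ?thesis using \<eta> by auto
    next
      case False
      then obtain k where n: "n = Suc (Suc (Suc k))"
        by (metis Suc_diff_Suc diff_Suc_Suc le_add_diff_inverse2 not_less numeral_3_eq_3 add_Suc_right add_0_right)
      show ?thesis
      proof (rule ccontr)
        assume "\<not> \<eta> \<le> d n"
        then have dn: "d n < 1 / (2 * c)" "d n < 1 / c\<^sup>2" "d n < \<eta>" using \<eta> by auto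
        have "1 / (2 * c) \<le> 1 / 2" using c1 by (simp add: field_simps)
        then have "d (Suc (Suc k)) \<le> c * d n * d (Suc n)" using step[of "Suc k"] dn by (simp add: n)
        also have "\<dots> \<le> c * d n * 1" using dp[of "Suc n"] dp[of n] c1 by (intro mult_left_mono) auto
        finally have 1: "d (Suc (Suc k)) \<le> c * d n" by simp
        have "c * d n \<le> 1 / 2" using dn(1) c1 by (simp add: field_simps)
        then have "d (Suc k) \<le> c * d (Suc (Suc k)) * d n" using step[of k] 1 by (simp add: n)
        also have "\<dots> \<le> c * (c * d n) * d n" using 1 c1 dp[of n] by (intro mult_right_mono mult_left_mono) auto
        also have "\<dots> = (c\<^sup>2 * d n) * d n" by (simp add: power2_eq_square mult.assoc)
        also have "\<dots> \<le> 1 * d n" using dn(2) c1 dp[of n] by (intro mult_right_mono) (auto simp: field_simps)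
        finally have "d (Suc k) < \<eta>" using dn by simp
        moreover have "\<eta> \<le> d (Suc k)" by (rule less) (simp add: n)
        ultimately show False by simp
      qed
    qed
  qed
  then show ?thesis using \<eta>(1) by (intro exI[of _ \<eta>]) (auto simp: d_def algebra_simps)
qed

lemma h_bounded_away: "\<exists>\<rho>>0. \<forall>n. \<rho> \<le> 1 - h n"
proof -
  obtain \<eta> where \<eta>: "0 < \<eta>" "\<And>n. u n \<le> 1 - \<eta>" using u_bounded_away by blast
  have "\<eta> / Lmax \<le> 1 - h n" for n
  proof -
    have "\<eta> / Lmax \<le> (1 - u n) / Lmax" using \<eta>(2)[of n] Lmax_ge1 by (intro divide_right_mono) auto
    then show ?thesis using one_minus_h_lower[of n] by linarith
  qed
  then show ?thesis using \<eta>(1) Lmax_ge1 by (intro exI[of _ "\<eta> / Lmax"]) auto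
qed

lemma X_bounded: "\<exists>R>0. \<forall>n. X n \<le> R * P (n + 2)"
proof -
  obtain M where M: "\<And>n. osc n \<le> M" using osc_bounded by blast
  obtain \<rho> where \<rho>: "0 < \<rho>" "\<And>n. \<rho> \<le> 1 - h n" using h_bounded_away by blast
  have "X n \<le> (1 + exp M * (1 / \<rho>)) * P (n + 2)" for n
  proof -
    have "exp (osc n) * (h (Suc n) / (1 - h (Suc n))) \<le> exp M * (1 / \<rho>)"
      using M[of n] \<rho> h_less[of "Suc n"] h_pos[of "Suc n"] by (intro mult_mono frac_le) auto
    then have "X n / P (n + 2) \<le> 1 + exp M * (1 / \<rho>)" using X_ratio_ineq[of n] by linarith
    then show ?thesis using P_pos[of "n + 2"] by (simp add: pos_divide_le_eq)
  qed
  then show ?thesis using \<rho>(1) by (intro exI[of _ "1 + exp M * (1 / \<rho>)"]) (auto intro!: add_pos_pos)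
qed

lemma e_bounded: "\<exists>B. \<forall>n. e n \<le> B"
proof -
  obtain M where M: "\<And>n. osc n \<le> M" using osc_bounded by blast
  obtain \<rho> where \<rho>: "0 < \<rho>" "\<And>n. \<rho> \<le> 1 - h n" using h_bounded_away by blast
  obtain R where R: "0 < R" "\<And>n. X n \<le> R * P (n + 2)" using X_bounded by blast
  have "e (m + 3) \<le> R * (exp M * (1 / \<rho>))" for m
  proof -
    have "1 / R \<le> P (m + 3) / X (Suc m)"
      using R(1) R(2)[of "Suc m"] X_pos[of "Suc m"] by (simp add: field_simps numeral_eq_Suc)
    then have "e (m + 3) * (1 / R) \<le> e (m + 3) * (P (m + 3) / X (Suc m) + e (m + 2))"
      using e_pos[of "m + 3"] e_pos[of "m + 2"] by (intro mult_left_mono) auto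
    also have "\<dots> \<le> exp (osc (m + 2)) * (h (Suc m) * (1 - h (m + 3)) / (1 - h (Suc m)))" by (rule e_ineq)
    also have "\<dots> \<le> exp M * (1 / \<rho>)"
      using M[of "m + 2"] \<rho> h_less[of "Suc m"] h_pos[of "Suc m"] h_less[of "m + 3"] h_pos[of "m + 3"]
      by (intro mult_mono frac_le mult_le_one) auto
    finally show ?thesis using R(1) by (simp add: field_simps)
  qed
  then have "e n \<le> Max {e 0, e 1, e 2, R * (exp M * (1 / \<rho>))}" for n
  proof (cases "n < 3")
    case True
    then have "n = 0 \<or> n = 1 \<or> n = 2" by auto
    then show ?thesis by auto
  next
    case False
    then obtain m where "n = m + 3" by (metis add.commute le_add_diff_inverse not_less)
    then show ?thesis using \<open>\<And>m. e (m + 3) \<le> R * (exp M * (1 / \<rho>))\<close>[of m] by (intro Max_ge_iff[THEN iffD2]) auto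
  qed
  then show ?thesis by blast
qed

end

text \<open>For exponents with \<open>g 0 + g 1 = 1 + k\<close>, \<open>k > 0\<close>, the
  substitution \<open>D n = e n powr (- g n) * (1 - h n)\<close> and \<open>y n = D n * D (n + 1)
  * e (n + 1) powr (g (n + 1) - 1)\<close> turns the inequality into \<open>y n + D n \<le> th *
  (y (n + 1) * e (n + 1) powr k + D (n + 2) * u (n + 1) powr k)\<close>. With the weights
  \<open>mu (n + 1) = mu n * e (n + 1) powr k\<close> the positive quantity \<open>Z n = mu n * y
  n + mu n * D n + mu (n + 1) * D (n + 1)\<close> is then nondecreasing up to the factor
  \<open>max 1 th\<close>. But \<open>mu\<close> decays at least like \<open>(1 - d) powr (k * n /
  2)\<close>, because two consecutive factors multiply to \<open>u powr k\<close>, while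
  \<open>y\<close> and \<open>D\<close> stay bounded.\<close>

lemma no_bounded_solution:
  fixes e g :: "nat \<Rightarrow> real" and th :: real
  defines "u \<equiv> \<lambda>n. e n * e (Suc n)"
  defines "h \<equiv> \<lambda>n. u n powr g n"
  assumes e: "\<And>n. 0 < e n" "\<And>n. e n \<le> B" and u: "\<And>n. c \<le> u n" "0 < c" "\<And>n. u n \<le> 1 - d" "0 < d"
    and g: "\<And>n. 0 < g n" "\<And>n. g n \<le> 1" "\<And>n. g (Suc (Suc n)) = g n" "1 < g 0 + g 1"
    and th: "0 < th" "th\<^sup>2 * (1 - d) powr (g 0 + g 1 - 1) < 1"
    and ineq: "\<And>n. e (Suc (Suc n)) * (1 - h (Suc n) + e (Suc n)) * (1 - h n) \<le> th * (h n * (1 - h (Suc (Suc n))))"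
  shows False
proof -
  define k where "k = g 0 + g 1 - 1"
  have gg: "g n + g (Suc n) = 1 + k" for n
    by (induction n rule: induct_nat_012) (auto simp: k_def g)
  have k: "0 < k" using g by (simp add: k_def)
  have d1: "d < 1" using u(1,3)[of 0] u(2) by linarith
  have up: "0 < u n" "u n < 1" for n using u(1)[of n] u(2) u(3)[of n] u(4) by linarith+
  have hp: "0 < h n" "h n < 1" for n
    using up[of n] g(1)[of n] powr_less_mono2[of "g n" "u n" 1] by (auto simp: h_def)
  define D where "D n = e n powr (- g n) * (1 - h n)" for n
  have Dp: "0 < D n" for n using e(1)[of n] hp[of n] by (simp add: D_def)
  define y where "y n = D n * D (Suc n) * e (Suc n) powr (g (Suc n) - 1)" for n
  have yp: "0 < y n" for n using Dp e(1)[of "Suc n"] by (simp add: y_def)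
  have hD: "1 - h n = D n * e n powr g n" for n
    using e(1)[of n] by (simp add: D_def powr_minus)
  have he: "h n = e n powr g n * e (Suc n) powr g n" for n
    using e(1)[of n] e(1)[of "Suc n"] by (simp add: h_def u_def powr_mult)
  have step: "y n + D n \<le> th * (y (Suc n) * e (Suc n) powr k + D (Suc (Suc n)) * u (Suc n) powr k)" for n
  proof -
    define x z a b where "x = e (Suc n)" and "z = e (Suc (Suc n))" and "a = g (Suc n)" and "b = g n"
    have p: "0 < x" "0 < z" using e by (auto simp: x_def z_def)
    have ab: "a + b = 1 + k" using gg[of n] by (simp add: a_def b_def)
    have g2: "g (Suc (Suc n)) = b" by (simp add: b_def g)
    define D0 D1 D2 where "D0 = D n" and "D1 = D (Suc n)" and "D2 = D (Suc (Suc n))"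
    have en: "0 < e n powr b" using e(1)[of n] by simp
    have "z * (D1 * x powr a + x) * (D0 * e n powr b) \<le> th * ((e n powr b * x powr b) * (D2 * z powr b))"
      using ineq[of n] hD[of "Suc n"] hD[of n] hD[of "Suc (Suc n)"] he[of n]
      by (simp add: x_def z_def a_def b_def D0_def D1_def D2_def g)
    then have "e n powr b * (z * (D1 * x powr a + x) * D0) \<le> e n powr b * (th * (x powr b * (D2 * z powr b)))"
      by (simp add: mult.assoc mult.left_commute mult.commute)
    then have 1: "z * (D1 * x powr a + x) * D0 \<le> th * (x powr b * (D2 * z powr b))"
      using en by (simp add: mult_le_cancel_left_pos)
    have xa: "x powr a = x * x powr (a - 1)" "x powr b = x * x powr (b - 1)" "z powr b = z * z powr (b - 1)"
      using p by (simp_all add: powr_diff)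
    have A: "z * (D1 * x powr a + x) * D0 = (x * z) * (D0 * D1 * x powr (a - 1) + D0)"
      unfolding xa(1) by (simp add: algebra_simps)
    have B: "th * (x powr b * (D2 * z powr b)) = (x * z) * (th * (D2 * (x powr (b - 1) * z powr (b - 1))))"
      unfolding xa(2,3) by (simp add: algebra_simps)
    have "(x * z) * (D0 * D1 * x powr (a - 1) + D0) \<le> (x * z) * (th * (D2 * (x powr (b - 1) * z powr (b - 1))))"
      using 1 by (simp only: A B)
    then have 2: "D0 * D1 * x powr (a - 1) + D0 \<le> th * (D2 * (x powr (b - 1) * z powr (b - 1)))"
      using p by (simp add: mult_le_cancel_left_pos)
    define w where "w = u (Suc n)"
    have w: "w = x * z" by (simp add: w_def u_def x_def z_def)
    have h1: "h (Suc n) = w powr a" by (simp add: h_def w_def a_def)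
    have D1x: "1 - w powr a = D1 * x powr a" using hD[of "Suc n"] by (simp add: h1 D1_def x_def a_def)
    have wm: "w powr (- a) * w powr a = 1" using p by (simp add: w flip: powr_add)
    have "x powr (b - 1) * z powr (b - 1) = w powr (b - 1)" using p by (simp add: w powr_mult)
    also have "b - 1 = k - a" using ab by simp
    also have "w powr (k - a) = w powr k * w powr (- a)"
      using p by (simp add: w powr_diff powr_minus divide_inverse)
    also have "\<dots> = w powr k * (w powr (- a) * (w powr a + (1 - w powr a)))"
      by algebra
    also have "\<dots> = w powr k * (1 + w powr (- a) * (1 - w powr a))"
      by (simp only: distrib_left wm)
    also have "\<dots> = w powr k + w powr k * (w powr (- a) * (D1 * x powr a))"
      unfolding D1x by (simp add: distrib_left)
    also have "w powr k * (w powr (- a) * (D1 * x powr a)) = D1 * x powr k * z powr (b - 1)"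
    proof -
      have "w powr k * (w powr (- a) * (D1 * x powr a)) = w powr (k - a) * (D1 * x powr a)"
        by (simp add: mult.assoc[symmetric] flip: powr_add)
      also have "w powr (k - a) = x powr (k - a) * z powr (k - a)"
        using p by (simp add: w powr_mult)
      also have "x powr (k - a) * z powr (k - a) * (D1 * x powr a) = D1 * (x powr (k - a) * x powr a) * z powr (k - a)"
        by algebra
      also have "x powr (k - a) * x powr a = x powr k" by (simp flip: powr_add)
      also have "k - a = b - 1" using ab by simp
      finally show ?thesis .
    qed
    finally have "x powr (k - a) * z powr (k - a) = w powr k + D1 * x powr k * z powr (b - 1)" .
    moreover have "k - a = b - 1" using ab by simp
    ultimately have 3: "x powr (b - 1) * z powr (b - 1) = w powr k + D1 * x powr k * z powr (b - 1)"
      by (simp only:)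
    have "D0 * D1 * x powr (a - 1) + D0 \<le> th * (D1 * D2 * z powr (b - 1) * x powr k + D2 * w powr k)"
      using 2 unfolding 3 by (simp add: algebra_simps)
    then show ?thesis
      by (simp add: y_def D0_def D1_def D2_def x_def z_def a_def w_def g2)
  qed
  define mu where "mu n = (\<Prod>i<n. e (Suc i) powr k)" for n
  have mup: "0 < mu n" for n unfolding mu_def by (rule prod_pos) (metis e(1) less_irrefl powr_gt_zero)
  have muS: "mu (Suc n) = mu n * e (Suc n) powr k" for n by (simp add: mu_def)
  have mu2: "mu (Suc (Suc n)) = mu n * u (Suc n) powr k" for n
    using e(1)[of "Suc n"] e(1)[of "Suc (Suc n)"] by (simp add: muS u_def powr_mult)
  define Z where "Z n = mu n * y n + mu n * D n + mu (Suc n) * D (Suc n)" for n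
  have Zp: "0 < Z n" for n using mup Dp yp by (auto simp: Z_def intro!: add_pos_pos)
  define T where "T = max 1 th"
  have Zstep: "Z n \<le> T * Z (Suc n)" for n
  proof -
    have "mu n * (y n + D n) \<le> mu n * (th * (y (Suc n) * e (Suc n) powr k + D (Suc (Suc n)) * u (Suc n) powr k))"
      using step mup[of n] by (intro mult_left_mono) auto
    also have "\<dots> = th * (mu (Suc n) * y (Suc n) + mu (Suc (Suc n)) * D (Suc (Suc n)))"
      unfolding mu2 unfolding muS by (simp add: algebra_simps)
    also have "\<dots> \<le> T * (mu (Suc n) * y (Suc n) + mu (Suc (Suc n)) * D (Suc (Suc n)))"
      using mult_pos_pos[OF mup[of "Suc n"] yp[of "Suc n"]] mult_pos_pos[OF mup[of "Suc (Suc n)"] Dp[of "Suc (Suc n)"]]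
      by (intro mult_right_mono) (auto simp: T_def)
    finally have "mu n * (y n + D n) \<le> T * (mu (Suc n) * y (Suc n) + mu (Suc (Suc n)) * D (Suc (Suc n)))" .
    moreover have "1 * (mu (Suc n) * D (Suc n)) \<le> T * (mu (Suc n) * D (Suc n))"
      using mult_pos_pos[OF mup[of "Suc n"] Dp[of "Suc n"]] by (intro mult_right_mono) (auto simp: T_def)
    ultimately show ?thesis by (simp add: Z_def algebra_simps)
  qed
  define q where "q = T\<^sup>2 * (1 - d) powr k"
  have q: "0 < q" "q < 1"
  proof -
    show "0 < q" using d1 by (simp add: q_def T_def)
    have "(1 - d) powr k < 1" using powr_less_mono2[of k "1 - d" 1] k d1 u(4) by simp
    then show "q < 1" using th by (auto simp: q_def T_def k_def max_def)
  qed
  have Z1: "Z 0 \<le> T ^ n * Z n" for n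
  proof (induction n)
    case (Suc n)
    have "T ^ n * Z n \<le> T ^ n * (T * Z (Suc n))" using Zstep by (intro mult_left_mono) (auto simp: T_def)
    then show ?case using Suc by (simp add: mult.assoc mult.left_commute)
  qed simp
  \<comment> \<open>Two consecutive factors of \<open>mu\<close> multiply to \<open>u powr
    k\<close>.\<close>
  have mue: "mu (2 * n) \<le> ((1 - d) powr k) ^ n" for n
  proof (induction n)
    case (Suc n)
    have "u (Suc (2 * n)) powr k \<le> (1 - d) powr k" using u(3) up k by (intro powr_mono2) (auto intro: less_imp_le)
    then have "mu (2 * n) * u (Suc (2 * n)) powr k \<le> ((1 - d) powr k) ^ n * (1 - d) powr k"
      using Suc mup[of "2 * n"] by (intro mult_mono) auto
    then show ?case by (simp add: mu2 mult.commute)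
  qed (simp add: mu_def)
  have elow: "c / B \<le> e n" for n
  proof -
    have "c \<le> e n * B" using u(1)[of n] e(1)[of n] e(2)[of "Suc n"] unfolding u_def
      by (meson mult_left_mono less_imp_le order_trans)
    moreover have "0 < B" using e(1)[of 0] e(2)[of 0] by linarith
    ultimately show ?thesis by (simp add: field_simps)
  qed
  have B: "0 < B" using e(1)[of 0] e(2)[of 0] by linarith
  define S where "S = max 1 (B / c)"
  have S1: "1 \<le> S" by (simp add: S_def)
  have pw: "e n powr (- t) \<le> S" if "0 \<le> t" "t \<le> 1" for n t
  proof -
    have "1 / e n \<le> B / c"
      using elow[of n] e(1)[of n] B u(2) by (simp add: field_simps)
    then have i: "inverse (e n) \<le> S" by (simp add: S_def field_simps)
    have "e n powr (- t) = inverse (e n) powr t" using e(1)[of n] by (simp add: powr_minus inverse_powr)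
    also have "\<dots> \<le> S powr t" using i e(1)[of n] that by (intro powr_mono2) auto
    also have "\<dots> \<le> S powr 1" using S1 that by (intro powr_mono) auto
    finally show ?thesis using S1 by simp
  qed
  have DS: "D n \<le> S" for n
  proof -
    have "e n powr (- g n) * (1 - h n) \<le> S * 1"
      using pw[of "g n" n] g(1,2)[of n] hp[of n] S1 by (intro mult_mono) auto
    then show ?thesis by (simp add: D_def)
  qed
  have yS: "y n \<le> S * S * S" for n
    unfolding y_def using pw[of "1 - g (Suc n)" "Suc n"] g(1,2)[of "Suc n"] DS Dp S1
    by (intro mult_mono) (auto intro: less_imp_le)
  have ZB: "Z (2 * n) \<le> ((1 - d) powr k) ^ n * (S * S * S + S + max 1 B powr k * S)" for n
  proof -
    have "e (Suc (2 * n)) powr k \<le> max 1 B powr k"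
      using e k by (intro powr_mono2) (auto intro: less_imp_le max.coboundedI2)
    then have "y (2 * n) + D (2 * n) + e (Suc (2 * n)) powr k * D (Suc (2 * n)) \<le> S * S * S + S + max 1 B powr k * S"
      using yS[of "2 * n"] DS[of "2 * n"] DS[of "Suc (2 * n)"] Dp[of "Suc (2 * n)"] by (intro add_mono mult_mono) auto
    then have "mu (2 * n) * (y (2 * n) + D (2 * n) + e (Suc (2 * n)) powr k * D (Suc (2 * n)))
        \<le> ((1 - d) powr k) ^ n * (S * S * S + S + max 1 B powr k * S)"
      using mue[of n] mup[of "2 * n"] yp[of "2 * n"] Dp[of "2 * n"] Dp[of "Suc (2 * n)"]
      by (intro mult_mono) (auto intro!: add_nonneg_nonneg mult_nonneg_nonneg)
    then show ?thesis by (simp add: Z_def muS algebra_simps)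
  qed
  have "Z 0 \<le> q ^ n * (S * S * S + S + max 1 B powr k * S)" for n
  proof -
    have "Z 0 \<le> T ^ (2 * n) * Z (2 * n)" by (rule Z1)
    also have "\<dots> \<le> T ^ (2 * n) * (((1 - d) powr k) ^ n * (S * S * S + S + max 1 B powr k * S))"
      using ZB by (intro mult_left_mono) (auto simp: T_def)
    also have "\<dots> = q ^ n * (S * S * S + S + max 1 B powr k * S)"
      by (simp add: q_def power_mult power_mult_distrib)
    finally show ?thesis .
  qed
  moreover have "(\<lambda>n. q ^ n * (S * S * S + S + max 1 B powr k * S)) \<longlonglongrightarrow> 0 * (S * S * S + S + max 1 B powr k * S)"
    using q by (intro tendsto_intros LIMSEQ_realpow_zero) auto
  ultimately have "Z 0 \<le> 0" by (intro LIMSEQ_le_const[of _ 0]) auto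
  then show False using Zp[of 0] by simp
qed

section \<open>Distortion tends to zero when the ratios stay away from zero\<close>

lemma powr_le_affine:
  fixes x g :: real
  assumes "0 < x" "0 \<le> g" "g \<le> 1"
  shows "x powr g \<le> 1 - g * (1 - x)"
  using Youngs_inequality_0[of g "1 - g" x 1] assms by (simp add: algebra_simps)

context flat_tower begin

text \<open>The function \<open>V n\<close> is itself controlled by cross ratios: four points
  whose images have a moderate cross ratio have a middle interval that carries no more distortion,
  up to a factor, than either of the outer ones. The statement is inherited through the recursion
  because cross ratios grow along it.\<close>

lemma V_quad_comparison:
  assumes "p \<in> dom n" "s \<in> dom n" "p < q" "q < r" "r < s"
  shows "V n r - V n q \<le> exp (V n s - V n p) * xrF n p q r s * (V n q - V n p) \<and>
         V n r - V n q \<le> exp (V n s - V n p) * xrF n p q r s * (V n s - V n r)"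
  using assms
proof (induction n arbitrary: p q r s rule: induct_nat_012)
  have base: "V i r - V i q \<le> exp (V i s - V i p) * xrF i p q r s * (V i q - V i p) \<and>
         V i r - V i q \<le> exp (V i s - V i p) * xrF i p q r s * (V i s - V i r)"
    if i: "i < 2" and d: "p \<in> dom i" "s \<in> dom i" "p < q" "q < r" "r < s" for i p q r s
  proof -
    have "i = 0 \<or> i = Suc 0" using i by auto
    then have Vi: "V i x = K * x" for x by auto
    have "q \<in> dom i" "r \<in> dom i" using d by (auto simp: dom_def)
    then have xp: "0 < xrF i p q r s" using xrF_pos d by auto
    have "xr p q r s \<le> exp (K * (s - q)) * xrF i p q r s" using base_xr[of i p q r s] i d by (auto simp: dom_def)
    also have "\<dots> \<le> exp (K * (s - p)) * xrF i p q r s"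
      using d K xp by (intro mult_right_mono iffD2[OF exp_le_cancel_iff] mult_left_mono) auto
    finally have x: "xr p q r s \<le> exp (K * (s - p)) * xrF i p q r s" .
    have 1: "r - q \<le> xr p q r s * (q - p)"
    proof -
      have "(r - q) * 1 \<le> (r - q) * ((s - p) / (s - r))" using d by (intro mult_left_mono) auto
      also have "\<dots> = xr p q r s * (q - p)" using d by (simp add: xr_def)
      finally show ?thesis by simp
    qed
    have 2: "r - q \<le> xr p q r s * (s - r)"
    proof -
      have "(r - q) * 1 \<le> (r - q) * ((s - p) / (q - p))" using d by (intro mult_left_mono) auto
      also have "\<dots> = xr p q r s * (s - r)" using d by (simp add: xr_def)
      finally show ?thesis by simp
    qed
    have "K * (r - q) \<le> K * (exp (K * (s - p)) * xrF i p q r s * (q - p))"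
      using order_trans[OF 1 mult_right_mono[OF x, of "q - p"]] d K by (intro mult_left_mono) auto
    moreover have "K * (r - q) \<le> K * (exp (K * (s - p)) * xrF i p q r s * (s - r))"
      using order_trans[OF 2 mult_right_mono[OF x, of "s - r"]] d K by (intro mult_left_mono) auto
    ultimately show ?thesis unfolding Vi by (simp add: right_diff_distrib' algebra_simps)
  qed
  {
    case 0
    then show ?case by (intro base) auto
  next
    case 1
    then show ?case by (intro base) auto
  next
    case (ge2 n)
    have d: "q \<in> dom (Suc (Suc n))" "r \<in> dom (Suc (Suc n))" using ge2.prems by (auto simp: dom_def)
    note dd = d ge2.prems(1,2)
    note lt = pull_less_dom[of p n q] pull_less_dom[of q n r] pull_less_dom[of r n s]
    let ?X = "xrF (Suc (Suc n)) p q r s" and ?e = "exp (V (Suc (Suc n)) s - V (Suc (Suc n)) p)"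
    define A where "A = V (Suc n) (- p) - V (Suc n) (- s)"
    define B where "B = V n (pull n s) - V n (pull n p)"
    have AB: "V (Suc (Suc n)) s - V (Suc (Suc n)) p = A + B" by (simp add: A_def B_def V.simps(3))
    have A0: "0 \<le> A" using V_diff_nonneg[OF minus_dom minus_dom, of s n p] dd ge2.prems by (simp add: A_def)
    have Xeq: "xrF n (pull n p) (pull n q) (pull n r) (pull n s) = ?X" by (simp add: F_pull)
    have Xp: "0 < ?X" using xrF_pos dd ge2.prems by auto
    have i1: "V n (pull n r) - V n (pull n q) \<le> exp B * ?X * (V n (pull n q) - V n (pull n p))"
      "V n (pull n r) - V n (pull n q) \<le> exp B * ?X * (V n (pull n s) - V n (pull n r))"
      using ge2.IH(1)[of "pull n p" "pull n s" "pull n q" "pull n r"] pull_dom' lt dd ge2.prems unfolding Xeq B_def by auto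
    let ?x = "xrF (Suc n) (- s) (- r) (- q) (- p)"
    have i2: "V (Suc n) (- q) - V (Suc n) (- r) \<le> exp A * ?x * (V (Suc n) (- r) - V (Suc n) (- s))"
      "V (Suc n) (- q) - V (Suc n) (- r) \<le> exp A * ?x * (V (Suc n) (- p) - V (Suc n) (- q))"
      using ge2.IH(2)[of "- s" "- p" "- r" "- q"] minus_dom dd ge2.prems unfolding A_def by auto
    have "?x \<le> xr (pull n p) (pull n q) (pull n r) (pull n s)"
      using xrF_le_pull[of n p q r s] ge2.prems X_Y[of "Suc (Suc n)"] by (auto simp: dom_Suc_Suc)
    also have "\<dots> \<le> exp (V n (pull n s) - V n (pull n q)) * ?X"
      using expand[of "pull n p" n "pull n s" "pull n q" "pull n r"] pull_dom' lt dd ge2.prems unfolding Xeq by auto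
    also have "\<dots> \<le> exp B * ?X"
      using V_mono[OF pull_dom' pull_dom', of p n q] lt(1) dd ge2.prems Xp by (intro mult_right_mono) (auto simp: B_def)
    finally have x: "?x \<le> exp B * ?X" .
    have eA: "exp B * ?X \<le> ?e * ?X" using A0 Xp unfolding AB by (intro mult_right_mono) auto
    have eB: "exp A * ?x \<le> ?e * ?X" using x unfolding AB by (simp add: exp_add mult.assoc mult_left_mono)
    have n1: "0 \<le> V n (pull n q) - V n (pull n p)" "0 \<le> V n (pull n s) - V n (pull n r)"
      using V_diff_nonneg[OF pull_dom' pull_dom', of p n q] V_diff_nonneg[OF pull_dom' pull_dom', of r n s] lt dd ge2.prems by auto
    have n2: "0 \<le> V (Suc n) (- r) - V (Suc n) (- s)" "0 \<le> V (Suc n) (- p) - V (Suc n) (- q)"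
      using V_diff_nonneg[OF minus_dom minus_dom, of s n r] V_diff_nonneg[OF minus_dom minus_dom, of q n p] dd ge2.prems by auto
    have j1: "V n (pull n r) - V n (pull n q) \<le> ?e * ?X * (V n (pull n q) - V n (pull n p))"
      "V n (pull n r) - V n (pull n q) \<le> ?e * ?X * (V n (pull n s) - V n (pull n r))"
      using order_trans[OF i1(1) mult_right_mono[OF eA n1(1)]] order_trans[OF i1(2) mult_right_mono[OF eA n1(2)]] by auto
    have j2: "V (Suc n) (- q) - V (Suc n) (- r) \<le> ?e * ?X * (V (Suc n) (- r) - V (Suc n) (- s))"
      "V (Suc n) (- q) - V (Suc n) (- r) \<le> ?e * ?X * (V (Suc n) (- p) - V (Suc n) (- q))"
      using order_trans[OF i2(1) mult_right_mono[OF eB n2(1)]] order_trans[OF i2(2) mult_right_mono[OF eB n2(2)]] by auto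
    have v: "V (Suc (Suc n)) y - V (Suc (Suc n)) x = (V n (pull n y) - V n (pull n x)) + (V (Suc n) (- x) - V (Suc n) (- y))" for x y
      by (simp add: V.simps(3))
    show ?case
      using add_mono[OF j1(1) j2(2)] add_mono[OF j1(2) j2(1)] unfolding v[of r q] v[of q p] v[of s r] distrib_left[symmetric]
      by blast
  }
qed

text \<open>The analogue of \<open>V_quad_comparison\<close> with the first point moved to the
  pole \<open>- Y n\<close>.\<close>

lemma V_pole_comparison:
  assumes M: "\<And>n. osc n \<le> M" and "q \<in> dom n" "s \<in> dom n" "q < r" "r < s"
  shows "V n r - V n q \<le> exp (2 * M) * ((F n r - F n q) / (F n s - F n r)) * (V n s - V n r)"
  using assms(2-)
proof (induction n arbitrary: q r s rule: induct_nat_012)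
  have M0: "0 \<le> M" using M[of 0] osc_nonneg[of 0] by linarith
  have base: "V i r - V i q \<le> exp (2 * M) * ((F i r - F i q) / (F i s - F i r)) * (V i s - V i r)"
    if i: "i < 2" and d: "q \<in> dom i" "s \<in> dom i" "q < r" "r < s" for i q r s
  proof -
    have "i = 0 \<or> i = Suc 0" using i by auto
    then have Vi: "V i x = K * x" for x by auto
    have r: "r \<in> dom i" using d by (auto simp: dom_def)
    have f: "0 < (F i r - F i q) / (F i s - F i r)" using F_less[of q i r] F_less[of r i s] d r by simp
    have q: "0 < q + Y i" using d X_Y[of i] by (auto simp: dom_def)
    have "(r - q) * 1 \<le> (r - q) * ((s + Y i) / (q + Y i))" using d q by (intro mult_left_mono) auto
    also have "\<dots> = xr (- Y i) q r s * (s - r)" using d q by (simp add: xr_def)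
    also have "\<dots> \<le> exp (osc i) * ((F i r - F i q) / (F i s - F i r)) * (s - r)"
      using expand_pole_osc[of q i s r] d by (intro mult_right_mono) auto
    also have "\<dots> \<le> exp (2 * M) * ((F i r - F i q) / (F i s - F i r)) * (s - r)"
      using M[of i] M0 f d by (intro mult_right_mono) auto
    finally have "K * (r - q) \<le> K * (exp (2 * M) * ((F i r - F i q) / (F i s - F i r)) * (s - r))"
      using K by (intro mult_left_mono) auto
    then show ?thesis unfolding Vi by (simp add: algebra_simps)
  qed
  {
    case 0
    then show ?case by (intro base) auto
  next
    case 1
    then show ?case by (intro base) auto
  next
    case (ge2 n)
    have d: "r \<in> dom (Suc (Suc n))" using ge2.prems by (auto simp: dom_def)
    note dd = d ge2.prems(1,2)
    note lt = pull_less_dom[of q n r] pull_less_dom[of r n s]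
    define p where "p = - Y (Suc (Suc n))"
    have p: "p < q" using ge2.prems X_Y[of "Suc (Suc n)"] by (auto simp: p_def dom_Suc_Suc)
    have mp: "- p \<in> dom (Suc n)" using reflect_dom[of n p] p ge2.prems by (auto simp: p_def dom_Suc_Suc)
    let ?r = "(F (Suc (Suc n)) r - F (Suc (Suc n)) q) / (F (Suc (Suc n)) s - F (Suc (Suc n)) r)"
    have rp: "0 < ?r" using F_less[of q "Suc (Suc n)" r] F_less[of r "Suc (Suc n)" s] dd ge2.prems by simp
    have 1: "V n (pull n r) - V n (pull n q) \<le> exp (2 * M) * ?r * (V n (pull n s) - V n (pull n r))"
      using ge2.IH(1)[of "pull n q" "pull n s" "pull n r"] pull_dom' lt dd ge2.prems by (simp add: F_pull)
    let ?x = "xrF (Suc n) (- s) (- r) (- q) (- p)"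
    have "?x \<le> xr (pull n p) (pull n q) (pull n r) (pull n s)"
      using xrF_le_pull[of n p q r s] ge2.prems p by (auto simp: dom_Suc_Suc p_def)
    also have "\<dots> \<le> exp (osc n) * ?r"
      using expand_pole_osc[of "pull n q" n "pull n s" "pull n r"] pull_dom' lt dd ge2.prems by (simp add: F_pull p_def pull_Y)
    also have "\<dots> \<le> exp M * ?r" using M[of n] rp by (intro mult_right_mono) auto
    finally have x: "?x \<le> exp M * ?r" .
    have xp: "0 < ?x" using xrF_pos[of "- s" "Suc n" "- r" "- q" "- p"] minus_dom dd mp p ge2.prems by auto
    have "exp (V (Suc n) (- p) - V (Suc n) (- s)) \<le> exp M"
      using V_le_osc[of "- s" "Suc n" "- p"] M[of "Suc n"] minus_dom dd mp by auto
    then have "exp (V (Suc n) (- p) - V (Suc n) (- s)) * ?x \<le> exp M * (exp M * ?r)"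
      using x xp by (intro mult_mono) auto
    also have "\<dots> = exp (2 * M) * ?r" by (simp add: exp_double power2_eq_square mult.assoc)
    finally have y: "exp (V (Suc n) (- p) - V (Suc n) (- s)) * ?x \<le> exp (2 * M) * ?r" .
    have "V (Suc n) (- q) - V (Suc n) (- r) \<le> exp (V (Suc n) (- p) - V (Suc n) (- s)) * ?x * (V (Suc n) (- r) - V (Suc n) (- s))"
      using V_quad_comparison[of "- s" "Suc n" "- p" "- r" "- q"] minus_dom dd mp p ge2.prems by auto
    also have "\<dots> \<le> exp (2 * M) * ?r * (V (Suc n) (- r) - V (Suc n) (- s))"
      using y V_diff_nonneg[OF minus_dom minus_dom, of s n r] dd ge2.prems by (intro mult_right_mono) auto
    finally have 2: "V (Suc n) (- q) - V (Suc n) (- r) \<le> exp (2 * M) * ?r * (V (Suc n) (- r) - V (Suc n) (- s))" .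
    have v: "V (Suc (Suc n)) y - V (Suc (Suc n)) x = (V n (pull n y) - V n (pull n x)) + (V (Suc n) (- x) - V (Suc n) (- y))" for x y
      by (simp add: V.simps(3))
    show ?case using add_mono[OF 1 2] unfolding v[of r q] v[of s r] distrib_left[symmetric] .
  }
qed

lemma X_excess:
  assumes c: "0 < c" "\<And>n. c \<le> u n"
  shows "\<exists>\<kappa>>0. \<forall>n. \<kappa> * P (n + 4) \<le> X (n + 2) - P (n + 4)"
proof -
  obtain M where M: "\<And>n. osc n \<le> M" using osc_bounded by blast
  obtain \<rho> where \<rho>: "0 < \<rho>" "\<And>n. \<rho> \<le> 1 - h n" using h_bounded_away by blast
  define A where "A = exp M * (1 / (c * \<rho>))"
  have A: "0 < A" using c \<rho> by (simp add: A_def)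
  have "1 / A * P (m + 4) \<le> X (m + 2) - P (m + 4)" for m
  proof -
    define p x1 x2 where "p = P (m + 4)" and "x1 = X (Suc m)" and "x2 = X (m + 2)"
    have o: "0 < p" "p < x2" "0 < x1" using ords by (simp_all add: p_def x1_def x2_def numeral_eq_Suc)
    have hc: "c \<le> h (m + 3)" using c(2)[of "m + 3"] u_le_h[of "m + 3"] by linarith
    have "p / (x2 - p) = p * x1 / ((x2 - p) * x1)" using o by simp
    also have "\<dots> \<le> p * (x1 + x2) / ((x2 - p) * x1)" using o by (intro divide_right_mono mult_left_mono) auto
    also have "\<dots> \<le> exp (osc (m + 2)) * ((1 - h (m + 3)) / (h (m + 3) * (1 - h (Suc m))))"
      using space_ineq[of m] by (simp add: p_def x1_def x2_def)
    also have "\<dots> \<le> A" unfolding A_def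
      using M[of "m + 2"] \<rho>(1) \<rho>(2)[of "Suc m"] hc c(1) h_pos[of "m + 3"] h_less[of "m + 3"] h_less[of "Suc m"]
      by (intro mult_mono frac_le) auto
    finally show ?thesis using A o by (simp add: p_def x2_def field_simps)
  qed
  then show ?thesis using A by (intro exI[of _ "1 / A"]) auto
qed

text \<open>If \<open>X\<close> came close to \<open>Y\<close>, then \<open>flat_ineq\<close>
  would push \<open>X (n + 2)\<close> towards \<open>P (n + 4)\<close>, which
  \<open>X_excess\<close> excludes.\<close>

lemma gap_lower:
  assumes c: "0 < c" "\<And>n. c \<le> u n"
  shows "\<exists>\<kappa>>0. \<kappa> < 1 \<and> (\<forall>n. X (n + 2) \<le> (1 - \<kappa>) * Y (n + 2))"
proof -
  obtain M where M: "\<And>n. osc n \<le> M" using osc_bounded by blast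
  obtain \<rho> where \<rho>: "0 < \<rho>" "\<And>n. \<rho> \<le> 1 - h n" using h_bounded_away by blast
  obtain \<kappa> where \<kappa>: "0 < \<kappa>" "\<And>n. \<kappa> * P (n + 4) \<le> X (n + 2) - P (n + 4)" using X_excess[OF c] by blast
  define A where "A = exp M * (1 / \<rho>)"
  have A: "0 < A" using \<rho> by (simp add: A_def)
  have main: "\<kappa> / A * Y (m + 2) \<le> Y (m + 2) - X (m + 2)" for m
  proof -
    define p x y where "p = P (m + 4)" and "x = X (m + 2)" and "y = Y (m + 2)"
    have o: "0 < p" "p < x" "x < y" using ords by (simp_all add: p_def x_def y_def numeral_eq_Suc)
    have "\<kappa> * (y / (y - x)) \<le> (x - p) / p * (y / (y - x))"
      using \<kappa>(2)[of m] o by (intro mult_right_mono) (auto simp: p_def x_def field_simps)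
    also have "\<dots> = (x - p) * y / ((y - x) * p)" using o by simp
    also have "\<dots> \<le> exp (osc (m + 2)) * (h (Suc (m + 2)) / (1 - h (Suc (m + 2))))"
      using flat_ineq[of "m + 2"] by (simp add: p_def x_def y_def numeral_eq_Suc)
    also have "\<dots> \<le> A" unfolding A_def
      using M[of "m + 2"] \<rho>(1) \<rho>(2)[of "Suc (m + 2)"] h_less[of "Suc (m + 2)"] h_pos[of "Suc (m + 2)"]
      by (intro mult_mono frac_le) auto
    finally show ?thesis using A o by (simp add: x_def y_def field_simps)
  qed
  have "\<kappa> / A * Y 2 < 1 * Y 2" using main[of 0] X_pos[of 2] by (simp add: numeral_2_eq_2)
  then have "\<kappa> / A < 1" using Y_pos[of 2] by (metis mult_less_cancel_right_pos)
  then show ?thesis using main \<kappa> A by (intro exI[of _ "\<kappa> / A"]) (auto simp: algebra_simps)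
qed

text \<open>When \<open>u\<close> is bounded below, the image of the gap under the branch is
  comparable to the image of the whole left part. The two comparison lemmas for \<open>V\<close>
  then bound the distortion on either side of the gap by the distortion in the gap.\<close>

lemma mass_left_le_gap:
  assumes c: "0 < c" "\<And>n. c \<le> u n"
  shows "\<exists>A. \<forall>n. mass_left (n + 2) \<le> A * mass_gap (n + 2)"
proof -
  obtain M where M: "\<And>n. osc n \<le> M" using osc_bounded by blast
  obtain \<rho> where \<rho>: "0 < \<rho>" "\<And>n. \<rho> \<le> 1 - h n" using h_bounded_away by blast
  obtain \<kappa> where \<kappa>: "0 < \<kappa>" "\<kappa> < 1" "\<And>n. X (n + 2) \<le> (1 - \<kappa>) * Y (n + 2)" using gap_lower[OF c] by blast
  define A1 where "A1 = exp (2 * M) * (Lmax / \<kappa>)"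
  define A2 where "A2 = exp M * (Lmax / (\<kappa> * c * \<rho>))"
  have "mass_left (m + 2) \<le> (A1 + 1 + A2) * mass_gap (m + 2)" for m
  proof -
    let ?n = "Suc (Suc m)"
    define g where "g = 1 / L ?n"
    have g: "0 < g" "g \<le> 1" "1 / Lmax \<le> g"
      using L_ge1[of ?n] L_le[of ?n] by (auto simp: g_def field_simps)
    define w where "w = P (Suc m) powr g"
    define x where "x = X (Suc ?n) powr g"
    define y where "y = Y (Suc ?n) powr g"
    have w: "0 < w" using P_pos[of "Suc m"] by (simp add: w_def)
    have y: "0 < y" and x: "0 < x" using Y_pos[of "Suc ?n"] X_pos[of "Suc ?n"] by (auto simp: y_def x_def)
    have F: "F ?n (- X ?n) = 0" "F ?n (- Y (Suc (Suc ?n))) = x" "F ?n (- X (Suc (Suc ?n))) = y"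
      "F ?n 0 = h (Suc m) * w" "F ?n (X (Suc m)) = w"
      using P_powr_h[of "Suc m"] by (simp_all add: F_X F_Y2 F_X2 F_0 F_end x_def y_def w_def g_def L_period)
    have "x \<le> ((1 - \<kappa>) * Y (Suc ?n)) powr g"
      unfolding x_def using \<kappa>(3)[of "Suc m"] X_pos[of "Suc ?n"] g by (intro powr_mono2) (auto intro: less_imp_le)
    also have "\<dots> = (1 - \<kappa>) powr g * y" using \<kappa> Y_pos[of "Suc ?n"] by (simp add: y_def powr_mult)
    also have "\<dots> \<le> (1 - g * \<kappa>) * y"
      using powr_le_affine[of "1 - \<kappa>" g] \<kappa> g y by (intro mult_right_mono) auto
    finally have "g * \<kappa> * y \<le> y - x" by (simp add: algebra_simps)
    moreover have "\<kappa> / Lmax * y \<le> g * \<kappa> * y"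
      using mult_right_mono[OF g(3), of "\<kappa> * y"] \<kappa> y by (simp add: mult.assoc)
    ultimately have gap: "\<kappa> / Lmax * y \<le> y - x" by linarith
    have L0: "0 < Lmax" using Lmax_ge1 by simp
    have yx: "0 < y - x" using gap \<kappa> y L0 by (meson divide_pos_pos less_le_trans mult_pos_pos)
    have "Y (Suc ?n) > P (Suc (Suc (Suc ?n)))" using P_X[of "Suc ?n"] X_Y[of "Suc ?n"] by linarith
    then have "P (Suc (Suc (Suc ?n))) powr g \<le> y"
      unfolding y_def using g P_pos[of "Suc (Suc (Suc ?n))"] by (intro powr_mono2) auto
    moreover have "P (Suc (Suc (Suc ?n))) powr g = h (m + 3) * (h (Suc m) * w)"
      using P4_powr_h[of "Suc m"] by (simp add: g_def w_def L_period numeral_3_eq_3)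
    moreover have "c * (h (Suc m) * w) \<le> h (m + 3) * (h (Suc m) * w)"
      using c(2)[of "m + 3"] u_le_h[of "m + 3"] h_pos[of "Suc m"] w by (intro mult_right_mono) auto
    ultimately have yc: "c * (h (Suc m) * w) \<le> y" by linarith
    have left: "V ?n (- Y (Suc (Suc ?n))) - V ?n (- X ?n) \<le> A1 * mass_gap ?n"
    proof -
      have "V ?n (- Y (Suc (Suc ?n))) - V ?n (- X ?n) \<le> exp (2 * M) * ((x - 0) / (y - x)) * mass_gap ?n"
        using V_pole_comparison[OF M, of "- X ?n" ?n "- X (Suc (Suc ?n))" "- Y (Suc (Suc ?n))"]
          flat_end_dom inner_dom Y2_X[of ?n] X_Y[of "Suc (Suc ?n)"] by (simp add: F mass_gap_def)
      also have "(x - 0) / (y - x) \<le> Lmax / \<kappa>"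
      proof -
        have "x / (y - x) \<le> y / (\<kappa> / Lmax * y)" using gap yx \<kappa> y L0 by (intro frac_le) auto
        also have "\<dots> = Lmax / \<kappa>" using y by simp
        finally show ?thesis by simp
      qed
      finally show ?thesis unfolding A1_def using mass_nonneg(3)[of ?n] by (simp add: mult_right_mono)
    qed
    have right: "V ?n 0 - V ?n (- X (Suc (Suc ?n))) \<le> A2 * mass_gap ?n"
    proof -
      have d: "- Y (Suc (Suc ?n)) \<in> dom ?n" "X (Suc m) \<in> dom ?n" using inner_dom Suc_end_dom by auto
      have "V ?n 0 - V ?n (- X (Suc (Suc ?n)))
          \<le> exp (V ?n (X (Suc m)) - V ?n (- Y (Suc (Suc ?n)))) * xr x y (h (Suc m) * w) w * mass_gap ?n"
        using V_quad_comparison[OF d, of "- X (Suc (Suc ?n))" 0] X_Y[of "Suc (Suc ?n)"] X_pos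
        by (simp add: F mass_gap_def)
      also have "\<dots> \<le> exp M * (Lmax / (\<kappa> * c * \<rho>)) * mass_gap ?n"
      proof (intro mult_right_mono mult_mono)
        show "exp (V ?n (X (Suc m)) - V ?n (- Y (Suc (Suc ?n)))) \<le> exp M"
          using V_le_osc[OF d] M[of ?n] by simp
        have hw: "0 < h (Suc m) * w" "h (Suc m) * w \<le> (1 - \<rho>) * w"
          using h_pos[of "Suc m"] w \<rho>(2)[of "Suc m"] by auto
        have yh: "y < h (Suc m) * w"
          using F_less[of "- X (Suc (Suc ?n))" ?n 0] inner_dom zero_dom X_pos[of "Suc (Suc ?n)"] by (simp add: F)
        have xw: "x < w"
          using yh yx mult_strict_right_mono[OF h_less[of "Suc m"] w] by linarith
        have "xr x y (h (Suc m) * w) w = (h (Suc m) * w - y) * (w - x) / ((y - x) * (w - h (Suc m) * w))"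
          by (simp add: xr_def)
        also have "\<dots> \<le> (h (Suc m) * w) * w / ((\<kappa> / Lmax * (c * (h (Suc m) * w))) * (\<rho> * w))"
        proof (intro frac_le mult_mono)
          show "\<kappa> / Lmax * (c * (h (Suc m) * w)) \<le> y - x"
            using mult_left_mono[OF yc, of "\<kappa> / Lmax"] gap divide_pos_pos[OF \<kappa>(1) L0] by linarith
          show "\<rho> * w \<le> w - h (Suc m) * w" using hw by (simp add: algebra_simps)
        qed (use xw hw yh w x y yx \<kappa> c L0 \<rho> in \<open>auto intro!: mult_nonneg_nonneg mult_pos_pos divide_pos_pos less_imp_le\<close>)
        also have "\<dots> = ((h (Suc m) * w) * w) * 1 / (((h (Suc m) * w) * w) * (\<kappa> * c * \<rho> / Lmax))"
          by (simp add: mult.assoc mult.left_commute)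
        also have "\<dots> = Lmax / (\<kappa> * c * \<rho>)" using hw w by (subst mult_divide_mult_cancel_left) auto
        finally show "xr x y (h (Suc m) * w) w \<le> Lmax / (\<kappa> * c * \<rho>)" .
        show "0 \<le> xr x y (h (Suc m) * w) w"
          using yx yh hw w \<rho>(1) xr_pos[of x y "h (Suc m) * w" w] h_less[of "Suc m"] by auto
      qed (use mass_nonneg in auto)
      finally show ?thesis by (simp add: A2_def)
    qed
    have "mass_left ?n = (V ?n (- Y (Suc (Suc ?n))) - V ?n (- X ?n)) + mass_gap ?n + (V ?n 0 - V ?n (- X (Suc (Suc ?n))))"
      by (simp add: mass_left_def mass_gap_def)
    then show ?thesis using left right by (simp add: algebra_simps numeral_2_eq_2)
  qed
  then show ?thesis by blast
qed

text \<open>The gap masses tend to zero since they are summable, and they dominate the left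
  masses, of which the oscillation is made.\<close>

lemma osc_tendsto_0:
  assumes c: "0 < c" "\<And>n. c \<le> u n"
  shows "osc \<longlonglongrightarrow> 0"
proof -
  obtain A where A: "\<And>n. mass_left (n + 2) \<le> A * mass_gap (n + 2)" using mass_left_le_gap[OF c] by blast
  have "(\<lambda>n. mass_gap (Suc n)) \<longlonglongrightarrow> 0" using mass_gap_summable by (rule summable_LIMSEQ_zero)
  then have "(\<lambda>n. mass_gap (n + 2)) \<longlonglongrightarrow> 0" using LIMSEQ_ignore_initial_segment[of "\<lambda>n. mass_gap (Suc n)" 0 1] by simp
  then have t: "(\<lambda>n. A * mass_gap (n + 2)) \<longlonglongrightarrow> A * 0" by (intro tendsto_intros)
  have "(\<lambda>n. mass_left (n + 2)) \<longlonglongrightarrow> 0"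
    by (rule tendsto_sandwich[of "\<lambda>_. 0" _ _ "\<lambda>n. A * mass_gap (n + 2)"]) (use A mass_nonneg t in auto)
  then have ml: "mass_left \<longlonglongrightarrow> 0" by (rule LIMSEQ_offset)
  have "(\<lambda>n. mass_left (n + 2) + mass_left (n + 1) + mass_left n) \<longlonglongrightarrow> 0 + 0 + 0"
    using ml by (intro tendsto_intros LIMSEQ_ignore_initial_segment) auto
  then have t2: "(\<lambda>n. mass_left (n + 2) + mass_left (n + 1) + mass_left n) \<longlonglongrightarrow> 0" by simp
  have "(\<lambda>n. osc (n + 2)) \<longlonglongrightarrow> 0"
    by (rule tendsto_sandwich[of "\<lambda>_. 0" _ _ "\<lambda>n. mass_left (n + 2) + mass_left (n + 1) + mass_left n"])
      (use osc_le_mass osc_nonneg t2 in auto)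
  then show ?thesis by (rule LIMSEQ_offset)
qed

end

section \<open>Dichotomy for the ratios of a tower\<close>

text \<open>The weights \<open>g n\<close> form an eigenvector of the recursion: if \<open>z i
  \<le> g i * S\<close> for \<open>i = n\<close> and \<open>i = n + 1\<close>, then \<open>g n *
  (z n + z (n + 1)) \<le> g n * (g 0 + g 1) * S\<close>, which leaves room for the constant
  \<open>k\<close> once \<open>S\<close> is large.\<close>

lemma exponents_bounded:
  fixes z g :: "nat \<Rightarrow> real"
  assumes g: "\<And>n. 0 < g n" "\<And>n. g (Suc (Suc n)) = g n" "g 0 + g 1 < 1"
    and z: "\<And>n. z (Suc (Suc n)) \<le> g n * (z n + z (Suc n)) + k"
  shows "\<exists>B. \<forall>n. z n \<le> B"
proof -
  define G where "G = g 0 + g 1"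
  have gg: "g n + g (Suc n) = G" for n
    by (induction n rule: induct_nat_012) (auto simp: G_def g)
  have G1: "0 < 1 - G" using g by (simp add: G_def)
  define S where "S = Max {0, z 0 / g 0, z 1 / g 1, k / (g 0 * (1 - G)), k / (g 1 * (1 - G))}"
  have S: "0 \<le> S" "z 0 / g 0 \<le> S" "z 1 / g 1 \<le> S" "k / (g 0 * (1 - G)) \<le> S" "k / (g 1 * (1 - G)) \<le> S"
    by (auto simp: S_def)
  have kS: "k \<le> g n * (1 - G) * S" for n
  proof (induction n rule: induct_nat_012)
    case 0
    then show ?case using S(4) g(1)[of 0] G1 by (simp add: pos_divide_le_eq mult.commute mult.left_commute)
  next
    case 1
    then show ?case using S(5) g(1)[of 1] G1 by (simp add: pos_divide_le_eq mult.commute mult.left_commute)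
  qed (simp add: g)
  have "z n \<le> g n * S" for n
  proof (induction n rule: induct_nat_012)
    case 0
    then show ?case using S(2) g(1)[of 0] by (simp add: pos_divide_le_eq mult.commute)
  next
    case 1
    then show ?case using S(3) g(1)[of 1] by (simp add: pos_divide_le_eq mult.commute)
  next
    case (ge2 n)
    have "g n * (z n + z (Suc n)) \<le> g n * (g n * S + g (Suc n) * S)"
      using ge2 g(1)[of n] by (intro mult_left_mono) auto
    also have "\<dots> = g n * (G * S)" by (simp add: gg[of n, symmetric] algebra_simps)
    finally have "z (Suc (Suc n)) \<le> g n * (G * S) + g n * (1 - G) * S" using z[of n] kS[of n] by linarith
    then show ?case by (simp add: g algebra_simps)
  qed
  moreover have "g n * S \<le> 1 * S" for n
    using gg[of n] g(1)[of "Suc n"] g(1)[of n] g(3) S(1) by (intro mult_right_mono) (auto simp: G_def)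
  ultimately show ?thesis by (metis order_trans mult_1)
qed

context flat_tower begin

lemma L_sum: "1 / L n + 1 / L (Suc n) = 1 / L 0 + 1 / L 1"
  by (induction n rule: induct_nat_012) (auto simp: L_period)

text \<open>The combination of \<open>X_ratio_ineq\<close> and \<open>e_ineq\<close>, in which the
  lengths \<open>X\<close> cancel and only the ratios \<open>e\<close> remain.\<close>

lemma near_recursion:
  assumes o: "osc (Suc m) \<le> \<epsilon>" "osc (m + 2) \<le> \<epsilon>"
  shows "e (m + 3) * (1 - h (m + 2) + e (m + 2)) * (1 - h (Suc m)) \<le> exp (2 * \<epsilon>) * (h (Suc m) * (1 - h (m + 3)))"
proof -
  define C where "C = exp \<epsilon>"
  have C: "1 \<le> C" using o osc_nonneg[of "m + 2"] by (simp add: C_def)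
  define e1 e2 h0 h1 h2 R where "e1 = e (m + 2)" and "e2 = e (m + 3)" and "h0 = h (Suc m)"
    and "h1 = h (m + 2)" and "h2 = h (m + 3)" and "R = P (m + 3) / X (Suc m)"
  have hp: "0 < h0" "h0 < 1" "0 < h1" "h1 < 1" "0 < h2" "h2 < 1" "0 < e1" "0 < e2"
    using h_pos h_less e_pos by (auto simp: e1_def e2_def h0_def h1_def h2_def)
  have Rp: "0 < R" using P_pos X_pos by (simp add: R_def)
  have "1 / R - 1 \<le> exp (osc (Suc m)) * (h1 / (1 - h1))"
    using X_ratio_ineq[of "Suc m"] by (simp add: R_def h1_def numeral_eq_Suc)
  also have "\<dots> \<le> C * (h1 / (1 - h1))" using o hp by (intro mult_right_mono) (auto simp: C_def)
  finally have "1 / R \<le> C * (h1 / (1 - h1)) + 1" by simp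
  also have "\<dots> \<le> C * (h1 / (1 - h1)) + C" using C by simp
  also have "\<dots> = C / (1 - h1)" using hp by (simp add: field_simps)
  finally have "(1 - h1) / C \<le> R" using Rp C hp by (simp add: field_simps)
  then have "e2 * ((1 - h1) / C + e1 / C) \<le> e2 * (R + e1)"
    using hp C by (intro mult_left_mono add_mono) (auto simp: field_simps)
  also have "\<dots> \<le> exp (osc (m + 2)) * (h0 * (1 - h2) / (1 - h0))"
    using e_ineq[of m] by (simp add: e1_def e2_def h0_def h2_def R_def)
  also have "\<dots> \<le> C * (h0 * (1 - h2) / (1 - h0))" using o hp by (intro mult_right_mono) (auto simp: C_def)
  finally have "e2 * (1 - h1 + e1) / C \<le> C * (h0 * (1 - h2)) / (1 - h0)"
    by (simp add: add_divide_distrib[symmetric])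
  then have "e2 * (1 - h1 + e1) * (1 - h0) \<le> C * (h0 * (1 - h2)) * C"
    by (rule frac_cross_le) (use hp C in auto)
  also have "\<dots> = exp (2 * \<epsilon>) * (h0 * (1 - h2))"
    by (simp add: C_def exp_double power2_eq_square)
  finally show ?thesis by (simp add: e1_def e2_def h0_def h1_def h2_def)
qed

text \<open>The oscillation is eventually so small that the factor \<open>exp (2 *
  \<epsilon>)\<close> loses against the decay in \<open>no_bounded_solution\<close>, which then
  excludes the remaining tail of the tower.\<close>

theorem u_not_bounded_below:
  assumes L: "1 < 1 / L 0 + 1 / L 1" and c: "0 < c" "\<And>n. c \<le> u n"
  shows False
proof -
  obtain d where d: "0 < d" "\<And>n. u n \<le> 1 - d" using u_bounded_away by blast
  obtain B where B: "\<And>n. e n \<le> B" using e_bounded by blast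
  define k where "k = 1 / L 0 + 1 / L 1 - 1"
  have k: "0 < k" using L by (simp add: k_def)
  have d1: "0 < 1 - d" using d(2)[of 0] u_pos[of 0] by linarith
  \<comment> \<open>Chosen such that \<open>4 * \<epsilon>\<close> is half of \<open>- k * ln (1 -
    d)\<close>.\<close>
  define \<epsilon> where "\<epsilon> = - (k * ln (1 - d)) / 8"
  have \<epsilon>: "0 < \<epsilon>" using k d(1) d1 by (simp add: \<epsilon>_def mult_pos_neg)
  have "eventually (\<lambda>n. osc n < \<epsilon>) sequentially"
    using osc_tendsto_0[OF c] \<epsilon> by (rule order_tendstoD)
  then obtain N where N: "\<And>n. N \<le> n \<Longrightarrow> osc n < \<epsilon>" by (auto simp: eventually_sequentially)
  define g where "g n = 1 / L (Suc (n + Suc N))" for n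
  define e' where "e' n = e (n + Suc N)" for n
  have u': "e' n * e' (Suc n) = u (n + Suc N)" for n by (simp add: e'_def u_e)
  have h': "(e' n * e' (Suc n)) powr g n = h (n + Suc N)" for n by (simp add: u' g_def h_def)
  show False
  proof (rule no_bounded_solution[of e' B c d g "exp (2 * \<epsilon>)"])
    show "0 < e' n" for n by (simp add: e'_def e_pos)
    show "e' n \<le> B" for n by (simp add: e'_def B)
    show "c \<le> e' n * e' (Suc n)" for n unfolding u' by (rule c)
    show "0 < c" by (rule c)
    show "e' n * e' (Suc n) \<le> 1 - d" for n unfolding u' by (rule d)
    show "0 < d" by (rule d)
    show "0 < g n" "g n \<le> 1" for n using L_ge1[of "Suc (n + Suc N)"] by (auto simp: g_def)
    show "g (Suc (Suc n)) = g n" for n by (simp add: g_def L_period)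
    have gs: "g 0 + g 1 = 1 / L 0 + 1 / L 1" using L_sum[of "Suc (Suc N)"] by (simp add: g_def)
    show "1 < g 0 + g 1" unfolding gs by (rule L)
    have "(exp (2 * \<epsilon>))\<^sup>2 * (1 - d) powr (g 0 + g 1 - 1) = exp (4 * \<epsilon> + k * ln (1 - d))"
      unfolding gs k_def[symmetric] using d1 by (simp add: powr_def exp_add exp_double[symmetric])
    also have "4 * \<epsilon> + k * ln (1 - d) = - 4 * \<epsilon>" by (simp add: \<epsilon>_def)
    finally show "(exp (2 * \<epsilon>))\<^sup>2 * (1 - d) powr (g 0 + g 1 - 1) < 1" using \<epsilon> by simp
    fix n
    have "e (n + N + 3) * (1 - h (n + N + 2) + e (n + N + 2)) * (1 - h (Suc (n + N)))
        \<le> exp (2 * \<epsilon>) * (h (Suc (n + N)) * (1 - h (n + N + 3)))"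
      by (rule near_recursion) (use N in \<open>auto intro: less_imp_le\<close>)
    then show "e' (Suc (Suc n)) * (1 - (e' (Suc n) * e' (Suc (Suc n))) powr g (Suc n) + e' (Suc n)) * (1 - (e' n * e' (Suc n)) powr g n)
        \<le> exp (2 * \<epsilon>) * ((e' n * e' (Suc n)) powr g n * (1 - (e' (Suc (Suc n)) * e' (Suc (Suc (Suc n)))) powr g (Suc (Suc n))))"
      unfolding h' by (simp add: e'_def numeral_eq_Suc)
  qed simp
qed

text \<open>As \<open>e\<close> is bounded above, a lower bound for the product \<open>e n * e (n
  + 1)\<close> bounds both factors below, and every \<open>e\<close> is a factor of some
  \<open>u\<close> with odd index.\<close>

lemma u_bounded_below_of_odd:
  assumes c: "0 < c" "\<And>n. N \<le> n \<Longrightarrow> c \<le> u (Suc (2 * n))"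
  shows "\<exists>c'>0. \<forall>n. c' \<le> u n"
proof -
  obtain B where B: "\<And>n. e n \<le> B" using e_bounded by blast
  have Bp: "0 < B" using B[of 0] e_pos[of 0] by linarith
  have el: "c / B \<le> e n" if n: "2 * N + 2 \<le> n" for n
  proof (cases "even n")
    case False
    then obtain k where k: "n = Suc (2 * k)" by (metis oddE Suc_eq_plus1)
    have "c \<le> e n * e (Suc n)" using c(2)[of k] n k by (simp add: u_e)
    also have "\<dots> \<le> e n * B" using B[of "Suc n"] e_pos[of n] by (intro mult_left_mono) auto
    finally show ?thesis using Bp by (simp add: pos_divide_le_eq)
  next
    case True
    then obtain k where "n = 2 * k" by (rule evenE)
    then obtain k where k: "n = Suc (Suc (2 * k))" using n by (cases k) auto
    have "N \<le> k" using n k by linarith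
    then have "c \<le> e (Suc (2 * k)) * e n" using c(2)[of k] k by (simp add: u_e)
    also have "\<dots> \<le> B * e n" using B[of "Suc (2 * k)"] e_pos[of n] by (intro mult_right_mono) auto
    finally show ?thesis using Bp by (simp add: pos_divide_le_eq mult.commute)
  qed
  have ul: "(c / B)\<^sup>2 \<le> u n" if "2 * N + 2 \<le> n" for n
    unfolding u_e power2_eq_square using el[of n] el[of "Suc n"] that c(1) Bp e_pos[of n]
    by (intro mult_mono) (auto intro: less_imp_le)
  define c' where "c' = Min (insert ((c / B)\<^sup>2) (u ` {..2 * N + 2}))"
  have "0 < c'" using c(1) Bp u_pos by (auto simp: c'_def)
  moreover have "c' \<le> u n" for n
  proof (cases "2 * N + 2 \<le> n")
    case True
    then show ?thesis using ul[of n] by (auto simp: c'_def intro: order_trans[OF Min_le])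
  next
    case False
    then show ?thesis unfolding c'_def by (intro Min_le) auto
  qed
  ultimately show ?thesis by blast
qed

text \<open>The point \<open>s\<close> is the one whose image under the branch of level \<open>k +
  3\<close> is half of the image of \<open>0\<close>. By \<open>expand_pole\<close>,
  \<open>s\<close> is comparable to \<open>X (k + 3)\<close>, hence not much smaller than \<open>P
  (k + 5)\<close>. One branch later the value at \<open>s\<close> still stays away from the value
  at \<open>X (k + 3)\<close>, and the cross ratio of \<open>- P (k + 6)\<close>,
  \<open>0\<close>, \<open>s\<close>, \<open>X (k + 3)\<close> then bounds \<open>P (k + 6) /
  s\<close> from below by a multiple of \<open>h (k + 3)\<close>.\<close>

lemma e_lower: "\<exists>c>0. \<forall>k. c * h (k + 3) \<le> e (k + 5)"
proof -
  obtain M where M: "\<And>n. osc n \<le> M" using osc_bounded by blast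
  obtain \<rho> where \<rho>: "0 < \<rho>" "\<And>n. \<rho> \<le> 1 - h n" using h_bounded_away by blast
  define C where "C = exp M"
  have "0 \<le> M" using M[of 0] osc_nonneg[of 0] by linarith
  then have C: "1 \<le> C" by (simp add: C_def)
  have oC: "exp (osc n) \<le> C" for n using M[of n] by (simp add: C_def)
  define \<kappa> where "\<kappa> = 2 powr (- Lmax) * \<rho> / C"
  have \<kappa>: "0 < \<kappa>" using \<rho> C by (simp add: \<kappa>_def)
  define \<kappa>' where "\<kappa>' = \<kappa> / (1 + \<kappa>) * \<rho>"
  have \<kappa>': "0 < \<kappa>'" using \<kappa> \<rho> by (simp add: \<kappa>'_def)
  define c where "c = \<rho> * \<kappa>' / (C * (1 + C))"
  have c: "0 < c" using \<rho> \<kappa>' C by (simp add: c_def)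
  have "c * h (k + 3) \<le> e (k + 5)" for k
  proof -
    define na nb nc where "na = Suc (Suc k)" and "nb = Suc na" and "nc = Suc nb"
    note nn = na_def nb_def nc_def
    define W where "W = P nc powr (1 / L nb)"
    have W: "0 < W" using P_pos[of nc] by (simp add: W_def)
    have Fb: "F nb (- X nb) = 0" "F nb 0 = W" by (simp_all add: F_X F_0 W_def nc_def)
    have ctb: "continuous_on {- X nb..0} (F nb)"
      by (rule continuous_on_subset[OF F_cont]) (use E_nonneg[of nb] in \<open>auto simp: dom_def\<close>)
    obtain y where y: "- X nb \<le> y" "y \<le> 0" "F nb y = W / 2"
      using IVT'[of "F nb" "- X nb" "W / 2" 0] ctb W X_pos[of nb] Fb by auto
    define s where "s = - y"
    have "y \<noteq> - X nb" "y \<noteq> 0" using y Fb W by auto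
    then have s: "0 < s" "s < X nb" "F nb (- s) = W / 2" using y by (auto simp: s_def)
    define x where "x = X nb"
    have xs: "x - s \<le> C * s"
    proof -
      have "xr (- Y nb) (- X nb) (- s) 0 \<le> exp (osc nb) * ((F nb (- s) - F nb (- X nb)) / (F nb 0 - F nb (- s)))"
        by (rule expand_pole_osc) (use flat_end_dom zero_dom s in auto)
      also have "\<dots> = exp (osc nb)" using W by (simp add: Fb s(3))
      finally have 1: "(x - s) * Y nb / ((Y nb - x) * s) \<le> C"
        using oC[of nb] by (simp add: xr_def x_def)
      have "(x - s) / s = (x - s) * (Y nb - x) / ((Y nb - x) * s)" using X_Y[of nb] by (simp add: x_def)
      also have "\<dots> \<le> (x - s) * Y nb / ((Y nb - x) * s)"
        using s X_Y[of nb] X_pos[of nb] by (intro divide_right_mono mult_left_mono) (auto simp: x_def)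
      finally have "(x - s) / s \<le> C" using 1 by linarith
      then show ?thesis using s by (simp add: pos_divide_le_eq)
    qed
    \<comment> \<open>Taking the power turns the factor \<open>1 / 2\<close> at \<open>s\<close>
      into \<open>2 powr (- L)\<close> for its image \<open>- \<sigma>\<close> under
      \<open>pull\<close>.\<close>
    define \<sigma> where "\<sigma> = P nc / 2 powr L nb"
    have hs: "pull na s = - \<sigma>"
    proof -
      have "(W / 2) powr L nb = P nc / 2 powr L nb"
        using P_pos[of nc] by (simp add: powr_divide W_def)
      moreover have "pull na s = - (F nb (- s) powr L nb)" by (simp add: pull_def nb_def)
      ultimately show ?thesis by (simp only: s(3) \<sigma>_def)
    qed
    have \<sigma>: "0 < \<sigma>" "\<sigma> < P nc" and \<sigma>2: "2 powr (- Lmax) \<le> \<sigma> / P nc"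
    proof -
      have "1 < 2 powr L nb" using L_ge1[of nb] by simp
      then show "0 < \<sigma>" "\<sigma> < P nc" using P_pos[of nc] by (auto simp: \<sigma>_def field_simps)
      have "2 powr (- Lmax) \<le> 2 powr (- L nb)" using L_le[of nb] by (intro powr_mono) auto
      moreover have "\<sigma> / P nc = 2 powr (- L nb)"
        using P_pos[of nc] by (simp add: \<sigma>_def powr_minus_divide)
      ultimately show "2 powr (- Lmax) \<le> \<sigma> / P nc" by simp
    qed
    define g w where "g = 1 / L k" and "w = P (Suc k) powr g"
    have w: "0 < w" using P_pos[of "Suc k"] by (simp add: w_def)
    define J J5 I where "J = h (Suc k) * w" and "J5 = h (k + 3) * J" and "I = F na (- \<sigma>)"
    have Jw: "0 < J" "J \<le> (1 - \<rho>) * w" "J < w" "0 < J5" "J5 < J" "J5 \<le> (1 - \<rho>) * J"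
      using h_pos[of "Suc k"] h_less[of "Suc k"] \<rho>(2)[of "Suc k"] h_pos[of "k + 3"] h_less[of "k + 3"] \<rho>(2)[of "k + 3"] w
      by (auto simp: J_def J5_def)
    have Fa: "F na 0 = J" "F na (- P nc) = J5" "F na (X (Suc k)) = w"
      using P_powr_h[of "Suc k"] P4_powr_h[of "Suc k"]
      by (simp_all add: nn F_0 F_P2 F_end L_period w_def g_def J_def J5_def numeral_eq_Suc)
    have da: "- P nc \<in> dom na" "X (Suc k) \<in> dom na" "- \<sigma> \<in> dom na"
      using inner_dom(1)[of na] Suc_end_dom[of k] \<sigma> P_X[of na] by (auto simp: nn intro!: left_dom)
    have I: "J5 < I" "I < J"
      using F_less[OF da(1,3)] F_less[OF da(3) zero_dom] \<sigma> by (auto simp: Fa I_def)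
    have "2 powr (- Lmax) \<le> C * ((J - I) * (1 / ((I - J5) * \<rho>)))"
    proof -
      have "\<sigma> / P nc \<le> \<sigma> / (P nc - \<sigma>)" using \<sigma> by (intro divide_left_mono) auto
      also have "\<dots> = \<sigma> * X (Suc k) / ((P nc - \<sigma>) * X (Suc k))" using X_pos[of "Suc k"] by simp
      also have "\<dots> \<le> \<sigma> * (X (Suc k) + P nc) / ((P nc - \<sigma>) * X (Suc k))"
        using \<sigma> P_pos[of nc] X_pos[of "Suc k"] by (intro divide_right_mono mult_left_mono) auto
      also have "\<dots> = xr (- P nc) (- \<sigma>) 0 (X (Suc k))" by (simp add: xr_def)
      also have "\<dots> \<le> exp (osc na) * xr J5 I J w"
        using expand_osc[OF da(1,2), of "- \<sigma>" 0] \<sigma> X_pos[of "Suc k"] by (simp add: Fa I_def)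
      also have "\<dots> \<le> C * xr J5 I J w" using oC[of na] xr_pos[of J5 I J w] I Jw by (intro mult_right_mono) auto
      also have "xr J5 I J w = (J - I) * ((w - J5) / ((I - J5) * (w - J)))" by (simp add: xr_def)
      also have "(w - J5) / ((I - J5) * (w - J)) \<le> w / ((I - J5) * (\<rho> * w))"
        using I Jw w \<rho> by (intro frac_le mult_left_mono) (auto simp: algebra_simps)
      also have "\<dots> = 1 / ((I - J5) * \<rho>)" using w by simp
      finally show ?thesis using \<sigma>2 C I by (simp add: mult_left_mono)
    qed
    then have "2 powr (- Lmax) * ((I - J5) * \<rho>) \<le> C * (J - I)" using I \<rho> by (simp add: pos_le_divide_eq)
    then have "\<kappa> * (I - J5) \<le> J - I" using C by (simp add: \<kappa>_def field_simps)
    then have "\<kappa> * (J - J5) \<le> (1 + \<kappa>) * (J - I)" by (simp add: algebra_simps)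
    moreover have "\<kappa> * (\<rho> * J) \<le> \<kappa> * (J - J5)" using Jw \<kappa> by (intro mult_left_mono) (auto simp: algebra_simps)
    ultimately have JI: "\<kappa>' * J \<le> J - I" using \<kappa> by (simp add: \<kappa>'_def field_simps)
    define p where "p = P (Suc (Suc nc))"
    have p: "0 < p" using P_pos by (simp add: p_def)
    define J7 where "J7 = h (k + 5) * J5"
    have J7: "0 < J7" "J7 \<le> (1 - \<rho>) * J5" "J7 < J5"
      using h_pos[of "k + 5"] h_less[of "k + 5"] \<rho>(2)[of "k + 5"] Jw by (auto simp: J7_def)
    have Fc: "F nc 0 = J5" "F nc (- p) = J7" "F nc (X nb) = J" "F nc s = I"
    proof -
      show "F nc s = I" by (simp add: nc_def nb_def F_pull[of na] hs I_def)
      show "F nc (X nb) = J" using P_powr_h[of "Suc k"] by (simp add: nn F_end L_period J_def w_def g_def)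
      show "F nc 0 = J5" using P4_powr_h[of "Suc k"] by (simp add: nn F_0 L_period J5_def J_def w_def g_def numeral_eq_Suc)
      have "P (Suc (Suc (Suc nc))) powr g = h (k + 5) * P (Suc nc) powr g"
        using P_powr_h[of "k + 5"] by (simp add: nn g_def L_period numeral_eq_Suc)
      moreover have "P (Suc nc) powr g = J5"
        using P4_powr_h[of "Suc k"] by (simp add: nn L_period J5_def J_def w_def g_def numeral_eq_Suc)
      ultimately show "F nc (- p) = J7" by (simp add: p_def F_P2 J7_def) (simp add: nn g_def L_period)
    qed
    have "s / p \<le> C * (1 / (h (k + 3) * \<rho> * \<kappa>'))"
    proof -
      have dc: "- p \<in> dom nc" "X nb \<in> dom nc" using inner_dom(1)[of nc] Suc_end_dom[of na] by (auto simp: nn p_def)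
      have "s / p = s / p * 1" by simp
      also have "\<dots> \<le> s / p * ((x + p) / (x - s))"
        using s p by (intro mult_left_mono) (auto simp: x_def)
      also have "\<dots> = xr (- p) 0 s (X nb)" by (simp add: xr_def x_def)
      also have "\<dots> \<le> exp (osc nc) * xr J7 J5 I J"
        using expand_osc[OF dc, of 0 s] p s by (simp add: Fc)
      also have "\<dots> \<le> C * xr J7 J5 I J"
        using oC[of nc] xr_pos[OF J7(3) I] by (intro mult_right_mono) auto
      also have "xr J7 J5 I J \<le> J * J / ((\<rho> * J5) * (\<kappa>' * J))"
        unfolding xr_def using I Jw J7 JI \<rho> \<kappa>' by (intro frac_le mult_mono) (auto simp: algebra_simps)
      also have "\<dots> = (J * J) * 1 / ((J * J) * (h (k + 3) * \<rho> * \<kappa>'))" by (simp add: J5_def)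
      also have "\<dots> = 1 / (h (k + 3) * \<rho> * \<kappa>')" using Jw by (subst mult_divide_mult_cancel_left) auto
      finally show ?thesis using C by (simp add: mult_left_mono)
    qed
    then have "s * (h (k + 3) * \<rho> * \<kappa>') \<le> C * p"
      using p h_pos[of "k + 3"] \<rho> \<kappa>' by (simp add: field_simps)
    moreover have "P (Suc nc) \<le> (1 + C) * s"
      using xs P_X[of nb] by (simp add: x_def algebra_simps nn)
    moreover define t where "t = h (k + 3) * \<rho> * \<kappa>'"
    moreover have t: "0 < t" using h_pos[of "k + 3"] \<rho> \<kappa>' by (simp add: t_def)
    ultimately have "P (Suc nc) * t \<le> (1 + C) * s * t" "(1 + C) * (s * t) \<le> (1 + C) * (C * p)"
      using C by (auto intro!: mult_right_mono mult_left_mono)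
    then have "P (Suc nc) * t \<le> (1 + C) * (C * p)" by (simp add: mult.assoc)
    then have "t * P (Suc nc) / ((1 + C) * C) \<le> p" using C by (simp add: pos_divide_le_eq mult.commute mult.left_commute)
    moreover have "c * h (k + 3) * P (Suc nc) = t * P (Suc nc) / ((1 + C) * C)"
      by (simp add: c_def t_def mult.commute mult.left_commute)
    ultimately have "c * h (k + 3) * P (Suc nc) \<le> p" by simp
    moreover have "e (k + 5) = p / P (Suc nc)" by (simp add: e_def p_def nn numeral_eq_Suc)
    ultimately show ?thesis using P_pos[of "Suc nc"] by (simp add: pos_le_divide_eq)
  qed
  then show ?thesis using c by blast
qed

text \<open>Taking logarithms in \<open>e_lower\<close> gives the recursion of
  \<open>exponents_bounded\<close> for \<open>- ln e\<close>.\<close>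

theorem u_bounded_below:
  assumes L: "1 / L 0 + 1 / L 1 < 1"
  shows "\<exists>c>0. \<forall>n. c \<le> u n"
proof -
  obtain c where c: "0 < c" "\<And>k. c * h (k + 3) \<le> e (k + 5)" using e_lower by blast
  define z where "z n = - ln (e (n + 3))" for n
  define g where "g n = 1 / L (Suc (n + 3))" for n
  have "\<exists>B. \<forall>n. z n \<le> B"
  proof (rule exponents_bounded[of g z "- ln c"])
    show "0 < g n" for n using L_ge1[of "Suc (n + 3)"] by (simp add: g_def)
    show "g (Suc (Suc n)) = g n" for n
      unfolding g_def using L_period[of "Suc (n + 3)"] by (simp add: numeral_eq_Suc)
    show "g 0 + g 1 < 1" using L L_sum[of 4] by (simp add: g_def numeral_eq_Suc)
    fix n
    have "ln (c * h (n + 3)) \<le> ln (e (n + 5))"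
      using c(2)[of n] c(1) h_pos[of "n + 3"] e_pos[of "n + 5"] by simp
    moreover have "ln (c * h (n + 3)) = ln c + g n * (ln (e (n + 3)) + ln (e (n + 4)))"
    proof -
      have "ln (c * h (n + 3)) = ln c + ln (h (n + 3))" using c(1) h_pos[of "n + 3"] by (simp add: ln_mult)
      also have "ln (h (n + 3)) = g n * ln (u (n + 3))" using u_pos[of "n + 3"] by (simp add: h_def ln_powr g_def)
      also have "ln (u (n + 3)) = ln (e (n + 3)) + ln (e (n + 4))"
        using e_pos[of "n + 3"] e_pos[of "n + 4"] by (simp add: u_e ln_mult numeral_eq_Suc)
      finally show ?thesis .
    qed
    ultimately show "z (Suc (Suc n)) \<le> g n * (z n + z (Suc n)) + - ln c"
      by (simp add: z_def algebra_simps numeral_eq_Suc)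
  qed
  then obtain B where B: "\<And>n. z n \<le> B" by blast
  have el: "exp (- B) \<le> e (n + 3)" for n
  proof -
    have "exp (- B) \<le> exp (ln (e (n + 3)))" using B[of n] by (simp add: z_def)
    then show ?thesis using e_pos[of "n + 3"] by simp
  qed
  have "exp (- B) * exp (- B) \<le> u (Suc (2 * n))" if "1 \<le> n" for n
  proof -
    have "Suc (2 * n) = (2 * n - 2) + 3" using that by linarith
    then obtain k where k: "Suc (2 * n) = k + 3" by blast
    have "exp (- B) \<le> e (Suc (k + 3))" using el[of "Suc k"] by simp
    then show ?thesis unfolding k u_e using el[of k] e_pos[of "k + 3"] by (intro mult_mono) auto
  qed
  then show ?thesis by (intro u_bounded_below_of_odd[of "exp (- B) * exp (- B)" 1]) auto
qed

text \<open>Cross ratio expansion for \<open>- P\<close>, \<open>- Y\<close>, \<open>0\<close>,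
  \<open>X\<close>. The image of the interval \<open>[- P, - Y]\<close> is not small because of
  \<open>X_excess\<close> one level above.\<close>

lemma Y_bounded_away:
  assumes c: "0 < c" "\<And>n. c \<le> u n"
  shows "\<exists>\<kappa>>0. \<forall>n. \<kappa> \<le> 1 - Y (n + 4) / P (n + 4)"
proof -
  obtain M where M: "\<And>n. osc n \<le> M" using osc_bounded by blast
  obtain \<rho> where \<rho>: "0 < \<rho>" "\<And>n. \<rho> \<le> 1 - h n" using h_bounded_away by blast
  obtain \<kappa> where \<kappa>: "0 < \<kappa>" "\<And>n. \<kappa> * P (n + 4) \<le> X (n + 2) - P (n + 4)" using X_excess[OF c] by blast
  define \<tau> where "\<tau> = (1 + \<kappa>) powr (1 / Lmax) - 1"
  have \<tau>: "0 < \<tau>" using \<kappa> Lmax_ge1 by (simp add: \<tau>_def gr_one_powr)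
  define A where "A = exp M * (1 / (\<tau> * c * \<rho>))"
  have A: "0 < A" using \<tau> c \<rho> by (simp add: A_def)
  have "1 / A * Y (m + 4) \<le> P (m + 4) - Y (m + 4)" for m
  proof -
    let ?n = "Suc (Suc m)"
    define g where "g = 1 / L ?n"
    have g: "0 < g" "1 / Lmax \<le> g" using L_ge1[of ?n] L_le[of ?n] by (auto simp: g_def field_simps)
    define w where "w = P (Suc m) powr g"
    have w: "0 < w" using P_pos[of "Suc m"] by (simp add: w_def)
    define J J3 x where "J = h (Suc m) * w" and "J3 = h (m + 3) * J" and "x = X (Suc ?n) powr g"
    have J: "0 < J" "J \<le> (1 - \<rho>) * w" "c * J \<le> J3" "0 < J3"
      using h_pos[of "Suc m"] \<rho>(2)[of "Suc m"] w h_pos[of "m + 3"] c(2)[of "m + 3"] u_le_h[of "m + 3"]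
      by (auto simp: J_def J3_def)
    have PJ3: "P (Suc (Suc (Suc ?n))) powr g = J3"
      using P4_powr_h[of "Suc m"] by (simp add: g_def w_def L_period J3_def J_def numeral_3_eq_3)
    have F: "F ?n 0 = J" "F ?n (- P (Suc (Suc ?n))) = J3" "F ?n (- Y (Suc (Suc ?n))) = x" "F ?n (X (Suc m)) = w"
      using P_powr_h[of "Suc m"] PJ3
      by (simp_all add: F_0 F_P2 F_Y2 F_end J_def w_def g_def L_period x_def)
    have "(1 + \<kappa>) * P (Suc (Suc (Suc ?n))) \<le> X (Suc ?n)"
      using \<kappa>(2)[of "Suc m"] by (simp add: algebra_simps numeral_eq_Suc)
    then have "((1 + \<kappa>) * P (Suc (Suc (Suc ?n)))) powr g \<le> x"
      unfolding x_def using \<kappa>(1) g P_pos[of "Suc (Suc (Suc ?n))"] by (intro powr_mono2) auto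
    then have "(1 + \<kappa>) powr g * J3 \<le> x" using \<kappa>(1) P_pos[of "Suc (Suc (Suc ?n))"] by (simp add: powr_mult PJ3)
    moreover have "(1 + \<tau>) * J3 \<le> (1 + \<kappa>) powr g * J3"
      unfolding \<tau>_def using \<kappa>(1) g J by (intro mult_right_mono) (auto intro: powr_mono)
    ultimately have "\<tau> * J3 \<le> x - J3" by (simp add: algebra_simps)
    moreover have "\<tau> * (c * J) \<le> \<tau> * J3" using J \<tau> by (intro mult_left_mono) auto
    ultimately have xJ: "\<tau> * c * J \<le> x - J3" by (simp add: mult.assoc)
    have "0 < \<tau> * c * J" using \<tau> c J by simp
    then have J3x: "J3 < x" using xJ by linarith
    define p y x1 where "p = P (m + 4)" and "y = Y (m + 4)" and "x1 = X (Suc m)"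
    have o: "0 < y" "y < p" "0 < x1" using ords by (simp_all add: p_def y_def x1_def)
    have d: "- P (Suc (Suc ?n)) \<in> dom ?n" "- Y (Suc (Suc ?n)) \<in> dom ?n" "X (Suc m) \<in> dom ?n"
      using inner_dom Suc_end_dom by auto
    have xJ': "x < J" using F_less[OF d(2) zero_dom] Y_pos[of "Suc (Suc ?n)"] by (simp add: F)
    have "y / (p - y) = y * x1 / ((p - y) * x1)" using o by simp
    also have "\<dots> \<le> y * (x1 + p) / ((p - y) * x1)" using o by (intro divide_right_mono mult_left_mono) auto
    also have "\<dots> = xr (- P (Suc (Suc ?n))) (- Y (Suc (Suc ?n))) 0 (X (Suc m))"
      by (simp add: xr_def p_def y_def x1_def numeral_eq_Suc)
    also have "\<dots> \<le> exp (osc ?n) * xr J3 x J w"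
      using expand_osc[OF d(1,3), of "- Y (Suc (Suc ?n))" 0] Y_P[of "Suc (Suc ?n)"] Y_pos X_pos by (simp add: F)
    also have "\<dots> \<le> exp M * (1 / (\<tau> * c * \<rho>))"
    proof (intro mult_mono)
      have "(1 - \<rho>) * w < w" using mult_pos_pos[OF \<rho>(1) w] by (simp add: left_diff_distrib)
      then have Jw: "J < w" using J(2) by linarith
      have "xr J3 x J w \<le> J * w / ((\<tau> * c * J) * (\<rho> * w))"
        unfolding xr_def using xJ xJ' J3x J w \<rho> \<tau> c Jw by (intro frac_le mult_mono) (auto simp: algebra_simps)
      also have "\<dots> = (J * w) * 1 / ((J * w) * (\<tau> * c * \<rho>))" by (simp add: mult.assoc mult.left_commute)
      also have "\<dots> = 1 / (\<tau> * c * \<rho>)" using J w by (subst mult_divide_mult_cancel_left) auto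
      finally show "xr J3 x J w \<le> 1 / (\<tau> * c * \<rho>)" .
      show "0 \<le> xr J3 x J w" using xr_pos[OF J3x xJ' Jw] by simp
    qed (use M in auto)
    finally have "y / (p - y) \<le> A" by (simp only: A_def)
    then have "y \<le> (p - y) * A" using o by (simp add: pos_divide_le_eq mult.commute)
    then have "y / A \<le> p - y" using A by (simp add: pos_divide_le_eq)
    then show ?thesis by (simp add: p_def y_def)
  qed
  then have "1 / A / (1 + 1 / A) \<le> 1 - Y (m + 4) / P (m + 4)" for m
  proof -
    define p y t where "p = P (m + 4)" and "y = Y (m + 4)" and "t = 1 / A"
    have "t * y \<le> p - y" using \<open>\<And>m. 1 / A * Y (m + 4) \<le> P (m + 4) - Y (m + 4)\<close>[of m] by (simp add: p_def y_def t_def)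
    then have "(1 + t) * y \<le> p" by (simp add: algebra_simps)
    moreover have "0 < p" "0 < t" using P_pos A by (simp_all add: p_def t_def)
    ultimately have "y / p \<le> 1 / (1 + t)" by (simp add: field_simps)
    also have "\<dots> = 1 - t / (1 + t)" using \<open>0 < t\<close> by (simp add: field_simps)
    finally show ?thesis by (simp add: p_def y_def t_def)
  qed
  moreover have "0 < 1 / A / (1 + 1 / A)" using A by (simp add: add_pos_pos)
  ultimately show ?thesis by blast
qed

end

section \<open>Renormalization of tuples\<close>

text \<open>The regularity that zooming and composition pass on without any discussion of
  derivatives. The smoothness of the original tuple enters through its own branches only, at the
  bottom of the tower.\<close>

definition homeo01 :: "(real \<Rightarrow> real) \<Rightarrow> bool" where
  "homeo01 f \<longleftrightarrow> f 0 = 0 \<and> f 1 = 1 \<and> strict_mono_on {0..1} f \<and> continuous_on {0..1} f"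

lemma homeo01_less: "homeo01 f \<Longrightarrow> 0 \<le> x \<Longrightarrow> x < y \<Longrightarrow> y \<le> 1 \<Longrightarrow> f x < f y"
  by (auto simp: homeo01_def strict_mono_on_def)

lemma homeo01_range: "homeo01 f \<Longrightarrow> 0 \<le> x \<Longrightarrow> x \<le> 1 \<Longrightarrow> 0 \<le> f x \<and> f x \<le> 1"
  using homeo01_less[of f 0 x] homeo01_less[of f x 1]
  by (cases "x = 0"; cases "x = 1") (auto simp: homeo01_def)

lemma homeo01_01: "homeo01 f \<Longrightarrow> f 0 = 0" "homeo01 f \<Longrightarrow> f 1 = 1"
  by (auto simp: homeo01_def)

lemma homeo01_inv:
  assumes "homeo01 f" "0 \<le> y" "y \<le> 1"
  shows "inv_into {0..1} f y \<in> {0..1}" "f (inv_into {0..1} f y) = y"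
proof -
  have "y \<in> f ` {0..1}"
    using IVT'[of f 0 y 1] assms by (auto simp: homeo01_def)
  then show "inv_into {0..1} f y \<in> {0..1}" "f (inv_into {0..1} f y) = y"
    by (rule inv_into_into, rule f_inv_into_f)
qed

lemma homeo01_inv_less:
  assumes f: "homeo01 f" and o: "0 \<le> x" "x < y" "y \<le> 1"
  shows "inv_into {0..1} f x < inv_into {0..1} f y"
proof (rule ccontr)
  let ?a = "inv_into {0..1} f x" and ?b = "inv_into {0..1} f y"
  assume "\<not> ?a < ?b"
  then have "?b < ?a \<or> ?b = ?a" by auto
  then have "f ?b \<le> f ?a"
    using homeo01_less[OF f, of ?b ?a] homeo01_inv(1)[OF f, of x] homeo01_inv(1)[OF f, of y] o by auto
  then show False using homeo01_inv(2)[OF f, of x] homeo01_inv(2)[OF f, of y] o by auto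
qed

lemma homeo01_comp: "homeo01 f \<Longrightarrow> homeo01 g \<Longrightarrow> homeo01 (f \<circ> g)"
proof -
  assume f: "homeo01 f" and g: "homeo01 g"
  have r: "g x \<in> {0..1}" if "x \<in> {0..1}" for x using homeo01_range[OF g] that by auto
  have "continuous_on {0..1} (\<lambda>x. f (g x))"
    by (rule continuous_on_compose2[of "{0..1}"]) (use f g r in \<open>auto simp: homeo01_def\<close>)
  then show ?thesis using f g r
    unfolding homeo01_def strict_mono_on_def by (auto simp: o_def)
qed

lemma homeo01_Diff2: "\<phi> \<in> Diff2 \<Longrightarrow> homeo01 \<phi>"
proof -
  assume d: "\<phi> \<in> Diff2"
  then have "\<phi> differentiable_on {0..1}" by (simp add: Diff2_def C2_01_def)
  then show ?thesis using Diff2_props[OF d] d differentiable_imp_continuous_on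
    by (auto simp: homeo01_def Diff2_def)
qed

lemma homeo01_qmap:
  assumes "0 < s" "s < 1" "1 \<le> b"
  shows "homeo01 (qmap b s)"
proof -
  have sb: "s powr b < 1" using assms powr_less_mono2[of b s 1] by simp
  have "continuous_on {0..1} (qmap b s)"
    unfolding qmap_def using assms sb
    by (intro continuous_intros) (auto simp: add_nonneg_eq_0_iff)
  then show ?thesis using qmap_props[OF assms] by (auto simp: homeo01_def strict_mono_on_def)
qed

lemma homeo01_zoom:
  assumes f: "homeo01 f" and ab: "0 \<le> a" "a < b" "b \<le> 1"
  shows "homeo01 (zoom a b f)"
proof -
  have fab: "f a < f b" using homeo01_less[OF f] ab by auto
  have r: "(b - a) * x + a \<in> {0..1}" if "x \<in> {0..1}" for x
  proof -
    have "0 \<le> (b - a) * x" using that ab by simp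
    moreover have "(b - a) * x + a \<le> (b - a) * 1 + a" using that ab by (intro add_mono mult_left_mono) auto
    moreover have "(b - a) * 1 + a = b" by simp
    ultimately have "0 \<le> (b - a) * x + a" "(b - a) * x + a \<le> 1" using ab by linarith+
    then show ?thesis by simp
  qed
  have "continuous_on {0..1} (\<lambda>x. f ((b - a) * x + a))"
    by (rule continuous_on_compose2[of "{0..1}" f]) (use f r in \<open>auto simp: homeo01_def intro!: continuous_intros\<close>)
  then have c: "continuous_on {0..1} (zoom a b f)" unfolding zoom_def using fab by (intro continuous_intros) auto
  have "zoom a b f x < zoom a b f y" if "x \<in> {0..1}" "y \<in> {0..1}" "x < y" for x y
    unfolding zoom_def using fab r[OF that(1)] r[OF that(2)] ab that
    by (intro divide_strict_right_mono diff_strict_right_mono homeo01_less[OF f]) auto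
  then show ?thesis using c fab unfolding homeo01_def strict_mono_on_def by (auto simp: zoom_def)
qed

lemma homeo01_reflect: "homeo01 f \<Longrightarrow> homeo01 (\<lambda>x. 1 - f (1 - x))"
proof -
  assume f: "homeo01 f"
  have "continuous_on {0..1} (\<lambda>x. f (1 - x))"
    by (rule continuous_on_compose2[of "{0..1}" f]) (use f in \<open>auto simp: homeo01_def intro!: continuous_intros\<close>)
  then have "continuous_on {0..1} (\<lambda>x. 1 - f (1 - x))" by (intro continuous_intros)
  moreover have "strict_mono_on {0..1} (\<lambda>x. 1 - f (1 - x))"
    unfolding strict_mono_on_def using homeo01_less[OF f] by auto
  ultimately show ?thesis using homeo01_01[OF f] by (simp add: homeo01_def)
qed

text \<open>The topological part of being a renormalizable element of \<open>LL\<close>. It says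
  nothing about \<open>x\<^sub>1\<close>, on which the other components of the renormalization do
  not depend.\<close>

definition flat_tuple :: "flat_map \<Rightarrow> bool" where
  "flat_tuple f \<longleftrightarrow> 0 < x3_of f \<and> x3_of f < x4_of f \<and> x4_of f < 1
     \<and> 0 < x2_of f \<and> x2_of f < x3_of f \<and> 0 < s_of f \<and> s_of f < 1
     \<and> homeo01 (phi_of f) \<and> homeo01 (phil_of f) \<and> homeo01 (phir_of f)"

definition gmap :: "real \<Rightarrow> flat_map \<Rightarrow> real \<Rightarrow> real" where
  "gmap b f = qmap b (s_of f) \<circ> phi_of f"

lemma homeo01_gmap: "flat_tuple f \<Longrightarrow> 1 \<le> b \<Longrightarrow> homeo01 (gmap b f)"
  unfolding gmap_def flat_tuple_def by (intro homeo01_comp homeo01_qmap) auto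

text \<open>The inverse functions in the definition of the renormalization are eliminated: the new
  points \<open>x\<^sub>3\<close>, \<open>x\<^sub>4\<close> are described by the values of
  \<open>gmap\<close>.\<close>

lemma renorm_fields:
  assumes f: "flat_tuple f" and ab: "1 \<le> a" "1 \<le> b"
  defines "t \<equiv> (x3_of f - x2_of f) / x3_of f" and "r \<equiv> renorm a b f" and "g \<equiv> gmap b f"
  shows "x2_of r = phil_of f t powr a" "s_of r = phil_of f t" "phi_of r = zoom t 1 (phil_of f)"
    "phil_of r = phir_of f \<circ> zoom (1 - x3_of r) 1 g"
    "phir_of r = (\<lambda>x. zoom 0 t (phil_of f) (1 - zoom 0 (1 - x4_of r) g (1 - x)))"
    "g (1 - x3_of r) = (x4_of f - x2_of f) / (1 - x2_of f)"
    "g (1 - x4_of r) = (x3_of f - x2_of f) / (1 - x2_of f)"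
    "0 < x3_of r" "x3_of r < x4_of r" "x4_of r < 1"
    "0 < t" "t < 1" "0 < phil_of f t" "phil_of f t < 1"
proof -
  have o: "0 < x2_of f" "x2_of f < x3_of f" "x3_of f < x4_of f" "x4_of f < 1"
    using f by (auto simp: flat_tuple_def)
  have g: "homeo01 g" unfolding g_def using f ab by (intro homeo01_gmap)
  define v3 where "v3 = (x4_of f - x2_of f) / (1 - x2_of f)"
  define v4 where "v4 = (x3_of f - x2_of f) / (1 - x2_of f)"
  have v: "0 < v4" "v4 < v3" "v3 < 1" using o by (auto simp: v3_def v4_def divide_strict_right_mono)
  have r: "x3_of r = 1 - inv_into {0..1} g v3" "x4_of r = 1 - inv_into {0..1} g v4"
    by (simp_all add: r_def renorm_def Let_def g_def gmap_def v3_def v4_def)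
  show "x2_of r = phil_of f t powr a" "s_of r = phil_of f t" "phi_of r = zoom t 1 (phil_of f)"
    by (simp_all add: r_def renorm_def Let_def t_def)
  show "phil_of r = phir_of f \<circ> zoom (1 - x3_of r) 1 g"
    "phir_of r = (\<lambda>x. zoom 0 t (phil_of f) (1 - zoom 0 (1 - x4_of r) g (1 - x)))"
    by (simp_all add: r_def renorm_def Let_def t_def g_def gmap_def)
  show g3: "g (1 - x3_of r) = (x4_of f - x2_of f) / (1 - x2_of f)"
    unfolding r using homeo01_inv(2)[OF g, of v3] v by (simp add: v3_def)
  show g4: "g (1 - x4_of r) = (x3_of f - x2_of f) / (1 - x2_of f)"
    unfolding r using homeo01_inv(2)[OF g, of v4] v by (simp add: v4_def)
  have i: "inv_into {0..1} g v3 \<noteq> 1" "inv_into {0..1} g v4 \<noteq> 0"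
    using homeo01_inv(2)[OF g, of v3] homeo01_inv(2)[OF g, of v4] homeo01_01[OF g] v by auto
  show "0 < x3_of r" "x4_of r < 1" unfolding r
    using i homeo01_inv(1)[OF g, of v3] homeo01_inv(1)[OF g, of v4] v by auto
  show "x3_of r < x4_of r" unfolding r using homeo01_inv_less[OF g, of v4 v3] v by auto
  show t: "0 < t" "t < 1" using o by (auto simp: t_def)
  have l: "homeo01 (phil_of f)" using f by (simp add: flat_tuple_def)
  show "0 < phil_of f t" "phil_of f t < 1"
    using homeo01_less[OF l, of 0 t] homeo01_less[OF l, of t 1] homeo01_01[OF l] t by auto
qed

lemma flat_tuple_renorm:
  assumes f: "flat_tuple f" and ab: "1 \<le> a" "1 \<le> b" and R: "renormalizable (renorm a b f)"
  shows "flat_tuple (renorm a b f)"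
proof -
  note r = renorm_fields[OF f ab]
  have h: "homeo01 (phil_of f)" "homeo01 (phir_of f)" "homeo01 (gmap b f)"
    using f ab homeo01_gmap by (auto simp: flat_tuple_def)
  have 1: "homeo01 (phi_of (renorm a b f))" unfolding r(3) using h r(11,12) by (intro homeo01_zoom) auto
  have 2: "homeo01 (phil_of (renorm a b f))" unfolding r(4) using h r(8,9,10)
    by (intro homeo01_comp homeo01_zoom) auto
  have "homeo01 (zoom 0 (1 - x4_of (renorm a b f)) (gmap b f))" using h r(8,9,10) by (intro homeo01_zoom) auto
  from homeo01_comp[OF homeo01_zoom[OF h(1), of 0] homeo01_reflect[OF this]]
  have 3: "homeo01 (phir_of (renorm a b f))" unfolding r(5) using r(11,12) by (auto simp: o_def)
  show ?thesis unfolding flat_tuple_def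
    using 1 2 3 r(8-10,13,14) R by (auto simp: renormalizable_def r(2))
qed

lemma lev_ge1: "1 \<le> l1 \<Longrightarrow> 1 \<le> l2 \<Longrightarrow> 1 \<le> lev l1 l2 n"
  by (simp add: lev_def)

lemma lev_Suc_Suc: "lev l1 l2 (Suc (Suc n)) = lev l1 l2 n"
  by (simp add: lev_def)

lemma flat_tuple_iter:
  assumes l: "1 \<le> l1" "1 \<le> l2" and f: "f \<in> Fibonacci_maps l1 l2"
  shows "flat_tuple (renorm_iter l1 l2 n f)"
proof (induction n)
  case 0
  have "renormalizable (renorm_iter l1 l2 0 f)" using f unfolding Fibonacci_maps_def by blast
  then show ?case using f homeo01_Diff2 by (auto simp: Fibonacci_maps_def LL_def flat_tuple_def renormalizable_def)
next
  case (Suc n)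
  have "renormalizable (renorm_iter l1 l2 (Suc n) f)" using f unfolding Fibonacci_maps_def by blast
  then show ?case using Suc lev_ge1[OF l] by (auto intro: flat_tuple_renorm)
qed

section \<open>The first two branches of the tower\<close>

lemma loglip_compose_affine:
  assumes "loglip K f f' a b" "0 < m"
  shows "\<exists>N. loglip N (\<lambda>x. m * f x + k) (\<lambda>x. m * f' x) a b"
proof -
  have c: "continuous_on {a..b} f" using assms(1) by (rule loglip_continuous)
  have "bounded (f ` {a..b})" by (intro compact_imp_bounded compact_continuous_image c) auto
  then obtain B where B: "\<And>x. x \<in> {a..b} \<Longrightarrow> norm (f x) \<le> B" unfolding bounded_iff by blast
  show ?thesis
    by (rule loglip_compose[OF assms(1) loglip_affine[OF assms(2)], of "- B" B])
      (use B in \<open>force simp: abs_le_iff\<close>)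
qed

lemma loglip_rescale:
  assumes "loglip K f f' 0 1" "0 < c" "0 \<le> v" "v \<le> c"
  shows "\<exists>N. loglip N (\<lambda>y. f (1 + y / c)) (\<lambda>y. f' (1 + y / c) * (1 / c)) (- v) 0"
proof -
  have "\<exists>N. loglip N (\<lambda>y. f (1 / c * y + 1)) (\<lambda>y. f' (1 / c * y + 1) * (1 / c)) (- v) 0"
    by (rule loglip_compose[OF loglip_affine assms(1)]) (use assms in \<open>auto simp: field_simps\<close>)
  then show ?thesis by (simp add: add.commute)
qed

text \<open>The branches of the given map have to be extended so that they start a tower whose
  first return branches are exactly the components of the tuple. \<open>F0\<close> comes from the
  branch over \<open>[x\<^sub>1, 0)\<close>, and is continued affinely to the left until it
  vanishes, at \<open>- X0\<close>. \<open>F1\<close> comes from the branch over \<open>[0,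
  x\<^sub>3]\<close> on the left of \<open>0\<close>. On the right of \<open>0\<close> it is
  determined by the requirement that \<open>F0 (- (F1 (- y) powr a))\<close> be the branch over
  \<open>[x\<^sub>4, 1]\<close>, and beyond that it is continued affinely up to \<open>\<kappa> *
  x\<^sub>4\<close> of the first renormalization. The length \<open>\<kappa>\<close> on the left
  of the critical value is a free parameter, because \<open>x\<^sub>1\<close> does not influence
  the other ratios; it is used to make \<open>F1\<close> differentiable at
  \<open>0\<close>.\<close>

lemma base_branches:
  assumes f: "f \<in> LL" and R: "renormalizable f" and ab: "1 \<le> a" "1 \<le> b"
  defines "y3 \<equiv> x3_of (renorm a b f)" and "y4 \<equiv> x4_of (renorm a b f)"
    and "x2 \<equiv> x2_of f" and "x3 \<equiv> x3_of f" and "x4 \<equiv> x4_of f"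
  defines "G \<equiv> \<lambda>z. (1 - x2) * gmap b f z + x2"
  shows "\<exists>\<kappa> X0 Y0 F0 F1 f0 f1 K0 K1. 0 < \<kappa> \<and> \<kappa> < X0 \<and> X0 < Y0
    \<and> loglip K0 F0 f0 (- X0) 0 \<and> loglip K1 F1 f1 (- x3) (\<kappa> * y4)
    \<and> F0 (- X0) = 0 \<and> (\<forall>y\<in>{- \<kappa>..0}. F0 y = G (1 + y / \<kappa>) powr (1 / b))
    \<and> (\<forall>y\<in>{- x3..0}. F1 y = \<kappa> powr (1 / a) * phil_of f (1 + y / x3))
    \<and> F1 (\<kappa> * y3) = X0 powr (1 / a) \<and> F1 (\<kappa> * y4) = Y0 powr (1 / a)
    \<and> (\<forall>y\<in>{- (\<kappa> * y3)..0}. F0 (- (F1 (- y) powr a)) =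
         x2 powr (1 / b) * phir_of f ((G (1 + y / \<kappa>) - x4) / (1 - x4)))"
proof -
  have ft: "flat_tuple f" using f R homeo01_Diff2 by (auto simp: LL_def flat_tuple_def renormalizable_def)
  note rf = renorm_fields[OF ft ab, folded y3_def y4_def x2_def x3_def x4_def]
  have o: "0 < x2" "x2 < x3" "x3 < x4" "x4 < 1" "0 < y3" "y3 < y4" "y4 < 1" "0 < s_of f" "s_of f < 1"
    using ft rf by (auto simp: flat_tuple_def x2_def x3_def x4_def)
  have hom: "homeo01 (phi_of f)" "homeo01 (phil_of f)" "homeo01 (phir_of f)" using ft by (auto simp: flat_tuple_def)
  have hg: "homeo01 (gmap b f)" using ft ab by (intro homeo01_gmap)
  obtain Kp where Kp: "loglip Kp (phi_of f) (D01 (phi_of f)) 0 1" using loglip_Diff2 f by (auto simp: LL_def)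
  obtain Kl where Kl: "loglip Kl (phil_of f) (D01 (phil_of f)) 0 1" using loglip_Diff2 f by (auto simp: LL_def)
  obtain Kr where Kr: "loglip Kr (phir_of f) (D01 (phir_of f)) 0 1" using loglip_Diff2 f by (auto simp: LL_def)
  define pl where "pl = D01 (phil_of f)"
  define pr where "pr = D01 (phir_of f)"
  define s where "s = s_of f"
  have s: "0 < s" "s < 1" "s powr b < 1" using o ab powr_less_mono2[of b s 1] by (auto simp: s_def)
  obtain KG G' where KG: "loglip KG G G' 0 1"
  proof -
    obtain N1 where N1: "loglip N1 (\<lambda>x. (1 - s) * phi_of f x + s) (\<lambda>x. (1 - s) * D01 (phi_of f) x) 0 1"
      using loglip_compose_affine[OF Kp, of "1 - s" s] s by auto
    have "(1 - s) * phi_of f x + s \<in> {s..1}" if "x \<in> {0..1}" for x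
    proof -
      have "0 \<le> phi_of f x" "phi_of f x \<le> 1" using homeo01_range[OF hom(1)] that by auto
      then have "0 \<le> (1 - s) * phi_of f x" "(1 - s) * phi_of f x \<le> (1 - s) * 1"
        using s by (auto intro: mult_left_mono simp del: mult_1_right)
      then show ?thesis by auto
    qed
    from loglip_compose[OF N1 loglip_powr[OF s(1), of b] this] ab
    obtain N2 d where N2: "loglip N2 (\<lambda>x. ((1 - s) * phi_of f x + s) powr b) d 0 1" by auto
    define c where "c = (1 - x2) / (1 - s powr b)"
    have c: "0 < c" using o s by (simp add: c_def)
    have "G = (\<lambda>x. c * ((1 - s) * phi_of f x + s) powr b + (x2 - c * s powr b))"
      by (rule ext) (simp add: G_def gmap_def qmap_def c_def s_def[symmetric] algebra_simps diff_divide_distrib)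
    then show ?thesis using loglip_compose_affine[OF N2 c] that by auto
  qed
  have Gv: "G 0 = x2" "G 1 = 1" using homeo01_01[OF hg] by (simp_all add: G_def)
  have Gy: "G (1 - y3) = x4" "G (1 - y4) = x3"
    using rf(6,7) o by (simp_all add: G_def)
  have Gr: "x2 \<le> G z \<and> G z \<le> 1" if "0 \<le> z" "z \<le> 1" for z
    using loglip_strict_mono[OF KG, of 0 z] loglip_strict_mono[OF KG, of z 1] that Gv
    by (cases "z = 0"; cases "z = 1") auto
  have G'p: "0 < G' z" if "0 \<le> z" "z \<le> 1" for z using KG that by (auto simp: loglip_def)
  have plp: "0 < pl 1" and prp: "0 < pr 1" using Kl Kr by (auto simp: loglip_def pl_def pr_def)
  define \<beta> where "\<beta> = 1 / b"
  define \<alpha> where "\<alpha> = 1 / a"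
  have ex: "0 < \<alpha>" "0 < \<beta>" "(x powr \<alpha>) powr a = x" "(x powr \<beta>) powr b = x" if "0 \<le> x" for x
    using ab that by (auto simp: \<alpha>_def \<beta>_def powr_powr)
  have ab0: "0 < \<alpha>" "0 < \<beta>" using ab by (auto simp: \<alpha>_def \<beta>_def)
  \<comment> \<open>The left scale \<open>\<kappa>\<close> makes the two one-sided derivatives of
    \<open>F1\<close> at \<open>0\<close> agree; \<open>\<mu>\<close> is the derivative at
    \<open>0\<close> of the right-hand part before the root is taken.\<close>
  define \<mu> where "\<mu> = (x2 powr \<beta> * (pr 1 * (1 / (1 - x4) * G' 1))) / (\<beta> * x2 powr (\<beta> - 1) * G' 0)"
  have \<mu>: "0 < \<mu>" using o prp G'p ab0 by (simp add: \<mu>_def)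
  define \<kappa> where "\<kappa> = \<alpha> * \<mu> * x3 / pl 1"
  have \<kappa>: "0 < \<kappa>" using o plp \<mu> ab0 by (simp add: \<kappa>_def)
  obtain NA where NA: "loglip NA (\<lambda>y. G (1 + y / \<kappa>)) (\<lambda>y. G' (1 + y / \<kappa>) * (1 / \<kappa>)) (- \<kappa>) 0"
    using loglip_rescale[OF KG \<kappa>, of \<kappa>] \<kappa> by auto
  have rng: "0 \<le> 1 + y / \<kappa> \<and> 1 + y / \<kappa> \<le> 1" if "y \<in> {- \<kappa>..0}" for y
    using that \<kappa> by (auto simp: field_simps)
  have "G (1 + y / \<kappa>) \<in> {x2..1}" if "y \<in> {- \<kappa>..0}" for y using Gr rng[OF that] by auto
  from loglip_compose[OF NA loglip_powr[OF o(1) ab0(2)] this]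
  obtain NB where NB: "loglip NB (\<lambda>y. G (1 + y / \<kappa>) powr \<beta>)
      (\<lambda>y. \<beta> * G (1 + y / \<kappa>) powr (\<beta> - 1) * (G' (1 + y / \<kappa>) * (1 / \<kappa>))) (- \<kappa>) 0" by blast
  define m0 where "m0 = \<beta> * x2 powr (\<beta> - 1) * (G' 0 * (1 / \<kappa>))"
  have m0: "0 < m0" using o G'p[of 0] \<kappa> ab0 by (simp add: m0_def)
  define X0 where "X0 = \<kappa> + x2 powr \<beta> / m0"
  have X0: "\<kappa> < X0" using m0 o by (simp add: X0_def)
  define F0 where "F0 y = (if y \<le> - \<kappa> then m0 * y + (x2 powr \<beta> + m0 * \<kappa>) else G (1 + y / \<kappa>) powr \<beta>)" for y
  have "loglip (0 + NB) F0 (\<lambda>y. if y \<le> - \<kappa> then m0 else \<beta> * G (1 + y / \<kappa>) powr (\<beta> - 1) * (G' (1 + y / \<kappa>) * (1 / \<kappa>))) (- X0) 0"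
    unfolding F0_def by (rule loglip_glue[OF loglip_affine[OF m0] NB]) (use \<kappa> X0 Gv in \<open>auto simp: m0_def\<close>)
  then obtain K0 f0 where K0: "loglip K0 F0 f0 (- X0) 0" by blast
  have F0G: "F0 y = G (1 + y / \<kappa>) powr \<beta>" if "y \<in> {- \<kappa>..0}" for y
    using that \<kappa> by (auto simp: F0_def Gv)
  have F0X: "F0 (- X0) = 0" using X0 m0 by (simp add: F0_def) (simp add: X0_def field_simps)
  define X2 where "X2 = \<kappa> * y3"
  have X2: "0 < X2" "X2 < \<kappa>" using \<kappa> o by (auto simp: X2_def)
  define H where "H y = x2 powr \<beta> * phir_of f ((G (1 + y / \<kappa>) - x4) / (1 - x4))" for y
  define H' where "H' y = x2 powr \<beta> * (pr ((G (1 + y / \<kappa>) - x4) / (1 - x4)) * (1 / (1 - x4) * (G' (1 + y / \<kappa>) * (1 / \<kappa>))))" for y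
  have Gx4: "x4 \<le> G (1 + y / \<kappa>) \<and> G (1 + y / \<kappa>) \<le> 1" if "y \<in> {- X2..0}" for y
  proof -
    have z: "1 - y3 \<le> 1 + y / \<kappa>" "1 + y / \<kappa> \<le> 1" using that \<kappa> by (auto simp: X2_def field_simps)
    then show ?thesis using loglip_strict_mono[OF KG, of "1 - y3" "1 + y / \<kappa>"] Gy Gr[of "1 + y / \<kappa>"] o
      by (cases "1 - y3 = 1 + y / \<kappa>") auto
  qed
  obtain NH where NH: "loglip NH H H' (- X2) 0"
  proof -
    have N1: "loglip NA (\<lambda>y. G (1 + y / \<kappa>)) (\<lambda>y. G' (1 + y / \<kappa>) * (1 / \<kappa>)) (- X2) 0"
      by (rule loglip_subset[OF NA]) (use X2 in auto)
    obtain N2 where N2: "loglip N2 (\<lambda>y. 1 / (1 - x4) * G (1 + y / \<kappa>) + - x4 / (1 - x4))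
        (\<lambda>y. 1 / (1 - x4) * (G' (1 + y / \<kappa>) * (1 / \<kappa>))) (- X2) 0"
      using loglip_compose_affine[OF N1, of "1 / (1 - x4)" "- x4 / (1 - x4)"] o by auto
    have eq: "1 / (1 - x4) * v + - x4 / (1 - x4) = (v - x4) / (1 - x4)" for v
      by (simp add: diff_divide_distrib)
    have im: "(G (1 + y / \<kappa>) - x4) / (1 - x4) \<in> {0..1}" if "y \<in> {- X2..0}" for y
      using Gx4[OF that] o by auto
    obtain N3 where N3: "loglip N3 (\<lambda>y. phir_of f ((G (1 + y / \<kappa>) - x4) / (1 - x4)))
        (\<lambda>y. pr ((G (1 + y / \<kappa>) - x4) / (1 - x4)) * (1 / (1 - x4) * (G' (1 + y / \<kappa>) * (1 / \<kappa>)))) (- X2) 0"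
      using loglip_compose[OF N2[unfolded eq] Kr im] unfolding pr_def by blast
    have "0 < x2 powr \<beta>" using o by simp
    from loglip_compose_affine[OF N3 this, of 0] show ?thesis
      using that unfolding H_def H'_def by (auto simp: fun_eq_iff)
  qed
  have H0: "H 0 = x2 powr \<beta>" using homeo01_01[OF hom(3)] o by (simp add: H_def Gv)
  have HX: "H (- X2) = 0" using homeo01_01[OF hom(3)] o \<kappa> by (simp add: H_def X2_def Gy)
  have Hle: "H y \<le> x2 powr \<beta>" "0 \<le> H y" if "y \<in> {- X2..0}" for y
  proof -
    have "0 \<le> phir_of f ((G (1 + y / \<kappa>) - x4) / (1 - x4))" "phir_of f ((G (1 + y / \<kappa>) - x4) / (1 - x4)) \<le> 1"
      using homeo01_range[OF hom(3), of "(G (1 + y / \<kappa>) - x4) / (1 - x4)"] Gx4[OF that] o by auto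
    then show "H y \<le> x2 powr \<beta>" "0 \<le> H y" using o by (auto simp: H_def intro: mult_left_le)
  qed
  \<comment> \<open>\<open>F0\<close> is affine beyond \<open>- \<kappa>\<close>, so the
    requirement on \<open>F1\<close> can be solved explicitly: \<open>- Q x\<close> is the point
    that \<open>F0\<close> maps to \<open>H (- x)\<close>.\<close>
  define Q where "Q x = \<kappa> + (x2 powr \<beta> - H (- x)) / m0" for x
  have Q\<kappa>: "\<kappa> \<le> Q x" if "x \<in> {0..X2}" for x using Hle[of "- x"] that m0 by (simp add: Q_def)
  have QX0: "Q x \<le> X0" if "x \<in> {0..X2}" for x
    using Hle[of "- x"] that m0 by (simp add: Q_def X0_def divide_right_mono)
  obtain NR where NR: "loglip NR (\<lambda>x. Q x powr \<alpha>) (\<lambda>x. \<alpha> * Q x powr (\<alpha> - 1) * (1 / m0 * H' (- x))) 0 X2"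
  proof -
    have "loglip NH (\<lambda>x. - H (- x)) (\<lambda>x. H' (- x)) 0 X2" using loglip_minus[OF NH] by simp
    from loglip_compose_affine[OF this, of "1 / m0" "\<kappa> + x2 powr \<beta> / m0"] m0
    obtain N where N: "loglip N (\<lambda>x. 1 / m0 * - H (- x) + (\<kappa> + x2 powr \<beta> / m0)) (\<lambda>x. 1 / m0 * H' (- x)) 0 X2" by auto
    have Qeq: "(\<lambda>x. 1 / m0 * - H (- x) + (\<kappa> + x2 powr \<beta> / m0)) = Q"
      by (rule ext) (simp add: Q_def diff_divide_distrib)
    have "Q x \<in> {\<kappa>..X0}" if "x \<in> {0..X2}" for x using Q\<kappa>[OF that] QX0[OF that] by auto
    from loglip_compose[OF N[unfolded Qeq] loglip_powr[OF \<kappa> ab0(1)] this] show ?thesis using that by blast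
  qed
  obtain NL where NL: "loglip NL (\<lambda>y. \<kappa> powr \<alpha> * phil_of f (1 + y / x3)) (\<lambda>y. \<kappa> powr \<alpha> * (pl (1 + y / x3) * (1 / x3))) (- x3) 0"
  proof -
    have x3: "0 < x3" using o by simp
    obtain N where N: "loglip N (\<lambda>y. phil_of f (1 + y / x3)) (\<lambda>y. pl (1 + y / x3) * (1 / x3)) (- x3) 0"
      using loglip_rescale[OF Kl x3, of x3] x3 unfolding pl_def by auto
    have "0 < \<kappa> powr \<alpha>" using \<kappa> by simp
    from loglip_compose_affine[OF N this, of 0] show ?thesis using that by auto
  qed
  have match: "\<kappa> powr \<alpha> * (pl 1 * (1 / x3)) = \<alpha> * \<kappa> powr (\<alpha> - 1) * (1 / m0 * H' 0)"
  proof -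
    have H'0: "H' 0 = x2 powr \<beta> * (pr 1 * (1 / (1 - x4) * (G' 1 * (1 / \<kappa>))))" using o by (simp add: H'_def Gv)
    have "1 / m0 * H' 0 = \<mu>"
    proof -
      define A where "A = x2 powr \<beta> * (pr 1 * (1 / (1 - x4) * G' 1))"
      define B where "B = \<beta> * x2 powr (\<beta> - 1) * G' 0"
      have "H' 0 = A * (1 / \<kappa>)" "m0 = B * (1 / \<kappa>)" "\<mu> = A / B"
        by (simp_all add: H'0 m0_def \<mu>_def A_def B_def)
      then show ?thesis using \<kappa> by simp
    qed
    moreover have "pl 1 * (1 / x3) = \<alpha> * \<mu> / \<kappa>" using plp o \<mu> ab0 by (simp add: \<kappa>_def)
    moreover have "\<kappa> powr (\<alpha> - 1) = \<kappa> powr \<alpha> / \<kappa>" using \<kappa> by (simp add: powr_diff)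
    ultimately show ?thesis by simp
  qed
  have Q0: "Q 0 = \<kappa>" by (simp add: Q_def H0)
  have QX2: "Q X2 = X0" by (simp add: Q_def HX X0_def)
  define F1a where "F1a y = (if y \<le> 0 then \<kappa> powr \<alpha> * phil_of f (1 + y / x3) else Q y powr \<alpha>)" for y
  define f1a where "f1a y = (if y \<le> 0 then \<kappa> powr \<alpha> * (pl (1 + y / x3) * (1 / x3)) else \<alpha> * Q y powr (\<alpha> - 1) * (1 / m0 * H' (- y)))" for y
  have N1a: "loglip (NL + NR) F1a f1a (- x3) X2"
    unfolding F1a_def f1a_def
    by (rule loglip_glue[OF NL NR]) (use o X2 match homeo01_01[OF hom(2)] Q0 in auto)
  define m1 where "m1 = f1a X2"
  have m1: "0 < m1" using N1a X2 o by (auto simp: m1_def loglip_def)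
  define F1 where "F1 y = (if y \<le> X2 then F1a y else m1 * y + (X0 powr \<alpha> - m1 * X2))" for y
  have X2le: "X2 \<le> \<kappa> * y4" using o \<kappa> by (simp add: X2_def)
  have F1aX2: "F1a X2 = X0 powr \<alpha>" using X2 by (simp add: F1a_def QX2)
  have "loglip ((NL + NR) + 0) F1 (\<lambda>y. if y \<le> X2 then f1a y else m1) (- x3) (\<kappa> * y4)"
    unfolding F1_def by (rule loglip_glue[OF N1a loglip_affine[OF m1]])
      (use o X2 X2le F1aX2 in \<open>auto simp: m1_def\<close>)
  then obtain K1 f1 where K1: "loglip K1 F1 f1 (- x3) (\<kappa> * y4)" by blast
  have F1l: "F1 y = \<kappa> powr \<alpha> * phil_of f (1 + y / x3)" if "y \<in> {- x3..0}" for y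
    using that X2 by (auto simp: F1_def F1a_def)
  have F1r: "F1 x = Q x powr \<alpha>" if "x \<in> {0..X2}" for x
    using that X2 homeo01_01[OF hom(2)] Q0 by (auto simp: F1_def F1a_def)
  define Y0 where "Y0 = F1 (\<kappa> * y4) powr a"
  have X2lt: "X2 < \<kappa> * y4" "- x3 \<le> X2" using o \<kappa> X2 by (auto simp: X2_def)
  have lt: "F1 X2 < F1 (\<kappa> * y4)" using loglip_strict_mono[OF K1, of X2 "\<kappa> * y4"] X2lt by auto
  have F1X2: "F1 X2 = X0 powr \<alpha>" using F1aX2 by (simp add: F1_def)
  have p: "0 \<le> X0 powr \<alpha>" by simp
  have Y0: "F1 (\<kappa> * y4) = Y0 powr \<alpha>" "X0 < Y0"
  proof -
    have pos: "0 < F1 (\<kappa> * y4)" using lt F1X2 p by linarith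
    show "F1 (\<kappa> * y4) = Y0 powr \<alpha>" using pos ab by (simp add: Y0_def \<alpha>_def powr_powr)
    have "(X0 powr \<alpha>) powr a < Y0" unfolding Y0_def using lt F1X2 p ab by (intro powr_less_mono2) auto
    then show "X0 < Y0" using ex(3)[of X0] X0 \<kappa> by simp
  qed
  have last: "F0 (- (F1 (- y) powr a)) = H y" if y: "y \<in> {- X2..0}" for y
  proof -
    have x: "- y \<in> {0..X2}" using y by auto
    have Qp: "\<kappa> \<le> Q (- y)" by (rule Q\<kappa>[OF x])
    then have "F1 (- y) powr a = Q (- y)" using F1r[OF x] ex(3)[of "Q (- y)"] \<kappa> by simp
    then have "F0 (- (F1 (- y) powr a)) = m0 * - Q (- y) + (x2 powr \<beta> + m0 * \<kappa>)" using Qp by (simp add: F0_def)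
    also have "\<dots> = H y" using m0 by (simp add: Q_def field_simps)
    finally show ?thesis .
  qed
  show ?thesis
  proof (intro exI conjI)
    show "loglip K0 F0 f0 (- X0) 0" by (rule K0)
    show "loglip K1 F1 f1 (- x3) (\<kappa> * y4)" by (rule K1)
    show "\<forall>y\<in>{- (\<kappa> * y3)..0}. F0 (- (F1 (- y) powr a)) = x2 powr (1 / b) * phir_of f ((G (1 + y / \<kappa>) - x4) / (1 - x4))"
      using last by (simp add: X2_def H_def \<beta>_def)
    show "F1 (\<kappa> * y3) = X0 powr (1 / a)" using F1X2 by (simp add: X2_def \<alpha>_def)
    show "F1 (\<kappa> * y4) = Y0 powr (1 / a)" using Y0 by (simp add: \<alpha>_def)
  qed (use \<kappa> X0 Y0 F0X F0G F1l in \<open>auto simp: \<alpha>_def \<beta>_def\<close>)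
qed

section \<open>Branches of the renormalizations\<close>

lemma gmap_value:
  assumes f: "flat_tuple f" and b: "1 \<le> b"
  defines "v \<equiv> \<lambda>z. (1 - x2_of f) * gmap b f z + x2_of f"
  shows "v 0 = x2_of f" "v 1 = 1" "\<And>y z. 0 \<le> y \<Longrightarrow> y \<le> z \<Longrightarrow> z \<le> 1 \<Longrightarrow> v y \<le> v z"
    "\<And>z. 0 \<le> z \<Longrightarrow> z \<le> 1 \<Longrightarrow> 0 < v z \<and> v z \<le> 1"
proof -
  have g: "homeo01 (gmap b f)" using f b by (rule homeo01_gmap)
  have o: "0 < x2_of f" "x2_of f < 1" using f by (auto simp: flat_tuple_def)
  show v: "v 0 = x2_of f" "v 1 = 1" using homeo01_01[OF g] by (simp_all add: v_def)
  show m: "v y \<le> v z" if "0 \<le> y" "y \<le> z" "z \<le> 1" for y z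
    using homeo01_less[OF g, of y z] that o by (cases "y = z") (auto simp: v_def)
  show "0 < v z \<and> v z \<le> 1" if "0 \<le> z" "z \<le> 1" for z
    using m[of 0 z] m[of z 1] that v o by auto
qed

text \<open>The tower and the renormalized tuples carry the same information: up to scale, the
  components \<open>\<phi>\<^sup>l\<close>, \<open>q\<^sub>s \<circ> \<phi>\<close>,
  \<open>\<phi>\<^sup>r\<close> of the tuple of level \<open>n\<close> are three consecutive
  functions of the tower. The three statements are proved together, as renormalization turns
  \<open>\<phi>\<^sup>l\<close> into \<open>\<phi>\<close>, \<open>\<phi>\<^sup>r\<close> into
  \<open>\<phi>\<^sup>l\<close>, and all three into \<open>\<phi>\<^sup>r\<close>.\<close>

lemma tower_relation:
  fixes P X :: "nat \<Rightarrow> real" and a :: "nat \<Rightarrow> real" and F :: "nat \<Rightarrow> real \<Rightarrow> real" and fn :: "nat \<Rightarrow> flat_map"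
  defines "val \<equiv> \<lambda>n z. (1 - x2_of (fn n)) * gmap (a (Suc n)) (fn n) z + x2_of (fn n)"
  assumes a: "\<And>n. 1 \<le> a n" "\<And>n. a (Suc (Suc n)) = a n"
    and fn: "\<And>n. flat_tuple (fn n)" "\<And>n. fn (Suc n) = renorm (a n) (a (Suc n)) (fn n)"
    and P: "\<And>n. 0 < P n" "\<And>n. P (Suc (Suc (Suc n))) = P (Suc n) * x2_of (fn n)"
    and X: "\<And>n. X (Suc n) = P (Suc n) * x3_of (fn n)"
    and F: "\<And>n x. F (Suc (Suc n)) x = F n (- (F (Suc n) (- x) powr a n))"
    and base: "\<And>y. y \<in> {- X (Suc 0)..0} \<Longrightarrow> F (Suc 0) y = P (Suc (Suc 0)) powr (1 / a 0) * phil_of (fn 0) (1 + y / X (Suc 0))"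
      "\<And>y. y \<in> {- P (Suc (Suc 0))..0} \<Longrightarrow> F 0 y = (P (Suc 0) * val 0 (1 + y / P (Suc (Suc 0)))) powr (1 / a (Suc 0))"
      "\<And>y. y \<in> {- X (Suc (Suc 0))..0} \<Longrightarrow> F (Suc (Suc 0)) y =
        P (Suc (Suc (Suc 0))) powr (1 / a (Suc 0)) * phir_of (fn 0) ((val 0 (1 + y / P (Suc (Suc 0))) - x4_of (fn 0)) / (1 - x4_of (fn 0)))"
  shows "(\<forall>y\<in>{- X (Suc n)..0}. F (Suc n) y = P (Suc (Suc n)) powr (1 / a n) * phil_of (fn n) (1 + y / X (Suc n))) \<and>
    (\<forall>y\<in>{- P (Suc (Suc n))..0}. F n y = (P (Suc n) * val n (1 + y / P (Suc (Suc n)))) powr (1 / a (Suc n))) \<and>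
    (\<forall>y\<in>{- X (Suc (Suc n))..0}. F (Suc (Suc n)) y =
        P (Suc (Suc (Suc n))) powr (1 / a (Suc n)) * phir_of (fn n) ((val n (1 + y / P (Suc (Suc n))) - x4_of (fn n)) / (1 - x4_of (fn n))))"
proof (induction n)
  case 0
  then show ?case using base by blast
next
  case (Suc n)
  define f r aa b where "f = fn n" and "r = fn (Suc n)" and "aa = a n" and "b = a (Suc n)"
  note fr = f_def r_def aa_def b_def
  have a2: "a (Suc (Suc n)) = aa" "a (Suc (Suc (Suc n))) = b" by (simp_all add: a fr)
  have ab: "1 \<le> aa" "1 \<le> b" using a by (auto simp: fr)
  have ft: "flat_tuple f" "flat_tuple r" using fn(1) by (simp_all add: fr)
  have rr: "renorm aa b f = r" by (simp add: fr fn(2))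
  define x2 x3 x4 y3 y4 t where "x2 = x2_of f" and "x3 = x3_of f" and "x4 = x4_of f"
    and "y3 = x3_of r" and "y4 = x4_of r" and "t = (x3 - x2) / x3"
  define g where "g = gmap b f"
  define l where "l = phil_of f"
  note RF = renorm_fields[OF ft(1) ab, unfolded rr, folded x2_def x3_def x4_def y3_def y4_def, folded t_def g_def l_def]
  have o: "0 < x2" "x2 < x3" "x3 < x4" "x4 < 1" using ft(1) by (auto simp: flat_tuple_def x2_def x3_def x4_def)
  have l: "homeo01 l" and g: "homeo01 g" using ft(1) ab homeo01_gmap by (auto simp: flat_tuple_def l_def g_def)
  define p1 p2 p3 where "p1 = P (Suc n)" and "p2 = P (Suc (Suc n))" and "p3 = P (Suc (Suc (Suc n)))"
  have p: "0 < p1" "0 < p2" "0 < p3" "p3 = p1 * x2" "X (Suc n) = p1 * x3" "X (Suc (Suc n)) = p2 * y3"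
    "P (Suc (Suc (Suc (Suc n)))) = p2 * x2_of r"
    using P(1)[of "Suc n"] P(1)[of "Suc (Suc n)"] P(1)[of "Suc (Suc (Suc n))"] P(2)[of n] P(2)[of "Suc n"] X[of n] X[of "Suc n"]
    by (simp_all add: p1_def p2_def p3_def x2_def x3_def y3_def fr)
  define x1' where "x1' = p1 * x3"
  have IH1: "F (Suc n) y = p2 powr (1 / aa) * l (1 + y / x1')" if "y \<in> {- x1'..0}" for y
    using Suc that by (simp add: p p2_def[symmetric] x1'_def l_def f_def[symmetric] aa_def[symmetric])
  have IH2: "F n y = (p1 * val n (1 + y / p2)) powr (1 / b)" if "y \<in> {- p2..0}" for y
    using Suc that by (simp add: p1_def[symmetric] p2_def[symmetric] b_def[symmetric])
  have IH3: "F (Suc (Suc n)) y = p3 powr (1 / b) * phir_of f ((val n (1 + y / p2) - x4) / (1 - x4))"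
    if "y \<in> {- (p2 * y3)..0}" for y
    using Suc that by (simp add: p p2_def[symmetric] p3_def[symmetric] b_def[symmetric] x4_def f_def[symmetric])
  have valn: "val n z = (1 - x2) * g z + x2" for z by (simp add: val_def x2_def g_def fr)
  have px: "p3 < x1'" "0 < x1'" using o p by (auto simp: x1'_def)
  have t: "0 < t" "t < 1" "1 - t = p3 / x1'" using o p by (auto simp: t_def x1'_def field_simps)
  have lt: "0 < l t" "l t < 1" using RF(13,14) by auto
  have sr: "s_of r = l t" "x2_of r = l t powr aa" "phi_of r = zoom t 1 l" using RF(1-3) by auto
  have lta: "l t powr aa < 1" using lt ab powr_less_mono2[of aa "l t" 1] by simp
  have valS: "val (Suc n) (1 + y / p3) = l (1 + y / x1') powr aa" if "y \<in> {- p3..0}" for y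
  proof -
    have "(1 - t) * (1 + y / p3) + t = 1 + (1 - t) * (y / p3)" by (simp add: algebra_simps)
    also have "(1 - t) * (y / p3) = y / x1'" unfolding t(3) using p(3) by simp
    finally have arg: "(1 - t) * (1 + y / p3) + t = 1 + y / x1'" .
    have z: "(1 - l t) * zoom t 1 l (1 + y / p3) + l t = l (1 + y / x1')"
      unfolding zoom_def arg using lt homeo01_01[OF l] by simp
    have "val (Suc n) (1 + y / p3) = (1 - l t powr aa) * (((1 - l t) * zoom t 1 l (1 + y / p3) + l t) powr aa - l t powr aa) / (1 - l t powr aa) + l t powr aa"
      by (simp add: val_def gmap_def qmap_def a2 r_def[symmetric] sr)
    then show ?thesis using lta by (simp add: z)
  qed
  have c2: "F (Suc n) y = (p2 * val (Suc n) (1 + y / p3)) powr (1 / aa)" if y: "y \<in> {- p3..0}" for y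
  proof -
    have y': "y \<in> {- x1'..0}" using y px by auto
    have "0 \<le> 1 + y / x1'" "1 + y / x1' \<le> 1" using y' px by (auto simp: field_simps)
    then have l0: "0 \<le> l (1 + y / x1')" using homeo01_range[OF l] by auto
    have "(p2 * val (Suc n) (1 + y / p3)) powr (1 / aa) = p2 powr (1 / aa) * (l (1 + y / x1') powr aa) powr (1 / aa)"
      unfolding valS[OF y] using p l0 by (simp add: powr_mult)
    also have "(l (1 + y / x1') powr aa) powr (1 / aa) = l (1 + y / x1')" using l0 ab by (simp add: powr_powr)
    finally show ?thesis using IH1[OF y'] by simp
  qed
  have y3: "0 < y3" "y3 < y4" "y4 < 1" using RF(8-10) by auto
  have c1: "F (Suc (Suc n)) y = p3 powr (1 / b) * phil_of r (1 + y / (p2 * y3))" if y: "y \<in> {- (p2 * y3)..0}" for y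
  proof -
    have arg: "(1 - (1 - y3)) * (1 + y / (p2 * y3)) + (1 - y3) = 1 + y / p2" using y3 p by (simp add: field_simps)
    have "zoom (1 - y3) 1 g (1 + y / (p2 * y3)) = (g (1 + y / p2) - (x4 - x2) / (1 - x2)) / (1 - (x4 - x2) / (1 - x2))"
      unfolding zoom_def arg using RF(6) homeo01_01[OF g] by simp
    also have "1 - (x4 - x2) / (1 - x2) = (1 - x4) / (1 - x2)" using o by (simp add: field_simps)
    also have "g (1 + y / p2) - (x4 - x2) / (1 - x2) = (val n (1 + y / p2) - x4) / (1 - x2)"
      using o by (simp add: valn field_simps)
    also have "(val n (1 + y / p2) - x4) / (1 - x2) / ((1 - x4) / (1 - x2)) = (val n (1 + y / p2) - x4) / (1 - x4)"
      using o by simp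
    finally show ?thesis using IH3[OF y] RF(4) by simp
  qed
  define r2 where "r2 = fn (Suc (Suc n))"
  define z3 where "z3 = x3_of r2"
  have rr2: "renorm b aa r = r2" unfolding r2_def r_def b_def aa_def using fn(2)[of "Suc n"] by (simp only: a(2))
  note RF2 = renorm_fields[OF ft(2) ab(2,1), unfolded rr2, folded z3_def]
  have gr: "gmap aa r (1 - z3) = (y4 - x2_of r) / (1 - x2_of r)" using RF2(6) by (simp add: y4_def)
  have z3: "0 < z3" "z3 < 1" using RF2(8-10) by (auto simp: z3_def)
  have vz: "val (Suc n) (1 - z3) = y4"
    using gr lta by (simp add: val_def a2 r_def[symmetric] sr(2))
  have X3: "X (Suc (Suc (Suc n))) = p3 * z3" using X by (simp add: p3_def z3_def r2_def)
  have c3: "F (Suc (Suc (Suc n))) y = (p2 * x2_of r) powr (1 / aa) * phir_of r ((val (Suc n) (1 + y / p3) - y4) / (1 - y4))"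
    if y: "y \<in> {- (p3 * z3)..0}" for y
  proof -
    have "p3 * z3 \<le> p3 * 1" using z3 p by (intro mult_left_mono) auto
    then have yp: "y \<in> {- p3..0}" using y by auto
    define w where "w = val (Suc n) (1 + y / p3)"
    note GV = gmap_value[OF ft(2) ab(1)]
    have valeq: "val (Suc n) = (\<lambda>z. (1 - x2_of r) * gmap aa r z + x2_of r)"
      by (rule ext) (simp add: val_def a2 r_def)
    have zr: "1 - z3 \<le> 1 + y / p3" "1 + y / p3 \<le> 1" using y p(3) by (auto simp: field_simps)
    have w: "y4 \<le> w" "w \<le> 1"
      using GV(3)[of "1 - z3" "1 + y / p3"] GV(4)[of "1 + y / p3"] zr z3 vz unfolding w_def valeq by auto
    have wp: "0 < w" using w y3 by linarith
    define v where "v = (F (Suc n) y) powr aa"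
    have v: "v = p2 * w" using c2[OF yp] p(2) wp ab by (simp add: v_def w_def[symmetric] powr_powr)
    have vr: "- v \<in> {- p2..0}" using w wp p(2) by (auto simp: v mult_left_le)
    have arg: "1 + - v / p2 = 1 - w" using p(2) by (simp add: v)
    define q where "q = val n (1 - w)"
    note GV1 = gmap_value[OF ft(1) ab(2)]
    have valeq1: "val n = (\<lambda>z. (1 - x2_of f) * gmap b f z + x2_of f)" by (rule ext) (simp add: val_def b_def f_def)
    have q3: "val n (1 - y4) = x3" using RF(7) o by (simp add: valn)
    have q: "0 < q" "q \<le> x3"
      using GV1(3)[of "1 - w" "1 - y4"] GV1(4)[of "1 - w"] w wp y3 q3 unfolding q_def valeq1 by auto
    have "F (Suc (Suc n)) (- y) = F n (- v)" by (simp add: F v_def aa_def)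
    also have "\<dots> = (p1 * q) powr (1 / b)" using IH2[OF vr] by (simp only: arg q_def)
    finally have "F (Suc (Suc n)) (- y) powr b = p1 * q" using p(1) q ab by (simp add: powr_powr)
    then have "F (Suc (Suc (Suc n))) y = F (Suc n) (- (p1 * q))" by (simp add: F[of "Suc n"] b_def)
    also have "\<dots> = p2 powr (1 / aa) * l (1 + - (p1 * q) / x1')"
      by (rule IH1) (use q p(1) in \<open>auto simp: x1'_def\<close>)
    also have "1 + - (p1 * q) / x1' = 1 - q / x3" using p(1) by (simp add: x1'_def)
    finally have lhs: "F (Suc (Suc (Suc n))) y = p2 powr (1 / aa) * l (1 - q / x3)" .
    have w1: "1 - (w - y4) / (1 - y4) = (1 - w) / (1 - y4)" using y3 by (simp add: field_simps)
    have "zoom 0 (1 - y4) g ((1 - w) / (1 - y4)) = g (1 - w) / ((x3 - x2) / (1 - x2))"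
      unfolding zoom_def using RF(7) homeo01_01[OF g] y3 by simp
    also have "\<dots> = (q - x2) / (x3 - x2)" using o by (simp add: q_def valn)
    finally have z1: "1 - zoom 0 (1 - y4) g ((1 - w) / (1 - y4)) = (x3 - q) / (x3 - x2)" using o by (simp add: field_simps)
    have "phir_of r ((w - y4) / (1 - y4)) = zoom 0 t l ((x3 - q) / (x3 - x2))"
      unfolding RF(5) w1 z1 ..
    also have "\<dots> = l (t * ((x3 - q) / (x3 - x2))) / l t"
      unfolding zoom_def using homeo01_01[OF l] by simp
    also have "t * ((x3 - q) / (x3 - x2)) = 1 - q / x3" using o by (simp add: t_def field_simps)
    finally have pr: "phir_of r ((w - y4) / (1 - y4)) = l (1 - q / x3) / l t" .
    have "(p2 * x2_of r) powr (1 / aa) = p2 powr (1 / aa) * l t"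
      using p(2) lt ab by (simp add: sr(2) powr_mult powr_powr)
    then show ?thesis using lhs pr lt by (simp add: w_def)
  qed
  show ?case
    using c1 c2 c3 unfolding p X3 a2
    by (simp add: p2_def[symmetric] p3_def[symmetric] b_def[symmetric] r_def[symmetric] y4_def[symmetric] p)
qed

section \<open>The tower of a Fibonacci map\<close>

text \<open>The first entry has no meaning for the map; it only has to exceed the auxiliary length
  \<open>Y 0\<close>.\<close>

fun tower_scale :: "(nat \<Rightarrow> flat_map) \<Rightarrow> real \<Rightarrow> real \<Rightarrow> nat \<Rightarrow> real" where
  "tower_scale fn p k 0 = p"
| "tower_scale fn p k (Suc 0) = 1"
| "tower_scale fn p k (Suc (Suc 0)) = k"
| "tower_scale fn p k (Suc (Suc (Suc n))) = tower_scale fn p k (Suc n) * x2_of (fn n)"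

lemma tower_scale_pos:
  assumes "0 < p" "0 < k" "\<And>n. 0 < x2_of (fn n)"
  shows "0 < tower_scale fn p k n"
proof -
  have "0 < tower_scale fn p k n \<and> 0 < tower_scale fn p k (Suc n) \<and> 0 < tower_scale fn p k (Suc (Suc n))"
    by (induction n) (use assms in auto)
  then show ?thesis ..
qed

fun tower_fun :: "(nat \<Rightarrow> real) \<Rightarrow> (real \<Rightarrow> real) \<Rightarrow> (real \<Rightarrow> real) \<Rightarrow> nat \<Rightarrow> real \<Rightarrow> real" where
  "tower_fun a F0 F1 0 = F0"
| "tower_fun a F0 F1 (Suc 0) = F1"
| "tower_fun a F0 F1 (Suc (Suc n)) = (\<lambda>x. tower_fun a F0 F1 n (- (tower_fun a F0 F1 (Suc n) (- x) powr a n)))"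

text \<open>One constant \<open>2 * N\<close> serves both cross ratio estimates and the one with
  the pole \<open>- Y\<close>.\<close>

lemma loglip_base:
  assumes L: "loglip K F f (- X) E" and XY: "X < Y" and N: "K \<le> N" "K + 1 / (Y - X) \<le> N"
  shows "- X \<le> p \<Longrightarrow> p < q \<Longrightarrow> q < r \<Longrightarrow> r < s \<Longrightarrow> s \<le> E \<Longrightarrow> xr p q r s \<le> exp (2 * N * (s - q)) * xr (F p) (F q) (F r) (F s)"
    "- X \<le> p \<Longrightarrow> p < q \<Longrightarrow> q < r \<Longrightarrow> r < s \<Longrightarrow> s \<le> E \<Longrightarrow> xr p q r s \<le> exp (2 * N * (r - p)) * xr (F p) (F q) (F r) (F s)"
    "- X \<le> q \<Longrightarrow> q < r \<Longrightarrow> r < s \<Longrightarrow> s \<le> E \<Longrightarrow> xr (- Y) q r s \<le> exp (2 * N * (s - q)) * ((F r - F q) / (F s - F r))"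
    "strict_mono_on {- X..E} F" "continuous_on {- X..E} F"
proof -
  have K0: "0 \<le> K" "0 \<le> N" using L N by (auto simp: loglip_def)
  note m = loglip_strict_mono[OF L]
  show "strict_mono_on {- X..E} F" using m by (auto simp: strict_mono_on_def)
  show "continuous_on {- X..E} F" using L by (rule loglip_continuous)
  show "xr p q r s \<le> exp (2 * N * (s - q)) * xr (F p) (F q) (F r) (F s)"
      "xr p q r s \<le> exp (2 * N * (r - p)) * xr (F p) (F q) (F r) (F s)"
    if o: "- X \<le> p" "p < q" "q < r" "r < s" "s \<le> E" for p q r s
  proof -
    have x: "0 \<le> xr (F p) (F q) (F r) (F s)" using m o by (intro less_imp_le xr_pos) auto
    have e: "2 * K * (s - q) \<le> 2 * N * (s - q)" "2 * K * (r - p) \<le> 2 * N * (r - p)"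
      using o N by (auto intro!: mult_right_mono)
    show "xr p q r s \<le> exp (2 * N * (s - q)) * xr (F p) (F q) (F r) (F s)"
      by (rule order_trans[OF xr_loglip[OF L o] mult_right_mono]) (use e x in auto)
    show "xr p q r s \<le> exp (2 * N * (r - p)) * xr (F p) (F q) (F r) (F s)"
      by (rule order_trans[OF xr_loglip'[OF L o] mult_right_mono]) (use e x in auto)
  qed
  show "xr (- Y) q r s \<le> exp (2 * N * (s - q)) * ((F r - F q) / (F s - F r))"
    if o: "- X \<le> q" "q < r" "r < s" "s \<le> E" for q r s
  proof -
    have x: "0 \<le> (F r - F q) / (F s - F r)" using m[of q r] m[of r s] o by (intro divide_nonneg_nonneg) auto
    have "(K + 1 / (Y - X)) * (s - q) \<le> 2 * N * (s - q)"
      using o N K0 by (intro mult_right_mono) auto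
    then show ?thesis
      by (intro order_trans[OF pole_loglip[OF L, of "Y - X" "- Y"] mult_right_mono]) (use o x XY in auto)
  qed
qed

text \<open>The index of the tower is one ahead of the level of the renormalization, so that the
  data of the map itself fit without the relation \<open>x\<^sub>2 = s powr b\<close>, which holds
  from level one on only.\<close>

lemma fibonacci_tower:
  assumes l: "1 \<le> l1" "1 \<le> l2" and f: "f \<in> Fibonacci_maps l1 l2"
  defines "fn \<equiv> \<lambda>n. renorm_iter l1 l2 n f"
  shows "\<exists>P X Y E F K. flat_tower (\<lambda>n. lev l1 l2 (Suc n)) P X Y E F K \<and>
    (\<forall>n. P (Suc (Suc (Suc n))) = P (Suc n) * x2_of (fn n) \<and> X (Suc n) = P (Suc n) * x3_of (fn n)
      \<and> Y (Suc n) = P (Suc n) * x4_of (fn n))"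
proof -
  define a where "a = lev l1 l2"
  have a: "1 \<le> a n" "a (Suc (Suc n)) = a n" for n using lev_ge1[OF l] lev_Suc_Suc by (auto simp: a_def)
  have ft: "flat_tuple (fn n)" for n unfolding fn_def using l f by (rule flat_tuple_iter)
  have fS: "fn (Suc n) = renorm (a n) (a (Suc n)) (fn n)" for n by (simp add: fn_def a_def)
  have f0: "fn 0 = f" by (simp add: fn_def)
  define G where "G z = (1 - x2_of f) * gmap (a (Suc 0)) f z + x2_of f" for z
  have fLL: "f \<in> LL" "renormalizable f"
  proof -
    show "f \<in> LL" using f by (simp add: Fibonacci_maps_def)
    have "renormalizable (renorm_iter l1 l2 0 f)" using f unfolding Fibonacci_maps_def by blast
    then show "renormalizable f" by simp
  qed
  obtain \<kappa> X0 Y0 F0 F1 d0 d1 K0 K1 where b: "0 < \<kappa>" "\<kappa> < X0" "X0 < Y0"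
      "loglip K0 F0 d0 (- X0) 0" "loglip K1 F1 d1 (- x3_of f) (\<kappa> * x4_of (fn (Suc 0)))" "F0 (- X0) = 0"
      "\<forall>y\<in>{- \<kappa>..0}. F0 y = G (1 + y / \<kappa>) powr (1 / a (Suc 0))"
      "\<forall>y\<in>{- x3_of f..0}. F1 y = \<kappa> powr (1 / a 0) * phil_of f (1 + y / x3_of f)"
      "F1 (\<kappa> * x3_of (fn (Suc 0))) = X0 powr (1 / a 0)" "F1 (\<kappa> * x4_of (fn (Suc 0))) = Y0 powr (1 / a 0)"
      "\<forall>y\<in>{- (\<kappa> * x3_of (fn (Suc 0)))..0}. F0 (- (F1 (- y) powr a 0)) =
         x2_of f powr (1 / a (Suc 0)) * phir_of f ((G (1 + y / \<kappa>) - x4_of f) / (1 - x4_of f))"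
    using base_branches[OF fLL a(1)[of 0] a(1)[of "Suc 0"]] unfolding G_def fS f0 by blast
  define P where "P = tower_scale fn (Y0 + 1) \<kappa>"
  define X where "X n = (case n of 0 \<Rightarrow> X0 | Suc m \<Rightarrow> P n * x3_of (fn m))" for n
  define Y where "Y n = (case n of 0 \<Rightarrow> Y0 | Suc m \<Rightarrow> P n * x4_of (fn m))" for n
  define E where "E n = (case n of 0 \<Rightarrow> 0 | Suc m \<Rightarrow> if m = 0 then Y (Suc n) else X m)" for n
  define F where "F = tower_fun a F0 F1"
  have P: "P 0 = Y0 + 1" "P (Suc 0) = 1" "P (Suc (Suc 0)) = \<kappa>" "\<And>n. P (Suc (Suc (Suc n))) = P (Suc n) * x2_of (fn n)"
    by (simp_all add: P_def)
  have X: "X 0 = X0" "\<And>n. X (Suc n) = P (Suc n) * x3_of (fn n)" and Y: "Y 0 = Y0" "\<And>n. Y (Suc n) = P (Suc n) * x4_of (fn n)"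
    by (simp_all add: X_def Y_def)
  have E: "E 0 = 0" "E (Suc 0) = Y (Suc (Suc 0))" "\<And>n. E (Suc (Suc n)) = X (Suc n)" by (simp_all add: E_def)
  have F: "F 0 = F0" "F (Suc 0) = F1" "\<And>n x. F (Suc (Suc n)) x = F n (- (F (Suc n) (- x) powr a n))"
    by (simp_all add: F_def)
  have o: "0 < x2_of (fn n)" "x2_of (fn n) < x3_of (fn n)" "x3_of (fn n) < x4_of (fn n)" "x4_of (fn n) < 1" for n
    using ft[of n] by (auto simp: flat_tuple_def)
  have Ppos: "0 < P n" for n unfolding P_def
    using tower_scale_pos b(1-3) o by simp
  define val where "val n z = (1 - x2_of (fn n)) * gmap (a (Suc n)) (fn n) z + x2_of (fn n)" for n z
  have x30: "X (Suc 0) = x3_of f" "X (Suc (Suc 0)) = \<kappa> * x3_of (fn (Suc 0))" by (simp_all add: X P f0)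
  have REL: "(\<forall>y\<in>{- X (Suc n)..0}. F (Suc n) y = P (Suc (Suc n)) powr (1 / a n) * phil_of (fn n) (1 + y / X (Suc n))) \<and>
    (\<forall>y\<in>{- P (Suc (Suc n))..0}. F n y = (P (Suc n) * val n (1 + y / P (Suc (Suc n)))) powr (1 / a (Suc n))) \<and>
    (\<forall>y\<in>{- X (Suc (Suc n))..0}. F (Suc (Suc n)) y =
        P (Suc (Suc (Suc n))) powr (1 / a (Suc n)) * phir_of (fn n) ((val n (1 + y / P (Suc (Suc n))) - x4_of (fn n)) / (1 - x4_of (fn n))))" for n
    unfolding val_def
  proof (rule tower_relation[where P = P and X = X and F = F and a = a and fn = fn, OF a ft fS Ppos P(4) X(2) F(3)],
      goal_cases)
    case (1 y)
    then show ?case using b(8) by (simp only: F P x30 f0)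
  next
    case (2 y)
    then show ?case using b(7) unfolding G_def[abs_def] by (simp add: F P f0)
  next
    case (3 y)
    have "F (Suc (Suc 0)) y = F0 (- (F1 (- y) powr a 0))" by (simp add: F)
    then show ?case using b(11) 3 unfolding G_def[abs_def] x30 by (simp only: P f0) simp
  qed
  note R1 = REL[THEN conjunct1, rule_format] and R2 = REL[THEN conjunct2, THEN conjunct1, rule_format]
  have v: "val n 0 = x2_of (fn n)" "val n 1 = 1" for n
    using homeo01_01[OF homeo01_gmap[OF ft a(1)]] by (simp_all add: val_def)
  have vz: "val n (1 - x3_of (fn (Suc n))) = x4_of (fn n)" "val n (1 - x4_of (fn (Suc n))) = x3_of (fn n)" for n
  proof -
    note rf = renorm_fields(6,7)[OF ft[of n] a(1)[of n] a(1)[of "Suc n"], folded fS]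
    have "1 - x2_of (fn n) \<noteq> 0" using o[of n] by simp
    then show "val n (1 - x3_of (fn (Suc n))) = x4_of (fn n)" "val n (1 - x4_of (fn (Suc n))) = x3_of (fn n)"
      unfolding val_def rf by simp_all
  qed
  have R2': "F n (- (P (Suc (Suc n)) * z)) = (P (Suc n) * val n (1 - z)) powr (1 / a (Suc n))" if "0 \<le> z" "z \<le> 1" for n z
  proof -
    have "- (P (Suc (Suc n)) * z) \<in> {- P (Suc (Suc n))..0}" using that Ppos[of "Suc (Suc n)"] by (simp add: mult_left_le)
    moreover have "1 + - (P (Suc (Suc n)) * z) / P (Suc (Suc n)) = 1 - z" using Ppos[of "Suc (Suc n)"] by simp
    ultimately show ?thesis using R2[of "- (P (Suc (Suc n)) * z)" n] by simp
  qed
  define N where "N = K0 + K1 + 1 / (Y0 - X0) + 1 / (Y 1 - X 1)"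
  have K01: "0 \<le> K0" "0 \<le> K1" using b(4,5) by (auto simp: loglip_def)
  have XY1: "X 1 < Y 1" using o[of 0] by (simp add: X Y P)
  have N: "K0 \<le> N" "K0 + 1 / (Y0 - X0) \<le> N" "K1 \<le> N" "K1 + 1 / (Y 1 - X 1) \<le> N" "0 \<le> N"
    using K01 b(3) XY1 by (auto simp: N_def add_nonneg_nonneg add_increasing add_increasing2)
  have B1: "loglip K1 F1 d1 (- X 1) (E 1)" using b(5) by (simp add: x30 E Y P)
  note L0 = loglip_base[OF b(4,3) N(1,2)] and L1 = loglip_base[OF B1 XY1 N(3,4)]
  have "flat_tower (\<lambda>n. lev l1 l2 (Suc n)) P X Y E F (2 * N)"
  proof
    fix n
    show "1 \<le> lev l1 l2 (Suc n)" "lev l1 l2 (Suc (Suc (Suc n))) = lev l1 l2 (Suc n)"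
      using a by (simp_all add: a_def)
    show "0 < P n" by (rule Ppos)
    show "P (Suc (Suc n)) < X n" using b(2) o Ppos by (cases n) (auto simp: P X)
    show "X n < Y n" using b(3) o Ppos by (cases n) (auto simp: X Y)
    show "Y n < P n" using o Ppos by (cases n) (auto simp: P Y)
    show "E 0 = 0" "E (Suc 0) = Y (Suc (Suc 0))" "E (Suc (Suc n)) = X (Suc n)" by (rule E)+
    have aL: "lev l1 l2 (Suc n) = a (Suc n)" "lev l1 l2 (Suc (Suc 0)) = a 0" by (simp_all add: a_def lev_def)
    show "F n (- X n) = 0"
    proof (cases n)
      case (Suc m)
      have "0 < X (Suc m)" using Ppos[of "Suc m"] o[of m] by (simp add: X)
      then show ?thesis using R1[of "- X (Suc m)" m] ft[of m] Suc by (simp add: flat_tuple_def homeo01_def)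
    qed (simp add: F X b)
    show "F n (- P (Suc (Suc n))) = P (Suc (Suc (Suc n))) powr (1 / lev l1 l2 (Suc n))"
      using R2'[of 1 n] by (simp add: v P aL)
    show "F n (- Y (Suc (Suc n))) = X (Suc n) powr (1 / lev l1 l2 (Suc n))"
      using R2'[of "x4_of (fn (Suc n))" n] o[of "Suc n"] by (simp add: vz X Y aL)
    show "F n (- X (Suc (Suc n))) = Y (Suc n) powr (1 / lev l1 l2 (Suc n))"
      using R2'[of "x3_of (fn (Suc n))" n] o[of "Suc n"] by (simp add: vz X Y aL)
    show "F n 0 = P (Suc n) powr (1 / lev l1 l2 (Suc n))"
      using R2'[of 0 n] by (simp add: v aL)
    show "F (Suc 0) (X (Suc (Suc 0))) = X 0 powr (1 / lev l1 l2 (Suc (Suc 0)))"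
      "F (Suc 0) (Y (Suc (Suc 0))) = Y 0 powr (1 / lev l1 l2 (Suc (Suc 0)))"
      using b(9,10) by (simp_all only: aL F X Y P)
    show "F (Suc (Suc n)) x = F n (- (F (Suc n) (- x) powr lev l1 l2 (Suc (Suc n))))" for x
      unfolding F(3) by (simp only: a_def lev_Suc_Suc)
    show "strict_mono_on {- X 0..E 0} (F 0)" "continuous_on {- X 0..E 0} (F 0)"
      using L0(4,5) by (simp_all only: X E F)
    show "strict_mono_on {- X 1..E 1} (F 1)" "continuous_on {- X 1..E 1} (F 1)"
      using L1(4,5) by (simp_all add: F)
    show "0 \<le> 2 * N" using N by simp
    fix i :: nat and p q r s
    assume i: "i < 2"
    then have i: "i = 0 \<or> i = 1" by auto
    show "- X i \<le> p \<Longrightarrow> p < q \<Longrightarrow> q < r \<Longrightarrow> r < s \<Longrightarrow> s \<le> E i \<Longrightarrow> xr p q r s \<le> exp (2 * N * (s - q)) * xr (F i p) (F i q) (F i r) (F i s)"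
      "- X i \<le> p \<Longrightarrow> p < q \<Longrightarrow> q < r \<Longrightarrow> r < s \<Longrightarrow> s \<le> E i \<Longrightarrow> xr p q r s \<le> exp (2 * N * (r - p)) * xr (F i p) (F i q) (F i r) (F i s)"
      "- X i \<le> q \<Longrightarrow> q < r \<Longrightarrow> r < s \<Longrightarrow> s \<le> E i \<Longrightarrow> xr (- Y i) q r s \<le> exp (2 * N * (s - q)) * ((F i r - F i q) / (F i s - F i r))"
      using i L0(1,2)[of p q r s] L0(3)[of q r s] L1(1,2)[of p q r s] L1(3)[of q r s] by (auto simp: X(1) Y(1) E(1) F(1,2))
  qed
  then show ?thesis using P(4) X(2) Y(2) by blast
qed

section \<open>The unstable coordinate and the scaling ratios\<close>

text \<open>The value on the vector of scaling ratios of the functional \<open>(1, c, 0, -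
  c)\<close>, which for a suitable \<open>c\<close> is a left eigenvector for
  \<open>\<lambda>\<^sub>u\<close>.\<close>

definition scaling_defect :: "real \<Rightarrow> real \<Rightarrow> flat_map \<Rightarrow> real" where
  "scaling_defect c b f = ln (ratio2 f) + c * (ln (ratio3 f) - ln (ratio5 b f))"

text \<open>The relation \<open>x\<^sub>2 = s powr b\<close> makes \<open>ln S\<^sub>5\<close> a
  multiple of \<open>ln x\<^sub>2\<close>.\<close>

lemma scaling_defect_renorm:
  assumes f: "flat_tuple f" and b: "1 \<le> b" and s: "x2_of f = s_of f powr b"
  shows "scaling_defect c b f = (1 - c) * ln (1 - x4_of f) - ln (1 - x2_of f) + c * ln (x3_of f) - c * (1 - 1 / b) * ln (x2_of f)"
proof -
  have o: "0 < x2_of f" "x2_of f < x3_of f" "x3_of f < x4_of f" "x4_of f < 1" "0 < s_of f"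
    using f by (auto simp: flat_tuple_def)
  have "ln (x2_of f) = b * ln (s_of f)" unfolding s using o by (simp add: ln_powr)
  then have "(1 - 1 / b) * ln (x2_of f) = (b - 1) * ln (s_of f)" using b by (simp add: field_simps)
  then have "ln (ratio5 b f) = (1 - 1 / b) * ln (x2_of f)" using o by (simp add: ratio5_def ln_powr)
  moreover have "ln (ratio2 f) = ln (1 - x4_of f) - ln (1 - x2_of f)" "ln (ratio3 f) = ln (x3_of f) - ln (1 - x4_of f)"
    using o by (simp_all add: ratio2_def ratio3_def ln_div)
  ultimately show ?thesis unfolding scaling_defect_def by (simp only:) (simp add: algebra_simps)
qed

lemma x2_iter:
  assumes l: "1 \<le> l1" "1 \<le> l2" and f: "f \<in> Fibonacci_maps l1 l2"
  shows "x2_of (renorm_iter l1 l2 (Suc n) f) = s_of (renorm_iter l1 l2 (Suc n) f) powr lev l1 l2 (Suc (Suc n))"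
  using renorm_fields(1,2)[OF flat_tuple_iter[OF l f, of n] lev_ge1[OF l, of n] lev_ge1[OF l, of "Suc n"]]
  by (simp only: renorm_iter.simps lev_Suc_Suc)

text \<open>In the formula of \<open>scaling_defect_renorm\<close> the terms with \<open>ln (1 -
  x\<^sub>2)\<close> and \<open>ln x\<^sub>2\<close> contribute nonnegative amounts; \<open>1 -
  x\<^sub>4\<close> and \<open>x\<^sub>3 > x\<^sub>2\<close> are bounded below by the results on
  towers.\<close>

lemma scaling_defect_bounded_below:
  assumes l: "1 \<le> l1" "1 \<le> l2" and f: "f \<in> Fibonacci_maps l1 l2" and S: "1 / l1 + 1 / l2 < 1" and c: "0 < c" "c < 1"
  shows "\<exists>B. \<forall>n\<ge>3. B \<le> scaling_defect c (lev l1 l2 (Suc n)) (renorm_iter l1 l2 n f)"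
proof -
  define fn where "fn n = renorm_iter l1 l2 n f" for n
  obtain P X Y E F K where T: "flat_tower (\<lambda>n. lev l1 l2 (Suc n)) P X Y E F K" and
    r: "\<And>n. P (Suc (Suc (Suc n))) = P (Suc n) * x2_of (fn n)" "\<And>n. Y (Suc n) = P (Suc n) * x4_of (fn n)"
    using fibonacci_tower[OF l f] unfolding fn_def by blast
  interpret flat_tower "\<lambda>n. lev l1 l2 (Suc n)" P X Y E F K by (rule T)
  have u: "u (Suc n) = x2_of (fn n)" for n unfolding u_def r using P_pos[of "Suc n"] by simp
  have S': "1 / lev l1 l2 (Suc 0) + 1 / lev l1 l2 (Suc 1) < 1" using S by (simp add: lev_def)
  obtain c0 where c0: "0 < c0" "\<And>n. c0 \<le> u n" using u_bounded_below S' by auto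
  obtain k where k: "0 < k" "\<And>n. k \<le> 1 - Y (n + 4) / P (n + 4)" using Y_bounded_away[OF c0] by blast
  have "(1 - c) * ln k + c * ln c0 \<le> scaling_defect c (lev l1 l2 (Suc n)) (fn n)" if n: "3 \<le> n" for n
  proof -
    obtain m where m: "n = Suc m" "n = m + 1" using n by (cases n) auto
    have ft: "flat_tuple (fn n)" unfolding fn_def using l f by (rule flat_tuple_iter)
    then have o: "0 < x2_of (fn n)" "x2_of (fn n) < x3_of (fn n)" "x3_of (fn n) < x4_of (fn n)" "x4_of (fn n) < 1"
      by (auto simp: flat_tuple_def)
    have "Suc n = (n - 3) + 4" using n by simp
    then have "k \<le> 1 - Y (Suc n) / P (Suc n)" using k(2)[of "n - 3"] by simp
    also have "Y (Suc n) / P (Suc n) = x4_of (fn n)" unfolding r(2) using P_pos[of "Suc n"] by simp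
    finally have "ln k \<le> ln (1 - x4_of (fn n))" using k(1) by simp
    then have 1: "(1 - c) * ln k \<le> (1 - c) * ln (1 - x4_of (fn n))" using c by (intro mult_left_mono) auto
    have "c0 \<le> x3_of (fn n)" using c0(2)[of "Suc n"] o unfolding u by linarith
    then have "ln c0 \<le> ln (x3_of (fn n))" using c0(1) by simp
    then have 2: "c * ln c0 \<le> c * ln (x3_of (fn n))" using c by (intro mult_left_mono) auto
    have b: "1 \<le> lev l1 l2 (Suc n)" using lev_ge1[OF l] .
    have "0 \<le> c * (1 - 1 / lev l1 l2 (Suc n))" using b c by (intro mult_nonneg_nonneg) auto
    then have 3: "c * (1 - 1 / lev l1 l2 (Suc n)) * ln (x2_of (fn n)) \<le> 0"
      using o by (intro mult_nonneg_nonpos) auto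
    have 4: "ln (1 - x2_of (fn n)) \<le> 0" using o by simp
    have "x2_of (fn n) = s_of (fn n) powr lev l1 l2 (Suc n)" using x2_iter[OF l f, of m] by (simp only: fn_def m(1))
    from scaling_defect_renorm[OF ft b this, of c] show ?thesis using 1 2 3 4 by linarith
  qed
  then show ?thesis unfolding fn_def by blast
qed

text \<open>Since \<open>x\<^sub>3 \<le> R * x\<^sub>2\<close>, the total coefficient of \<open>ln
  x\<^sub>2\<close> in \<open>scaling_defect_renorm\<close> is \<open>c / b > 0\<close>. A lower
  bound on the even levels therefore bounds \<open>x\<^sub>2\<close> below on these levels, that
  is, \<open>u\<close> at odd indices.\<close>

lemma scaling_defect_not_bounded_below:
  assumes l: "1 \<le> l1" "1 \<le> l2" and f: "f \<in> Fibonacci_maps l1 l2" and S: "1 < 1 / l1 + 1 / l2" and c: "0 < c" "c < 1"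
  shows "\<not> (\<forall>n\<ge>N. B \<le> scaling_defect c (lev l1 l2 (Suc (2 * n))) (renorm_iter l1 l2 (2 * n) f))"
proof
  assume D: "\<forall>n\<ge>N. B \<le> scaling_defect c (lev l1 l2 (Suc (2 * n))) (renorm_iter l1 l2 (2 * n) f)"
  define fn where "fn n = renorm_iter l1 l2 n f" for n
  obtain P X Y E F K where T: "flat_tower (\<lambda>n. lev l1 l2 (Suc n)) P X Y E F K" and
    r: "\<And>n. P (Suc (Suc (Suc n))) = P (Suc n) * x2_of (fn n)" "\<And>n. X (Suc n) = P (Suc n) * x3_of (fn n)"
    using fibonacci_tower[OF l f] unfolding fn_def by blast
  interpret flat_tower "\<lambda>n. lev l1 l2 (Suc n)" P X Y E F K by (rule T)
  have u: "u (Suc n) = x2_of (fn n)" for n unfolding u_def r using P_pos[of "Suc n"] by simp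
  have S': "1 < 1 / lev l1 l2 (Suc 0) + 1 / lev l1 l2 (Suc 1)" using S by (simp add: lev_def)
  obtain R where R: "0 < R" "\<And>n. X n \<le> R * P (n + 2)" using X_bounded by blast
  obtain \<eta> where \<eta>: "0 < \<eta>" "\<And>n. u n \<le> 1 - \<eta>" using u_bounded_away by blast
  define c1 where "c1 = exp (l2 / c * (B + ln \<eta> - c * ln R))"
  have "c1 \<le> u (Suc (2 * n))" if n: "N + 1 \<le> n" for n
  proof -
    define g where "g = fn (2 * n)"
    obtain m where m: "2 * n = Suc m" using n by (cases n) auto
    have ft: "flat_tuple g" unfolding g_def fn_def using l f by (rule flat_tuple_iter)
    then have o: "0 < x2_of g" "x2_of g < x3_of g" "x3_of g < x4_of g" "x4_of g < 1"
      by (auto simp: flat_tuple_def)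
    have lev: "lev l1 l2 (Suc (2 * n)) = l2" by (simp add: lev_def)
    have "x2_of g = s_of g powr l2" using x2_iter[OF l f, of m, folded m] by (simp only: g_def fn_def lev)
    note eq = scaling_defect_renorm[OF ft l(2) this, of c]
    have B: "B \<le> scaling_defect c l2 g" using D n by (auto simp: g_def fn_def lev_def)
    have "P (Suc (2 * n)) * x3_of g \<le> P (Suc (2 * n)) * (R * x2_of g)"
      using R(2)[of "Suc (2 * n)"] r(1)[of "2 * n"] r(2)[of "2 * n"] by (simp add: g_def mult_ac)
    then have "x3_of g \<le> R * x2_of g" using P_pos[of "Suc (2 * n)"] by simp
    then have "ln (x3_of g) \<le> ln (R * x2_of g)" using o by simp
    also have "\<dots> = ln R + ln (x2_of g)" using R(1) o by (simp add: ln_mult)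
    finally have 1: "c * ln (x3_of g) \<le> c * (ln R + ln (x2_of g))" using c by (intro mult_left_mono) auto
    have "\<eta> \<le> 1 - x2_of g" using \<eta>(2)[of "Suc (2 * n)"] unfolding u g_def by linarith
    then have 2: "ln \<eta> \<le> ln (1 - x2_of g)" using \<eta>(1) by simp
    have 3: "(1 - c) * ln (1 - x4_of g) \<le> 0" using o c by (intro mult_nonneg_nonpos) auto
    have "c * (1 - 1 / l2) * ln (x2_of g) = c * ln (x2_of g) - c / l2 * ln (x2_of g)" by (simp add: algebra_simps)
    then have "B + ln \<eta> - c * ln R \<le> c / l2 * ln (x2_of g)"
      using B 1 2 3 unfolding eq by (simp add: distrib_left)
    then have "l2 / c * (B + ln \<eta> - c * ln R) \<le> l2 / c * (c / l2 * ln (x2_of g))"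
      using c l by (intro mult_left_mono) auto
    also have "\<dots> = ln (x2_of g)" using c l by simp
    finally have "c1 \<le> exp (ln (x2_of g))" unfolding c1_def by simp
    then show ?thesis using o by (simp add: u g_def)
  qed
  moreover have "0 < c1" by (simp add: c1_def)
  ultimately obtain c2 where "0 < c2" "\<And>n. c2 \<le> u n" using u_bounded_below_of_odd[of c1 "N + 1"] by blast
  then show False using u_not_bounded_below S' by auto
qed

section \<open>The unstable left eigenvector\<close>

text \<open>\<open>\<lambda>\<^sub>u\<close> is the larger root of \<open>l1 * l2 *
  \<lambda>\<^sup>2 - (l1 + l2 + 1) * \<lambda> + 1\<close>, whose value at \<open>1\<close> is
  \<open>l1 * l2 - (l1 + l2)\<close>; this sign is the one of \<open>1 - (1 / l1 + 1 /
  l2)\<close>.\<close>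

lemma lambda_u_facts:
  assumes l: "1 \<le> l1" "1 \<le> l2"
  shows "l1 * l2 * (lambda_u l1 l2)\<^sup>2 - (l1 + l2 + 1) * lambda_u l1 l2 + 1 = 0" "1 < l2 * lambda_u l1 l2"
    "lambda_s l1 l2 < lambda_u l1 l2"
    "1 < lambda_u l1 l2 \<Longrightarrow> 1 < 1 / l1 + 1 / l2" "lambda_u l1 l2 < 1 \<Longrightarrow> 1 / l1 + 1 / l2 < 1"
proof -
  define d where "d = l1\<^sup>2 + l2\<^sup>2 + 2 * l1 + 2 * l2 - 2 * l1 * l2 + 1"
  have d: "d = (l1 - l2)\<^sup>2 + 2 * (l1 + l2) + 1" by (simp add: d_def power2_eq_square algebra_simps)
  have d0: "0 < d" unfolding d using l by (smt (verit) zero_le_power2)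
  have q: "(sqrt d)\<^sup>2 = d" "0 < sqrt d" using d0 by auto
  have p: "0 < l1 * l2" using l by simp
  have lam: "lambda_u l1 l2 = (1 + l1 + l2 + sqrt d) / (2 * (l1 * l2))" "lambda_s l1 l2 = (1 + l1 + l2 - sqrt d) / (2 * (l1 * l2))"
    by (simp_all add: lambda_u_def lambda_s_def d_def mult.assoc)
  have e: "2 * (l1 * l2) * lambda_u l1 l2 = 1 + l1 + l2 + sqrt d" unfolding lam(1) using p by (simp only: nonzero_mult_div_cancel_left times_divide_eq_right mult_eq_0_iff) auto
  then have "(2 * (l1 * l2) * lambda_u l1 l2 - (1 + l1 + l2))\<^sup>2 = d" using q by simp
  also have "d = (1 + l1 + l2)\<^sup>2 - 4 * (l1 * l2)" by (simp add: d_def power2_eq_square algebra_simps)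
  finally have "4 * (l1 * l2) * (l1 * l2 * (lambda_u l1 l2)\<^sup>2 - (l1 + l2 + 1) * lambda_u l1 l2 + 1) = 0"
    by (simp add: power2_eq_square algebra_simps)
  then show "l1 * l2 * (lambda_u l1 l2)\<^sup>2 - (l1 + l2 + 1) * lambda_u l1 l2 + 1 = 0" using p by (metis mult_eq_0_iff order_less_irrefl zero_neq_numeral)
  have "(l1 - l2 - 1)\<^sup>2 < d" unfolding d using l by (simp add: power2_eq_square algebra_simps)
  then have "l1 - l2 - 1 < sqrt d" by (intro real_less_rsqrt)
  then have "l1 * 2 < l1 * (2 * (l2 * lambda_u l1 l2))" using e by (simp add: mult_ac)
  then show "1 < l2 * lambda_u l1 l2" using l by simp
  show "lambda_s l1 l2 < lambda_u l1 l2" unfolding lam using q p by (intro divide_strict_right_mono) auto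
  have sq: "(2 * (l1 * l2) - (l1 + l2) - 1)\<^sup>2 = d + 4 * (l1 * l2) * (l1 * l2 - (l1 + l2))"
    by (simp add: d_def power2_eq_square algebra_simps)
  have frac: "1 / l1 + 1 / l2 = (l1 + l2) / (l1 * l2)" using l by (simp add: field_simps)
  show "1 < 1 / l1 + 1 / l2" if "1 < lambda_u l1 l2"
  proof (rule ccontr)
    assume "\<not> 1 < 1 / l1 + 1 / l2"
    then have le: "l1 + l2 \<le> l1 * l2" unfolding frac using p by (simp add: field_simps)
    then have "d \<le> (2 * (l1 * l2) - (l1 + l2) - 1)\<^sup>2" unfolding sq using p by simp
    moreover have "0 \<le> 2 * (l1 * l2) - (l1 + l2) - 1" using le l by linarith
    ultimately have "sqrt d \<le> 2 * (l1 * l2) - (l1 + l2) - 1" by (rule real_le_lsqrt[OF _ _, rotated 1])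
    then have "2 * (l1 * l2) * lambda_u l1 l2 \<le> 2 * (l1 * l2) * 1" using e by simp
    moreover have "2 * (l1 * l2) * 1 < 2 * (l1 * l2) * lambda_u l1 l2"
      using that p by (intro mult_strict_left_mono) auto
    ultimately show False by linarith
  qed
  show "1 / l1 + 1 / l2 < 1" if "lambda_u l1 l2 < 1"
  proof (rule ccontr)
    assume "\<not> 1 / l1 + 1 / l2 < 1"
    then have le: "l1 * l2 \<le> l1 + l2" unfolding frac using p by (simp add: field_simps)
    then have "4 * (l1 * l2) * (l1 * l2 - (l1 + l2)) \<le> 0" using p by (intro mult_nonneg_nonpos) auto
    then have "(2 * (l1 * l2) - (l1 + l2) - 1)\<^sup>2 \<le> d" unfolding sq by simp
    then have "2 * (l1 * l2) - (l1 + l2) - 1 \<le> sqrt d" by (intro real_le_rsqrt)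
    then have "2 * (l1 * l2) * 1 \<le> 2 * (l1 * l2) * lambda_u l1 l2" using e by simp
    moreover have "2 * (l1 * l2) * lambda_u l1 l2 < 2 * (l1 * l2) * 1"
      using that p by (intro mult_strict_left_mono) auto
    ultimately show False by linarith
  qed
qed

definition pairing :: "real \<Rightarrow> real ^ 4 \<Rightarrow> real" where
  "pairing c x = x $ 1 + c * x $ 2 - c * x $ 4"

lemma pairing_linear: "pairing c (x + y) = pairing c x + pairing c y" "pairing c (r *\<^sub>R x) = r * pairing c x"
  by (simp_all add: pairing_def algebra_simps)

lemma vector_4 [simp]:
  "(vector [a, b, c, d] :: ('a :: zero) ^ 4) $ 1 = a" "(vector [a, b, c, d] :: 'a ^ 4) $ 2 = b"
  "(vector [a, b, c, d] :: 'a ^ 4) $ 3 = c" "(vector [a, b, c, d] :: 'a ^ 4) $ 4 = d"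
  by (simp_all add: vector_def)

lemma Lmat_mult:
  "(Lmat l *v x) $ 1 = (1 + 1 / l) * x $ 1 + x $ 2 - x $ 4"
  "(Lmat l *v x) $ 2 = - (1 / l) * x $ 1 - x $ 2 + x $ 4"
  "(Lmat l *v x) $ 4 = (1 - 1 / l) * x $ 1"
  by (simp_all add: Lmat_def matrix_vector_mult_def sum_4)

lemma pairing_L_even:
  assumes l: "1 \<le> l1" "1 \<le> l2"
  defines "\<mu> \<equiv> lambda_u l1 l2" and "c \<equiv> 1 / (l2 * lambda_u l1 l2)"
  shows "pairing c (L_even l1 l2 *v x) = \<mu> * pairing c x"
proof -
  note lf = lambda_u_facts[OF l, folded \<mu>_def]
  have \<mu>: "0 < \<mu>" using lf(2) l by (smt (verit) mult_nonneg_nonpos)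
  have c: "\<mu> * c = 1 / l2" using \<mu> by (simp add: c_def \<mu>_def[symmetric])
  have r: "1 / l2 + 1 / l1 * (1 / l2 + 1 - c) = \<mu>"
  proof -
    have "l1 * l2 * \<mu> * (1 / l2 + 1 / l1 * (1 / l2 + 1 - c)) = (l1 + l2 + 1) * \<mu> - l2 * (\<mu> * c)"
      using l by (simp add: field_simps)
    also have "\<dots> = l1 * l2 * \<mu> * \<mu>" using lf(1) l by (simp add: c power2_eq_square algebra_simps)
    finally show ?thesis using l \<mu> by simp
  qed
  define y where "y = Lmat l1 *v x"
  have y: "y $ 1 = (1 + 1 / l1) * x $ 1 + x $ 2 - x $ 4" "y $ 2 = - (1 / l1) * x $ 1 - x $ 2 + x $ 4" "y $ 4 = (1 - 1 / l1) * x $ 1"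
    by (simp_all add: y_def Lmat_mult)
  have "pairing c (L_even l1 l2 *v x) = pairing c (Lmat l2 *v y)"
    by (simp add: L_even_def y_def matrix_vector_mul_assoc)
  also have "\<dots> = (1 + 1 / l2 - c) * y $ 1 + (1 - c) * y $ 2 - (1 - c) * y $ 4"
    by (simp add: pairing_def Lmat_mult algebra_simps)
  also have "\<dots> = (1 / l2 + 1 / l1 * (1 / l2 + 1 - c)) * x $ 1 + 1 / l2 * x $ 2 - 1 / l2 * x $ 4"
    unfolding y by (simp add: algebra_simps add_divide_distrib)
  also have "\<dots> = \<mu> * x $ 1 + \<mu> * c * x $ 2 - \<mu> * c * x $ 4" by (simp only: r c)
  finally show ?thesis by (simp add: pairing_def algebra_simps)
qed

lemma pairing_eigenvector_zero:
  assumes l: "1 \<le> l1" "1 \<le> l2" and e: "L_even l1 l2 *v x = m *\<^sub>R x" "m \<noteq> lambda_u l1 l2"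
  shows "pairing (1 / (l2 * lambda_u l1 l2)) x = 0"
proof -
  have "lambda_u l1 l2 * pairing (1 / (l2 * lambda_u l1 l2)) x = pairing (1 / (l2 * lambda_u l1 l2)) (m *\<^sub>R x)"
    using pairing_L_even[OF l, of x] e by simp
  also have "\<dots> = m * pairing (1 / (l2 * lambda_u l1 l2)) x" by (simp add: pairing_def algebra_simps)
  finally show ?thesis using e by simp
qed

text \<open>With \<open>y = Lmat l1 *v x\<close>, the eigenvector equation expresses \<open>x $
  2\<close> and \<open>x $ 4\<close> by \<open>x $ 1\<close> and \<open>y $ 1\<close>, and gives
  \<open>(1 - c) * y $ 1 = x $ 1 / l1\<close>. So \<open>y $ 1\<close> has the sign of \<open>x $
  1\<close>, and so has the pairing \<open>(1 - c) * x $ 1 + c\<^sup>2 * y $ 1\<close>.\<close>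

lemma pairing_Eu_neg:
  assumes l: "1 \<le> l1" "1 \<le> l2" and e: "L_even l1 l2 *v x = lambda_u l1 l2 *\<^sub>R x" "x $ 1 < 0"
  shows "pairing (1 / (l2 * lambda_u l1 l2)) x < 0"
proof -
  define \<mu> c where "\<mu> = lambda_u l1 l2" and "c = 1 / (l2 * \<mu>)"
  note lf = lambda_u_facts[OF l, folded \<mu>_def]
  have \<mu>: "0 < \<mu>" using lf(2) l by (smt (verit) mult_nonneg_nonpos)
  have c: "0 < c" "c < 1" using lf(2) by (auto simp: c_def)
  define y where "y = Lmat l1 *v x"
  have y: "y $ 1 = (1 + 1 / l1) * x $ 1 + x $ 2 - x $ 4" by (simp add: y_def Lmat_mult)
  have "Lmat l2 *v y = \<mu> *\<^sub>R x" using e by (simp add: L_even_def y_def matrix_vector_mul_assoc \<mu>_def)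
  then have "\<mu> * x $ 1 = (Lmat l2 *v y) $ 1" "\<mu> * x $ 2 = (Lmat l2 *v y) $ 2" "\<mu> * x $ 4 = (Lmat l2 *v y) $ 4" by simp_all
  then have m: "\<mu> * x $ 1 = (1 + 1 / l2) * y $ 1 + y $ 2 - y $ 4" "\<mu> * x $ 2 = - (1 / l2) * y $ 1 - y $ 2 + y $ 4"
    "\<mu> * x $ 4 = (1 - 1 / l2) * y $ 1" by (simp_all only: Lmat_mult)
  have "\<mu> * (x $ 1 + x $ 2) = y $ 1" using m by (simp add: algebra_simps)
  then have x2: "x $ 2 = y $ 1 / \<mu> - x $ 1" using \<mu> by (simp add: field_simps)
  have x4: "x $ 4 = (1 - 1 / l2) * y $ 1 / \<mu>" using m(3) \<mu> by (simp add: field_simps)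
  have cy: "y $ 1 / \<mu> - (1 - 1 / l2) * y $ 1 / \<mu> = c * y $ 1" using \<mu> l by (simp add: c_def field_simps)
  have "y $ 1 = x $ 1 / l1 + (y $ 1 / \<mu> - (1 - 1 / l2) * y $ 1 / \<mu>)" using y unfolding x2 x4 by (simp add: algebra_simps)
  then have "(1 - c) * y $ 1 = x $ 1 / l1" unfolding cy by (simp add: algebra_simps)
  moreover have "x $ 1 / l1 < 0" using e l by (simp add: divide_neg_pos)
  ultimately have y1: "y $ 1 < 0" using c by (metis diff_gt_0_iff_gt mult_less_0_iff not_less_iff_gr_or_eq)
  have "pairing c x = (1 - c) * x $ 1 + c * (y $ 1 / \<mu> - (1 - 1 / l2) * y $ 1 / \<mu>)"
    unfolding pairing_def x2 x4 by (simp add: algebra_simps)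
  also have "\<dots> = (1 - c) * x $ 1 + c * (c * y $ 1)" unfolding cy ..
  also have "\<dots> < 0" using c y1 e by (intro add_neg_neg mult_pos_neg) auto
  finally show ?thesis by (simp add: c_def \<mu>_def)
qed

text \<open>The left eigenvector for \<open>\<lambda>\<^sub>u\<close> annihilates the eigenvectors
  for all other eigenvalues and thus picks out the coordinate \<open>C_u\<close>.\<close>

lemma C_u_eq:
  assumes l: "1 \<le> l1" "1 \<le> l2" and B: "eigenbasis l1 l2 Eu Es E1 E0" and n1: "lambda_u l1 l2 \<noteq> 1"
  defines "c \<equiv> 1 / (l2 * lambda_u l1 l2)"
  shows "C_u l1 l2 Eu Es E1 E0 f n * pairing c Eu =
    scaling_defect c (lev l1 l2 (Suc (2 * n))) (renorm_iter l1 l2 (2 * n) f)"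
proof -
  let ?B = "{Eu, Es, E1, E0}" and ?w = "wvec l1 l2 f (2 * n)"
  have i: "independent ?B" and d: "distinct [Eu, Es, E1, E0]" using B by (auto simp: eigenbasis_def)
  have "card ?B = 4" using d by simp
  then have "span ?B = UNIV" using card_eq_dim[of ?B UNIV] i by (auto simp: dim_UNIV)
  then have "?w = (\<Sum>b\<in>?B. representation ?B ?w b *\<^sub>R b)"
    using sum_representation_eq[OF i, of ?w ?B] by simp
  also have "\<dots> = representation ?B ?w Eu *\<^sub>R Eu + (representation ?B ?w Es *\<^sub>R Es
      + (representation ?B ?w E1 *\<^sub>R E1 + representation ?B ?w E0 *\<^sub>R E0))" using d by simp
  finally have w: "?w = representation ?B ?w Eu *\<^sub>R Eu + (representation ?B ?w Es *\<^sub>R Es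
      + (representation ?B ?w E1 *\<^sub>R E1 + representation ?B ?w E0 *\<^sub>R E0))" .
  have "pairing c ?w = representation ?B ?w Eu * pairing c Eu + (representation ?B ?w Es * pairing c Es
      + (representation ?B ?w E1 * pairing c E1 + representation ?B ?w E0 * pairing c E0))"
    by (subst w) (simp only: pairing_linear)
  moreover have "lambda_u l1 l2 \<noteq> 0" using lambda_u_facts(2)[OF l] by auto
  moreover have "pairing c Es = 0" "pairing c E1 = 0" "pairing c E0 = 0"
    unfolding c_def using B n1 calculation(2) lambda_u_facts(2,3)[OF l] pairing_eigenvector_zero[OF l, of Es "lambda_s l1 l2"]
      pairing_eigenvector_zero[OF l, of E1 1] pairing_eigenvector_zero[OF l, of E0 0]
    by (auto simp: eigenbasis_def)
  moreover have "pairing c ?w = scaling_defect c (lev l1 l2 (Suc (2 * n))) (renorm_iter l1 l2 (2 * n) f)"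
    by (simp add: pairing_def wvec_def Let_def scaling_defect_def right_diff_distrib)
  ultimately show ?thesis by (simp add: C_u_def)
qed

lemma not_bounded_above_limsup:
  fixes x :: "nat \<Rightarrow> real"
  assumes "\<not> limsup (\<lambda>n. ereal (x n)) = \<infinity>"
  shows "\<exists>M N. \<forall>n\<ge>N. x n \<le> M"
proof -
  obtain M where "limsup (\<lambda>n. ereal (x n)) < ereal M"
    using assms by (metis ereal_infty_less(1) less_PInf_Ex_of_nat)
  then have "eventually (\<lambda>n. ereal (x n) < ereal M) sequentially" by (rule Limsup_lessD)
  then show ?thesis by (auto simp: eventually_sequentially intro: less_imp_le)
qed

theorem theoremA:
  fixes l1 l2 \<delta> :: real and Eu Es E1 E0 :: "real ^ 4"
  assumes "1 \<le> l1" and "1 \<le> l2" and "0 < \<delta>"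
    and "eigenbasis l1 l2 Eu Es E1 E0"
  shows "((l1, l2) \<in> Q_plus \<longrightarrow>
            (\<forall>f \<in> Fibonacci_maps_bd l1 l2 \<delta>. bounded_renorm l1 l2 Eu Es E1 E0 f)) \<and>
         ((l1, l2) \<in> Q_minus \<longrightarrow>
            (\<forall>f \<in> Fibonacci_maps_bd l1 l2 \<delta>.
               bounded_renorm l1 l2 Eu Es E1 E0 f \<or> degenerate_renorm l1 l2 Eu Es E1 E0 f) \<and>
            (\<exists>K > 0. \<forall>f \<in> Fibonacci_maps_bd l1 l2 \<delta>.
               K \<le> C_u l1 l2 Eu Es E1 E0 f 0 \<longrightarrow> degenerate_renorm l1 l2 Eu Es E1 E0 f))"
proof -
  define c where "c = 1 / (l2 * lambda_u l1 l2)"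
  note l = assms(1,2) and B = assms(4)
  note lf = lambda_u_facts[OF l]
  have c: "0 < c" "c < 1" using lf(2) by (auto simp: c_def)
  have neg: "pairing c Eu < 0" unfolding c_def using B by (intro pairing_Eu_neg l) (auto simp: eigenbasis_def)
  have bd: "bounded_renorm l1 l2 Eu Es E1 E0 f" if Q: "(l1, l2) \<in> Q_plus" and f: "f \<in> Fibonacci_maps_bd l1 l2 \<delta>" for f
  proof -
    have q: "lambda_u l1 l2 < 1" using Q by (simp add: Q_plus_def)
    have f': "f \<in> Fibonacci_maps l1 l2" using f by (simp add: Fibonacci_maps_bd_def)
    obtain D where D: "\<And>n. 3 \<le> n \<Longrightarrow> D \<le> scaling_defect c (lev l1 l2 (Suc n)) (renorm_iter l1 l2 n f)"
      using scaling_defect_bounded_below[OF l f' lf(5)[OF q] c] by blast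
    have "C_u l1 l2 Eu Es E1 E0 f n \<le> D / pairing c Eu" if "2 \<le> n" for n
      using C_u_eq[OF l B, folded c_def, of f n] D[of "2 * n"] q that neg
      by (simp add: neg_le_divide_eq)
    then have "eventually (\<lambda>n. ereal (C_u l1 l2 Eu Es E1 E0 f n) \<le> ereal (D / pairing c Eu)) sequentially"
      by (auto simp: eventually_sequentially)
    then have "limsup (\<lambda>n. ereal (C_u l1 l2 Eu Es E1 E0 f n)) \<le> ereal (D / pairing c Eu)"
      by (rule Limsup_bounded)
    then show ?thesis by (auto simp: bounded_renorm_def)
  qed
  have dg: "degenerate_renorm l1 l2 Eu Es E1 E0 f" if Q: "(l1, l2) \<in> Q_minus" and f: "f \<in> Fibonacci_maps_bd l1 l2 \<delta>" for f
  proof (rule ccontr)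
    have q: "1 < lambda_u l1 l2" using Q by (simp add: Q_minus_def)
    have f': "f \<in> Fibonacci_maps l1 l2" using f by (simp add: Fibonacci_maps_bd_def)
    assume "\<not> degenerate_renorm l1 l2 Eu Es E1 E0 f"
    then obtain M N where M: "\<And>n. N \<le> n \<Longrightarrow> C_u l1 l2 Eu Es E1 E0 f n \<le> M"
      using not_bounded_above_limsup[of "C_u l1 l2 Eu Es E1 E0 f"] by (auto simp: degenerate_renorm_def)
    have "M * pairing c Eu \<le> scaling_defect c (lev l1 l2 (Suc (2 * n))) (renorm_iter l1 l2 (2 * n) f)" if "N \<le> n" for n
      using C_u_eq[OF l B, folded c_def, of f n] mult_right_mono_neg[OF M[OF that], of "pairing c Eu"] q neg by simp
    then show False using scaling_defect_not_bounded_below[OF l f' lf(4)[OF q] c] by blast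
  qed
  show ?thesis using bd dg by (auto intro: exI[of _ 1])
qed

end
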